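(* Let $k,\ell\in\mathbb{N}$, let $W$ be an $N\times N$ GUE matrix, and let $A_1,\dots,A_{k+\ell}\in\mathbb{C}^{N\times N}$ be deterministic matrices with $\|A_j\|\lesssim1$ (operator norms bounded uniformly in $N$). Put $$Y_\alpha=\langle WA_1\cdots WA_k\rangle-\mathbb{E}\langle WA_1\cdots WA_k\rangle,\qquad Y_\beta=\langle WA_{k+1}\cdots WA_{k+\ell}\rangle-\mathbb{E}\langle WA_{k+1}\cdots WA_{k+\ell}\rangle.$$ Then $$\lim_{N\to\infty}\Big(N^2\,\mathbb{E}\big(Y_\alpha Y_\beta\big)-\sum_{\pi\in\overrightarrow{NCP}_2(k,\ell)}\prod_{B\in K(\pi)}\Big\langle\prod_{j\in B}A_j\Big\rangle\Big)=0,$$ where $\overrightarrow{NCP}_2(k,\ell)$ denotes the set of pairings in $\overrightarrow{NCP}(k,\ell)$, i.e. of those annular non-crossing permutations all of whose cycles have length two.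
   Context: $\langle A\rangle=N^{-1}\mathrm{Tr}\,A$. The GUE matrix is normalized so that $\mathbb{E}|W_{ij}|^2=1/N$. Annular non-crossing permutations. The $(k,\ell)$-annulus has labels $1,\dots,k$ clockwise on the outer circle and $k+1,\dots,k+\ell$ counter-clockwise on the inner circle. $\overrightarrow{NCP}(k,\ell)$ is the set of permutations of $\{1,\dots,k+\ell\}$ whose cycles can be drawn in the annulus such that (i) cycles do not cross, (ii) each cycle encloses a region in the annulus homeomorphic to the disk with boundary oriented clockwise, (iii) at least one cycle connects both circles. The annular Kreweras complement $K(\pi)\in\overrightarrow{NCP}(k,\ell)$ is the maximal annular non-crossing permutation that can be drawn on the labels of the arcs (arc $s$ follows point $s$ in the orientation of its circle) without intersecting the cycles of $\pi$; equivalently $K(\pi)=\pi^{-1}\circ\gamma$ with $\gamma=(1\,2\cdots k)(k+1\cdots k+\ell)$. "$B\in K(\pi)$" denotes a cycle, and the matrix product over $B$ is taken in the cyclic order of the cycle. *)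

theory Defs
  imports
    "HOL-Complex_Analysis.Complex_Analysis"
    "HOL-Probability.Probability"
    "HOL-Combinatorics.Combinatorics"
    "Jordan_Normal_Form.Schur_Decomposition"
begin

section \<open>Matrices\<close>

definition ntrace :: "complex mat \<Rightarrow> complex" where
  "ntrace A = (\<Sum>i<dim_row A. A $$ (i, i)) / of_nat (dim_row A)"

definition euclidean_norm :: "complex vec \<Rightarrow> real" where
  "euclidean_norm v = sqrt (\<Sum>i<dim_vec v. (cmod (vec_index v i))\<^sup>2)"

definition operator_norm :: "complex mat \<Rightarrow> real" where
  "operator_norm A =
     Sup {euclidean_norm (A *\<^sub>v v) | v. v \<in> carrier_vec (dim_col A) \<and> euclidean_norm v \<le> 1}"

text \<open>Ordered product of a list of square matrices of size \<open>N\<close>.\<close>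

definition mat_prod_list :: "nat \<Rightarrow> complex mat list \<Rightarrow> complex mat" where
  "mat_prod_list N As = foldr (*) As (1\<^sub>m N)"

section \<open>The Gaussian unitary ensemble\<close>

text \<open>
  The index pair \<open>(i, j)\<close> selects the \<open>N\<^sup>2\<close> independent real degrees of freedom of a Hermitian
  matrix: the diagonal entry if \<open>i = j\<close>, the real part of the entry \<open>(i, j)\<close> if \<open>i < j\<close>, and the
  imaginary part of the entry \<open>(j, i)\<close> if \<open>j < i\<close>.
\<close>

definition hermitian_coord :: "complex mat \<Rightarrow> nat \<times> nat \<Rightarrow> real" where
  "hermitian_coord H = (\<lambda>(i, j). if i \<le> j then Re (H $$ (i, j)) else Im (H $$ (j, i)))"

text \<open>
  The second parameter of \<^const>\<open>normal_density\<close> is the standard deviation. Real and imaginary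
  parts of an off-diagonal entry have variance \<open>1 / (2 N)\<close> each, the diagonal entries have variance
  \<open>1 / N\<close>, so that every entry has absolute second moment \<open>1 / N\<close>.
\<close>

definition GUE :: "nat \<Rightarrow> 'w measure \<Rightarrow> ('w \<Rightarrow> complex mat) \<Rightarrow> bool" where
  "GUE N M W \<longleftrightarrow>
     prob_space M \<and>
     (\<forall>\<omega>\<in>space M. W \<omega> \<in> carrier_mat N N \<and> mat_adjoint (W \<omega>) = W \<omega>) \<and>
     (\<forall>i<N. \<forall>j<N. distributed M lborel (\<lambda>\<omega>. hermitian_coord (W \<omega>) (i, j))
        (normal_density 0 (if i = j then sqrt (1 / real N) else sqrt (1 / (2 * real N))))) \<and>
     prob_space.indep_vars M (\<lambda>_. borel) (\<lambda>p \<omega>. hermitian_coord (W \<omega>) p) ({..<N} \<times> {..<N})"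

text \<open>\<open>word_trace N H As\<close> is the normalised trace of \<open>H A\<^sub>1 H A\<^sub>2 \<dots>\<close> for \<open>As = [A\<^sub>1, A\<^sub>2, \<dots>]\<close>.\<close>

definition word_trace :: "nat \<Rightarrow> complex mat \<Rightarrow> complex mat list \<Rightarrow> complex" where
  "word_trace N H As = ntrace (mat_prod_list N (map (\<lambda>A. H * A) As))"

definition centred :: "'w measure \<Rightarrow> ('w \<Rightarrow> complex) \<Rightarrow> 'w \<Rightarrow> complex" where
  "centred M X = (\<lambda>\<omega>. X \<omega> - integral\<^sup>L M X)"

section \<open>Cycles of permutations\<close>

text \<open>The supports of the cycles of \<open>p\<close> on \<open>S\<close>, fixed points included.\<close>

definition cycle_sets :: "'a set \<Rightarrow> ('a \<Rightarrow> 'a) \<Rightarrow> 'a set set" where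
  "cycle_sets S p = orbit p ` S"

text \<open>
  \<open>\<langle>A\<^sub>b A\<^bsub>p b\<^esub> A\<^bsub>p (p b)\<^esub> \<dots>\<rangle>\<close> along the cycle of \<open>p\<close> with support \<open>B\<close>. Starting at \<open>b = Min B\<close> is
  an arbitrary choice, as the trace is invariant under cyclic shifts.
\<close>

definition cycle_ntrace :: "nat \<Rightarrow> (nat \<Rightarrow> complex mat) \<Rightarrow> (nat \<Rightarrow> nat) \<Rightarrow> nat set \<Rightarrow> complex" where
  "cycle_ntrace N A p B =
     ntrace (mat_prod_list N (map (\<lambda>i. A ((p ^^ i) (Min B))) [0..<card B]))"

section \<open>Annular non-crossing permutations\<close>

definition annulus :: "complex set" where
  "annulus = {z. 1 \<le> cmod z \<and> cmod z \<le> 2}"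

text \<open>
  Labels \<open>1, \<dots>, k\<close> are placed clockwise on the outer circle, labels \<open>k + 1, \<dots>, k + l\<close>
  counter-clockwise on the inner circle.
\<close>

definition label_point :: "nat \<Rightarrow> nat \<Rightarrow> nat \<Rightarrow> complex" where
  "label_point k l j =
     (if j \<le> k then 2 * cis (- 2 * pi * real j / real k)
      else cis (2 * pi * real (j - k) / real l))"

text \<open>
  The loop \<open>g\<close> draws the cycle of \<open>p\<close> with support \<open>C\<close>: it is a simple closed curve in the annulus,
  it encloses a disk inside the annulus (so it does not wind around the hole), it is oriented
  clockwise, and it visits the labels of \<open>C\<close> in the cyclic order given by \<open>p\<close>. A cycle of
  length two is drawn as a loop as well, i.e. as a thickened arc.
\<close>

definition draws_cycle ::
    "nat \<Rightarrow> nat \<Rightarrow> (nat \<Rightarrow> nat) \<Rightarrow> nat set \<Rightarrow> (real \<Rightarrow> complex) \<Rightarrow> bool" where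
  "draws_cycle k l p C g \<longleftrightarrow>
     simple_path g \<and> pathfinish g = pathstart g \<and> path_image g \<subseteq> annulus \<and>
     inside (path_image g) \<subseteq> annulus \<and>
     inside (path_image g) homeomorphic ball (0 :: complex) 1 \<and>
     (\<forall>z\<in>inside (path_image g). winding_number g z = -1) \<and>
     (\<exists>a\<in>C. \<exists>t. strict_mono_on {..<card C} t \<and> t ` {..<card C} \<subseteq> {0..<1} \<and>
        (\<forall>i<card C. g (t i) = label_point k l ((p ^^ i) a)))"

text \<open>
  Disjointness of the loops expresses that the cycles do not cross: the disk enclosed by a loop is
  an open subset of the plane inside the annulus, so it contains no label and loops cannot be
  nested either.
\<close>

definition annular_NCP :: "nat \<Rightarrow> nat \<Rightarrow> (nat \<Rightarrow> nat) set" where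
  "annular_NCP k l = {p. p permutes {1..k + l} \<and>
     (\<exists>g. (\<forall>C\<in>cycle_sets {1..k + l} p. draws_cycle k l p C (g C)) \<and>
          disjoint_family_on (\<lambda>C. path_image (g C)) (cycle_sets {1..k + l} p)) \<and>
     (\<exists>C\<in>cycle_sets {1..k + l} p. C \<inter> {1..k} \<noteq> {} \<and> C \<inter> {k + 1..k + l} \<noteq> {})}"

definition annular_NCP2 :: "nat \<Rightarrow> nat \<Rightarrow> (nat \<Rightarrow> nat) set" where
  "annular_NCP2 k l = {p \<in> annular_NCP k l. \<forall>C\<in>cycle_sets {1..k + l} p. card C = 2}"

text \<open>\<open>(1 2 \<dots> k) (k + 1 \<dots> k + l)\<close>\<close>

definition annular_rotation :: "nat \<Rightarrow> nat \<Rightarrow> nat \<Rightarrow> nat" where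
  "annular_rotation k l = cycle_of_list [1..<k + 1] \<circ> cycle_of_list [k + 1..<k + l + 1]"

definition annular_Kreweras :: "nat \<Rightarrow> nat \<Rightarrow> (nat \<Rightarrow> nat) \<Rightarrow> nat \<Rightarrow> nat" where
  "annular_Kreweras k l p = inv_into UNIV p \<circ> annular_rotation k l"

end

theory Submission
  imports Defs
begin

text \<open>
Let \<open>\<gamma>\<close> be the rotation of the annulus. Both halves of the proof, a probabilistic and a topological
one, lead to the number of cycles of \<open>p \<circ> \<gamma>\<close> for a pairing \<open>p\<close> of the \<open>k + l\<close> labels.

Probability. Write each trace as a sum over one index per factor. Wick's formula for the entries
of a GUE matrix (\<open>GUE_wick\<close>, from Gaussian integration by parts) turns the expectation of the
product of both traces into a sum over all pairings, in which \<open>p\<close> contributes the normalised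
traces along the cycles of \<open>p \<circ> \<gamma>\<close> times a power of \<open>N\<close> (\<open>trace_expansion\<close>,
\<open>expectation_trace_product\<close>). The product of the two expectations consists of the pairings that do
not connect the circles, so the covariance is the sum over the linking pairings
(\<open>covariance_formula\<close>). After multiplication by \<open>N\<^sup>2\<close> the power of \<open>N\<close> is
\<open>(number of cycles of p \<circ> \<gamma>) - (k + l) / 2\<close>. As the normalised traces stay bounded, only linking
pairings with exponent \<open>0\<close> survive, provided that no exponent is positive.

Topology. It remains to show that a linking pairing has at most \<open>(k + l) / 2\<close> cycles
(\<open>linked_cycle_bound\<close>), with equality iff it can be drawn in the annulus (\<open>annular_NCP2_eq\<close>). The tool
is the removal of a pair \<open>{x, \<gamma> x}\<close> that is adjacent on its circle: \<open>x\<close> is then a fixed point of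
\<open>p \<circ> \<gamma>\<close>, and two labels and exactly one cycle disappear. Once no adjacent pair is left, \<open>p \<circ> \<gamma>\<close> has
no fixed points, so its cycles number at most half of the labels, with equality iff it is an
involution, that is, iff \<open>p\<close> conjugates \<open>\<gamma>\<close> to its inverse. These are the spoke diagrams.

If a drawing without adjacent pairs is given, it is lifted by the exponential map to a strip, where
the Fashoda theorem shows that an arch traps the partners of all labels below it and that paths
across the strip keep their order; so the drawing is a spoke diagram. Conversely, a spoke diagram is
drawn by straight segments in the strip, and an adjacent pair is added as an arch that is thin enough
to stay clear of everything drawn before.
\<close>

section \<open>Cycles of permutations and the removal of points\<close>

lemma orbit_self: "finite S \<Longrightarrow> f permutes S \<Longrightarrow> x \<in> orbit f x"
  by (meson permutation_permutes permutation_self_in_orbit)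

lemma orbit_eq_if_mem:
  assumes "finite S" "f permutes S" "z \<in> orbit f x"
  shows "orbit f z = orbit f x"
proof
  show "orbit f z \<subseteq> orbit f x" using assms(3) by (auto intro: orbit_trans)
  have "x \<in> orbit f z"
    using assms by (meson orbit_swap orbit_self)
  then show "orbit f x \<subseteq> orbit f z" by (auto intro: orbit_trans)
qed

lemma sum_card_cycle_sets:
  assumes "finite S" "f permutes S"
  shows "(\<Sum>C\<in>cycle_sets S f. card C) = card S"
proof -
  have "card (\<Union>(cycle_sets S f)) = (\<Sum>C\<in>cycle_sets S f. card C)"
  proof (rule card_Union_disjoint)
    show "pairwise disjnt (cycle_sets S f)"
    proof (rule pairwiseI)
      fix C D assume "C \<in> cycle_sets S f" "D \<in> cycle_sets S f" "C \<noteq> D"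
      then show "disjnt C D"
        unfolding cycle_sets_def disjnt_def using orbit_eq_if_mem[OF assms] by blast
    qed
    show "finite C" if "C \<in> cycle_sets S f" for C
      using that permutes_orbit_subset[OF assms(2)] assms(1) by (auto simp: cycle_sets_def intro: finite_subset)
  qed
  moreover have "\<Union>(cycle_sets S f) = S"
    using orbit_self[OF assms] permutes_orbit_subset[OF assms(2)] by (auto simp: cycle_sets_def)
  ultimately show ?thesis by simp
qed

lemma cycle_sets_cong:
  assumes "f permutes S" "\<And>x. x \<in> S \<Longrightarrow> f x = g x"
  shows "cycle_sets S f = cycle_sets S g"
proof -
  have "f \<in> S \<rightarrow> S" using assms(1) by (auto simp: permutes_in_image)
  then show ?thesis
    unfolding cycle_sets_def using assms(2) by (intro image_cong refl orbit_cong0[where A = S]) auto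
qed

lemma card_cycle_ge_2:
  assumes "finite S" "f permutes S" "x \<in> S" "f x \<noteq> x"
  shows "2 \<le> card (orbit f x)"
proof -
  have "{x, f x} \<subseteq> orbit f x" using orbit_self[OF assms(1,2)] by (auto intro: orbit.base)
  moreover have "finite (orbit f x)" using permutes_orbit_subset[OF assms(2,3)] assms(1) finite_subset by blast
  ultimately show ?thesis using assms(4) card_mono[of "orbit f x" "{x, f x}"] by auto
qed

lemma card_orbit_eq_2_iff:
  assumes "finite S" "f permutes S" "x \<in> S"
  shows "card (orbit f x) = 2 \<longleftrightarrow> f x \<noteq> x \<and> f (f x) = x"
proof
  assume c: "card (orbit f x) = 2"
  have "f x \<noteq> x"
  proof
    assume "f x = x"
    then have "orbit f x = {x}" by (simp add: orbit_eq_singleton_iff)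
    with c show False by simp
  qed
  moreover have "{x, f x} = orbit f x"
    using orbit_self[OF assms(1,2)] c \<open>f x \<noteq> x\<close>
    by (intro card_subset_eq) (auto intro: orbit.base card_ge_0_finite)
  moreover have "f (f x) \<in> orbit f x" by (intro orbit.intros)
  moreover have "f (f x) \<noteq> f x" using \<open>f x \<noteq> x\<close> assms(2) by (simp add: permutes_def) (metis assms(2) permutes_inj injD)
  ultimately show "f x \<noteq> x \<and> f (f x) = x" by auto
next
  assume *: "f x \<noteq> x \<and> f (f x) = x"
  have "orbit f x \<subseteq> {x, f x}"
  proof
    fix y assume "y \<in> orbit f x"
    then show "y \<in> {x, f x}" by induction (use * in auto)
  qed
  then have "orbit f x = {x, f x}" using orbit_self[OF assms(1,2)] by (auto intro: orbit.base)
  moreover have "card {x, f x} = 2" using * by (metis card_2_iff)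
  ultimately show "card (orbit f x) = 2" by simp
qed

text \<open>
Without fixed points every cycle has at least two elements, and in the extremal case exactly two.
\<close>

lemma no_fixed_point_count:
  assumes "finite S" "f permutes S" "\<And>x. x \<in> S \<Longrightarrow> f x \<noteq> x"
  shows "2 * card (cycle_sets S f) \<le> card S"
    and "2 * card (cycle_sets S f) = card S \<longleftrightarrow> (\<forall>x\<in>S. f (f x) = x)"
proof -
  have fin: "finite (cycle_sets S f)" using assms(1) by (simp add: cycle_sets_def)
  have ge: "2 \<le> card C" if "C \<in> cycle_sets S f" for C
    using that card_cycle_ge_2[OF assms(1,2)] assms(3) by (auto simp: cycle_sets_def)
  have sum2: "2 * card (cycle_sets S f) = (\<Sum>C\<in>cycle_sets S f. 2)" by simp
  show "2 * card (cycle_sets S f) \<le> card S"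
    unfolding sum2 sum_card_cycle_sets[OF assms(1,2), symmetric] by (rule sum_mono) (rule ge)
  have "2 * card (cycle_sets S f) = card S \<longleftrightarrow> (\<forall>C\<in>cycle_sets S f. 2 = card C)"
    unfolding sum2 sum_card_cycle_sets[OF assms(1,2), symmetric]
    using ge sum_mono_inv[of "\<lambda>_. 2" "cycle_sets S f" card] fin by (metis sum.cong)
  also have "\<dots> \<longleftrightarrow> (\<forall>x\<in>S. f (f x) = x)"
    using card_orbit_eq_2_iff[OF assms(1,2)] assms(3) by (auto simp: cycle_sets_def)
  finally show "2 * card (cycle_sets S f) = card S \<longleftrightarrow> (\<forall>x\<in>S. f (f x) = x)" .
qed

text \<open>
Cuts \<open>a\<close> out of its cycle and leaves it as a fixed point.
\<close>

definition skip :: "('a \<Rightarrow> 'a) \<Rightarrow> 'a \<Rightarrow> 'a \<Rightarrow> 'a" where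
  "skip f a = Transposition.transpose a (f a) \<circ> f"

lemma skip_simps:
  assumes "f permutes S"
  shows "skip f a a = a" "f z = a \<Longrightarrow> skip f a z = f a" "z \<noteq> a \<Longrightarrow> f z \<noteq> a \<Longrightarrow> skip f a z = f z"
  using permutes_inj[OF assms] by (auto simp: skip_def Transposition.transpose_def dest: injD)

lemma skip_permutes:
  assumes "f permutes S" "a \<in> S"
  shows "skip f a permutes S - {a}"
proof -
  have "skip f a permutes S" unfolding skip_def
    using assms by (intro permutes_compose permutes_swap_id) (auto simp: permutes_in_image)
  then show ?thesis
    by (rule permutes_superset) (use skip_simps(1)[OF assms(1)] in auto)
qed

lemma orbit_skip:
  assumes f: "finite S" "f permutes S" and "a \<in> S" "z \<noteq> a"
  shows "orbit (skip f a) z = orbit f z - {a}"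
proof
  note s = skip_simps[OF f(2)]
  have ne: "skip f a w \<noteq> a" if "w \<noteq> a" for w
    using s(1)[of a] that permutes_inj[OF skip_permutes[OF f(2) \<open>a \<in> S\<close>]] by (metis injD)
  show "orbit (skip f a) z \<subseteq> orbit f z - {a}"
  proof
    fix w assume "w \<in> orbit (skip f a) z"
    then show "w \<in> orbit f z - {a}"
    proof induction
      case base
      have "skip f a z \<in> orbit f z"
        using s(2)[of z a] s(3)[of z a] \<open>z \<noteq> a\<close> orbit.base[of f z] orbit.step[of _ f z] by (cases "f z = a") auto
      then show ?case using ne \<open>z \<noteq> a\<close> by auto
    next
      case (step y)
      have "skip f a y \<in> orbit f z"
        using s(2)[of y a] s(3)[of y a] step orbit.base[of f z] orbit.step[of _ f z] by (cases "f y = a") auto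
      then show ?case using ne step by auto
    qed
  qed
  show "orbit f z - {a} \<subseteq> orbit (skip f a) z"
  proof (cases "f a = a")
    case True
    then have "skip f a = f" by (auto simp: skip_def)
    then show ?thesis by auto
  next
    case False
    let ?O = "orbit (skip f a) z"
    have "(w \<noteq> a \<and> w \<in> ?O) \<or> (w = a \<and> f a \<in> ?O)" if "w \<in> orbit f z" for w
      using that
    proof induction
      case base
      then show ?case using s(2)[of z a] s(3)[of z a] \<open>z \<noteq> a\<close> orbit.base[of "skip f a" z]
        by (cases "f z = a") auto
    next
      case (step y)
      then show ?case
        using False s(2)[of y a] s(3)[of y a] orbit.step[of y "skip f a" z]
        by (cases "f y = a") auto
    qed
    then show ?thesis by auto
  qed
qed

lemma cycle_sets_skip:
  assumes f: "finite S" "f permutes S" and "a \<in> S" and ne: "f a \<noteq> a"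
  shows "cycle_sets (S - {a}) (skip f a) = (\<lambda>C. C - {a}) ` cycle_sets S f"
    and "inj_on (\<lambda>C. C - {a}) (cycle_sets S f)"
proof -
  have "f a \<in> S - {a}" using ne \<open>a \<in> S\<close> f(2) by (simp add: permutes_in_image)
  moreover have "orbit f a = orbit f (f a)"
    using orbit_eq_if_mem[OF f orbit.base[of f a]] by simp
  ultimately have S: "cycle_sets S f = orbit f ` (S - {a})"
    unfolding cycle_sets_def using \<open>a \<in> S\<close> by auto
  show "cycle_sets (S - {a}) (skip f a) = (\<lambda>C. C - {a}) ` cycle_sets S f"
    unfolding S unfolding cycle_sets_def image_image using orbit_skip[OF f \<open>a \<in> S\<close>] by (intro image_cong) auto
  show "inj_on (\<lambda>C. C - {a}) (cycle_sets S f)"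
  proof (rule inj_onI)
    fix C D assume "C \<in> cycle_sets S f" "D \<in> cycle_sets S f" and CD: "C - {a} = D - {a}"
    then obtain x y where x: "x \<noteq> a" "C = orbit f x" and y: "y \<noteq> a" "D = orbit f y"
      unfolding S by auto
    then have "x \<in> orbit f y" using orbit_self[OF f, of x] CD by auto
    then show "C = D" using orbit_eq_if_mem[OF f] x y by blast
  qed
qed

lemma card_cycle_sets_skip:
  assumes f: "finite S" "f permutes S" and "a \<in> S"
  shows "card (cycle_sets S f) = card (cycle_sets (S - {a}) (skip f a)) + (if f a = a then 1 else 0)"
proof (cases "f a = a")
  case True
  then have "skip f a = f" by (auto simp: skip_def)
  have "cycle_sets S f = insert {a} (cycle_sets (S - {a}) f)"
    using \<open>a \<in> S\<close> True orbit_eq_singleton_iff[of f a] by (auto simp: cycle_sets_def)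
  moreover have "{a} \<notin> cycle_sets (S - {a}) f"
  proof
    assume "{a} \<in> cycle_sets (S - {a}) f"
    then obtain z where "z \<noteq> a" "orbit f z = {a}" by (auto simp: cycle_sets_def)
    then show False using orbit_self[OF f, of z] by auto
  qed
  ultimately show ?thesis using True \<open>skip f a = f\<close> f(1) by (simp add: cycle_sets_def)
next
  case False
  then show ?thesis using cycle_sets_skip[OF f \<open>a \<in> S\<close>] by (simp add: card_image)
qed

section \<open>Pairings and adjacent pairs\<close>

definition pairings :: "'a set \<Rightarrow> ('a \<Rightarrow> 'a) set" where
  "pairings S = {p. p permutes S \<and> (\<forall>x\<in>S. p x \<noteq> x \<and> p (p x) = x)}"

lemma pairingsD:
  assumes "p \<in> pairings S"
  shows "p permutes S" "\<And>x. x \<in> S \<Longrightarrow> p x \<in> S" "\<And>x. x \<in> S \<Longrightarrow> p x \<noteq> x" "\<And>x. p (p x) = x"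
proof -
  show *: "p permutes S" using assms by (simp add: pairings_def)
  show "p x \<in> S" if "x \<in> S" for x using * that by (simp add: permutes_in_image)
  show "p x \<noteq> x" if "x \<in> S" for x using assms that by (simp add: pairings_def)
  show "p (p x) = x" for x using assms * by (cases "x \<in> S") (auto simp: pairings_def permutes_def)
qed

lemma pairings_remove:
  assumes p: "p \<in> pairings S" and a: "a \<in> S"
  defines "q \<equiv> Transposition.transpose a (p a) \<circ> p"
  shows "q \<in> pairings (S - {a} - {p a})" "\<And>z. z \<in> S - {a} - {p a} \<Longrightarrow> q z = p z"
proof -
  note P = pairingsD[OF p]
  let ?S = "S - {a} - {p a}"
  have in_S: "p z \<in> ?S \<longleftrightarrow> z \<in> ?S" for z
  proof -
    have "p z = a \<longleftrightarrow> z = p a" "p z = p a \<longleftrightarrow> z = a" using P(4) by metis+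
    moreover have "p z \<in> S \<longleftrightarrow> z \<in> S" using P(1) by (simp add: permutes_in_image)
    ultimately show ?thesis by auto
  qed
  show eq: "q z = p z" if "z \<in> ?S" for z
    using that in_S[of z] by (auto simp: q_def Transposition.transpose_def)
  have "q permutes S" unfolding q_def using P(1,2) a by (intro permutes_compose permutes_swap_id) auto
  then have "q permutes ?S"
    by (rule permutes_superset) (use P(4)[of a] in \<open>auto simp: q_def\<close>)
  then show "q \<in> pairings ?S"
    using eq in_S P(3,4) by (auto simp: pairings_def)
qed

text \<open>
For the rotation of the annulus, with the two circles as colours, this says that some pair joins the
circles. Asking for a link in every orbit, instead of for transitivity on the circles, gives a
condition that is inherited when labels are removed.
\<close>

definition linked :: "'a set \<Rightarrow> ('a \<Rightarrow> 'a) \<Rightarrow> ('a \<Rightarrow> 'a) \<Rightarrow> ('a \<Rightarrow> 'b) \<Rightarrow> bool" where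
  "linked S \<gamma> p r \<longleftrightarrow> (\<forall>z\<in>S. r (\<gamma> z) = r z) \<and> (\<forall>z\<in>S. \<exists>w\<in>orbit \<gamma> z. r (p w) \<noteq> r w)"

text \<open>
The adjacent label \<open>x\<close> is a fixed point of \<open>p \<circ> \<gamma>\<close>, so cutting it out removes one cycle. Cutting out
\<open>y\<close> merely shortens the cycle of \<open>y\<close>: otherwise \<open>p \<circ> \<gamma>\<close> would fix \<open>y\<close> too, \<open>{x, y}\<close> would be an orbit
of \<open>\<gamma>\<close>, and this orbit would contain no link.
\<close>

lemma remove_adjacent_pair:
  assumes fin: "finite S" and g: "\<gamma> permutes S" and p: "p \<in> pairings S"
    and linked: "linked S \<gamma> p r" and x: "x \<in> S" and adj: "p (\<gamma> x) = x"
  defines "y \<equiv> \<gamma> x"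
  defines "S' \<equiv> S - {x} - {y}" and "\<gamma>' \<equiv> skip (skip \<gamma> x) y" and "p' \<equiv> Transposition.transpose x y \<circ> p"
  shows "y \<in> S" "y \<noteq> x" "p x = y" "p y = x" "S = insert x (insert y S')"
    "card S = card S' + 2" "p' \<in> pairings S'" "\<And>z. z \<in> S' \<Longrightarrow> p' z = p z" "linked S' \<gamma>' p' r"
    "card (cycle_sets S (p \<circ> \<gamma>)) = card (cycle_sets S' (p' \<circ> \<gamma>')) + 1"
proof -
  note P = pairingsD[OF p]
  show yS: "y \<in> S" using g x by (simp add: y_def permutes_in_image)
  show py: "p y = x" using adj by (simp add: y_def)
  then show px: "p x = y" using P(4)[of y] by simp
  then show yx: "y \<noteq> x" using P(3)[OF x] by auto
  have r: "r (\<gamma> z) = r z" if "z \<in> S" for z using linked that by (simp add: linked_def)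
  have ry: "r y = r x" using r[OF x] by (simp add: y_def)
  have thr: "\<exists>w\<in>orbit \<gamma> z. r (p w) \<noteq> r w" if "z \<in> S" for z using linked that by (simp add: linked_def)
  have gy: "\<gamma> y \<noteq> x"
  proof
    assume "\<gamma> y = x"
    have "w \<in> {x, y}" if "w \<in> orbit \<gamma> x" for w
      using that by induction (use \<open>\<gamma> y = x\<close> in \<open>auto simp: y_def\<close>)
    then show False using thr[OF x] ry px py by force
  qed
  show S: "S = insert x (insert y S')" using x yS by (auto simp: S'_def)
  have fS': "finite S'" using fin by (simp add: S'_def)
  have "x \<notin> S'" "y \<notin> S'" by (auto simp: S'_def)
  then have "card (insert x (insert y S')) = card S' + 2" using fS' yx by simp
  then show "card S = card S' + 2" using S by metis
  show p'pair: "p' \<in> pairings S'" and p'eq: "\<And>z. z \<in> S' \<Longrightarrow> p' z = p z"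
    using pairings_remove[OF p x] by (simp_all add: px p'_def S'_def)
  have g1: "skip \<gamma> x permutes S - {x}" by (rule skip_permutes[OF g x])
  have y1: "y \<in> S - {x}" using yS yx by simp
  have g': "\<gamma>' permutes S'" unfolding \<gamma>'_def S'_def by (rule skip_permutes[OF g1 y1])
  note s1 = skip_simps[OF g] and s2 = skip_simps[OF g1]
  have inj: "\<gamma> z = y \<longleftrightarrow> z = x" for z using permutes_inj[OF g] by (auto simp: y_def dest: injD)
  have s1y: "skip \<gamma> x y = \<gamma> y" using s1(3)[of y x] yx gy by simp
  have g'eq: "\<gamma>' z = (if \<gamma> z = x then \<gamma> y else \<gamma> z)" if "z \<in> S'" for z
  proof (cases "\<gamma> z = x")
    case True
    then have "skip \<gamma> x z = y" using s1(2)[of z x] by (simp add: y_def)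
    then show ?thesis using True s2(2)[of z y] s1y by (simp add: \<gamma>'_def)
  next
    case False
    have "z \<noteq> x" "z \<noteq> y" using that by (auto simp: S'_def)
    then have "skip \<gamma> x z = \<gamma> z" using s1(3) False by simp
    then show ?thesis using False s2(3)[of z y] inj[of z] \<open>z \<noteq> y\<close> \<open>z \<noteq> x\<close> by (simp add: \<gamma>'_def)
  qed
  have orb: "orbit \<gamma>' z = orbit \<gamma> z - {x} - {y}" if "z \<in> S'" for z
    unfolding \<gamma>'_def using orbit_skip[OF _ g1 y1, of z] orbit_skip[OF fin g x, of z] fin that
    by (auto simp: S'_def)
  show "linked S' \<gamma>' p' r"
    unfolding linked_def
  proof (intro conjI ballI)
    fix z assume z: "z \<in> S'"
    then have zS: "z \<in> S" by (simp add: S'_def)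
    have "r (\<gamma> y) = r z" if "\<gamma> z = x" using r[OF zS] r[OF yS] ry that by simp
    then show "r (\<gamma>' z) = r z" using g'eq[OF z] r[OF zS] by simp
    obtain w where w: "w \<in> orbit \<gamma> z" "r (p w) \<noteq> r w" using thr[OF zS] by blast
    then have "w \<noteq> x" "w \<noteq> y" using px py ry by auto
    then have "w \<in> orbit \<gamma>' z" using w orb[OF z] by simp
    moreover have "w \<in> S'" using permutes_orbit_subset[OF g' z] calculation by auto
    ultimately show "\<exists>w\<in>orbit \<gamma>' z. r (p' w) \<noteq> r w"
      using w(2) p'eq[OF \<open>w \<in> S'\<close>] by (metis (no_types))
  qed
  define \<kappa> where "\<kappa> = p \<circ> \<gamma>"
  have k: "\<kappa> permutes S" unfolding \<kappa>_def using g P(1) by (rule permutes_compose)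
  have kx: "\<kappa> x = x" using adj by (simp add: \<kappa>_def)
  then have skx: "skip \<kappa> x = \<kappa>" by (simp add: skip_def)
  have k1: "\<kappa> permutes S - {x}" using skip_permutes[OF k x] skx by simp
  have "\<kappa> y \<noteq> y"
  proof
    assume "\<kappa> y = y"
    then have "\<gamma> y = p y" using P(4)[of "\<gamma> y"] by (simp add: \<kappa>_def)
    then show False using gy py by simp
  qed
  then have card: "card (cycle_sets S \<kappa>) = card (cycle_sets S' (skip \<kappa> y)) + 1"
    using card_cycle_sets_skip[OF fin k x] card_cycle_sets_skip[OF _ k1 y1] fin kx skx by (simp add: S'_def)
  have "cycle_sets S' (skip \<kappa> y) = cycle_sets S' (p' \<circ> \<gamma>')"
  proof (rule cycle_sets_cong)
    show "skip \<kappa> y permutes S'" unfolding S'_def by (rule skip_permutes[OF k1 y1])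
    fix z assume z: "z \<in> S'"
    then have "\<gamma>' z \<in> S'" using g' by (simp add: permutes_in_image)
    then have "p' (\<gamma>' z) = p (if \<gamma> z = x then \<gamma> y else \<gamma> z)" using p'eq g'eq[OF z] by simp
    moreover have "\<kappa> z = y \<longleftrightarrow> \<gamma> z = x" using P(4) px py unfolding \<kappa>_def o_apply by metis
    ultimately show "skip \<kappa> y z = (p' \<circ> \<gamma>') z"
      using skip_simps(2,3)[OF k1, of z y] z by (auto simp: \<kappa>_def S'_def)
  qed
  with card show "card (cycle_sets S (p \<circ> \<gamma>)) = card (cycle_sets S' (p' \<circ> \<gamma>')) + 1"
    by (simp add: \<kappa>_def)
qed

text \<open>
Each removal of an adjacent pair lowers both sides by two; when no adjacent pair is left, \<open>p \<circ> \<gamma>\<close>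
has no fixed points.
\<close>

lemma linked_cycle_bound:
  assumes "finite S" "\<gamma> permutes S" "p \<in> pairings S" "linked S \<gamma> p r"
  shows "2 * card (cycle_sets S (p \<circ> \<gamma>)) \<le> card S"
  using assms
proof (induction "card S" arbitrary: S \<gamma> p rule: less_induct)
  case less
  show ?case
  proof (cases "\<exists>x\<in>S. p (\<gamma> x) = x")
    case True
    then obtain x where x: "x \<in> S" "p (\<gamma> x) = x" by blast
    note R = remove_adjacent_pair[OF less.prems x]
    have "skip \<gamma> x permutes S - {x}" by (rule skip_permutes[OF less.prems(2) x(1)])
    then have g': "skip (skip \<gamma> x) (\<gamma> x) permutes S - {x} - {\<gamma> x}"
      by (rule skip_permutes) (use R(1,2) in auto)
    have "2 * card (cycle_sets (S - {x} - {\<gamma> x})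
        ((Transposition.transpose x (\<gamma> x) \<circ> p) \<circ> skip (skip \<gamma> x) (\<gamma> x))) \<le> card (S - {x} - {\<gamma> x})"
      by (rule less.hyps[OF _ _ g' R(7) R(9)]) (use R(6) less.prems(1) in auto)
    then show ?thesis using R(6,10) by simp
  next
    case False
    have "(p \<circ> \<gamma>) permutes S" using less.prems(2) pairingsD(1)[OF less.prems(3)] by (rule permutes_compose)
    then show ?thesis using no_fixed_point_count(1)[OF less.prems(1)] False by auto
  qed
qed

section \<open>Crossing paths in a strip\<close>

text \<open>
The Fashoda theorem, transported from \<open>\<real>\<^sup>2\<close> to the complex plane.
\<close>

lemma fashoda_complex:
  fixes f g :: "real \<Rightarrow> complex"
  assumes f: "path f" and g: "path g"
    and "path_image f \<subseteq> cbox a b" and "path_image g \<subseteq> cbox a b"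
    and "Re (pathstart f) = Re a" and "Re (pathfinish f) = Re b"
    and "Im (pathstart g) = Im a" and "Im (pathfinish g) = Im b"
  shows "path_image f \<inter> path_image g \<noteq> {}"
proof -
  define \<phi> :: "complex \<Rightarrow> real^2" where "\<phi> z = (\<chi> i. if i = 1 then Re z else Im z)" for z
  have comp: "\<phi> z $ 1 = Re z" "\<phi> z $ 2 = Im z" for z
    by (simp_all add: \<phi>_def)
  have inj: "\<phi> w = \<phi> z \<Longrightarrow> w = z" for w z
    using comp[of w] comp[of z] by (auto simp: complex_eq_iff)
  have "continuous_on S (\<lambda>z. if i = (1::2) then Re z else Im z)" for S i
    by (cases "i = 1") (auto intro!: continuous_intros)
  then have cont: "continuous_on S \<phi>" for S
    unfolding \<phi>_def by (rule continuous_on_vec_lambda)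
  obtain z where "z \<in> path_image (\<phi> \<circ> f)" "z \<in> path_image (\<phi> \<circ> g)"
  proof (rule fashoda[of "\<phi> \<circ> f" "\<phi> \<circ> g" "\<phi> a" "\<phi> b"])
    show "path (\<phi> \<circ> f)" "path (\<phi> \<circ> g)"
      using f g cont by (auto intro: path_continuous_image)
    show "path_image (\<phi> \<circ> f) \<subseteq> cbox (\<phi> a) (\<phi> b)" "path_image (\<phi> \<circ> g) \<subseteq> cbox (\<phi> a) (\<phi> b)"
      using assms(3,4) by (force simp: path_image_compose mem_box_cart forall_2 comp in_cbox_complex_iff)+
  qed (use assms in \<open>auto simp: comp pathstart_compose pathfinish_compose\<close>)
  then show ?thesis
    by (auto simp: path_image_compose dest!: inj)
qed

text \<open>
The half plane is bounded on the right, because there the exponential map places the outer circle.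
The axes are exchanged to match the lower edge in the version for \<open>\<real>\<^sup>2\<close>.
\<close>

lemma fashoda_interlace_complex:
  fixes f g :: "real \<Rightarrow> complex"
  assumes f: "path f" and g: "path g"
    and "\<And>z. z \<in> path_image f \<union> path_image g \<Longrightarrow> Re z \<le> c"
    and "Re (pathstart f) = c" "Re (pathfinish f) = c" "Re (pathstart g) = c" "Re (pathfinish g) = c"
    and "Im (pathstart f) < Im (pathstart g)" "Im (pathstart g) < Im (pathfinish f)"
      "Im (pathfinish f) < Im (pathfinish g)"
  shows "path_image f \<inter> path_image g \<noteq> {}"
proof -
  define \<phi> :: "complex \<Rightarrow> real^2" where "\<phi> z = (\<chi> i. if i = 1 then Im z else - Re z)" for z
  have comp: "\<phi> z $ 1 = Im z" "\<phi> z $ 2 = - Re z" for z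
    by (simp_all add: \<phi>_def)
  have inj: "\<phi> w = \<phi> z \<Longrightarrow> w = z" for w z
    using comp[of w] comp[of z] by (auto simp: complex_eq_iff)
  have "continuous_on S (\<lambda>z. if i = (1::2) then Im z else - Re z)" for S i
    by (cases "i = 1") (auto intro!: continuous_intros)
  then have cont: "continuous_on S \<phi>" for S
    unfolding \<phi>_def by (rule continuous_on_vec_lambda)
  have "bounded (path_image f \<union> path_image g)"
    using f g by (simp add: bounded_path_image)
  then obtain B where B: "\<And>z. z \<in> path_image f \<union> path_image g \<Longrightarrow> norm z \<le> B"
    unfolding bounded_iff by blast
  have box: "\<phi> z \<in> cbox (vector [-B, -c]) (vector [B, B])" if "z \<in> path_image f \<union> path_image g" for z
    using B[OF that] assms(3)[OF that] abs_Re_le_cmod[of z] abs_Im_le_cmod[of z]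
    by (auto simp: mem_box_cart forall_2 comp)
  obtain z where "z \<in> path_image (\<phi> \<circ> f)" "z \<in> path_image (\<phi> \<circ> g)"
  proof (rule fashoda_interlace[of "\<phi> \<circ> f" "\<phi> \<circ> g" "vector [-B, -c]" "vector [B, B]"])
    show "path (\<phi> \<circ> f)" "path (\<phi> \<circ> g)"
      using f g cont by (auto intro: path_continuous_image)
    show "path_image (\<phi> \<circ> f) \<subseteq> cbox (vector [-B, -c]) (vector [B, B])"
      "path_image (\<phi> \<circ> g) \<subseteq> cbox (vector [-B, -c]) (vector [B, B])"
      using box by (auto simp: path_image_compose)
  qed (use assms in \<open>auto simp: comp pathstart_compose pathfinish_compose\<close>)
  then show ?thesis
    by (auto simp: path_image_compose dest!: inj)
qed

lemma horizontal_segment: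
  assumes "Im w = Im z" "Re w \<le> Re z"
  shows "closed_segment w z = {u. Im u = Im w \<and> Re w \<le> Re u \<and> Re u \<le> Re z}"
    "closed_segment z w = {u. Im u = Im w \<and> Re w \<le> Re u \<and> Re u \<le> Re z}"
  using assms closed_segment_commute[of w z]
  by (auto simp: closed_segment_same_Im closed_segment_eq_real_ivl)

lemma vertical_segment:
  assumes "Re w = Re z" "Im w \<le> Im z"
  shows "closed_segment w z = {u. Re u = Re w \<and> Im w \<le> Im u \<and> Im u \<le> Im z}"
    "closed_segment z w = {u. Re u = Re w \<and> Im w \<le> Im u \<and> Im u \<le> Im z}"
  using assms closed_segment_commute[of w z]
  by (auto simp: closed_segment_same_Re closed_segment_eq_real_ivl)

text \<open>
Tails outside the strip prolong \<open>f\<close> and \<open>g\<close> to a vertical and a horizontal crossing of one rectangle.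
The tails meet neither each other nor the other path, so the crossing point lies on \<open>f\<close> and \<open>g\<close>.
\<close>

lemma thread_meets_arch:
  fixes f g :: "real \<Rightarrow> complex"
  assumes f: "path f" and g: "path g"
    and strip: "\<And>z. z \<in> path_image f \<union> path_image g \<Longrightarrow> c' \<le> Re z \<and> Re z \<le> c"
    and ends: "Re (pathstart f) = c" "Re (pathfinish f) = c" "Re (pathstart g) = c" "Re (pathfinish g) = c'"
    and less: "Im (pathstart f) < Im (pathstart g)" "Im (pathstart g) < Im (pathfinish f)"
  shows "path_image f \<inter> path_image g \<noteq> {}"
proof -
  have "bounded (path_image f \<union> path_image g)"
    using f g by (simp add: bounded_path_image)
  then obtain B where B: "\<And>z. z \<in> path_image f \<union> path_image g \<Longrightarrow> norm z \<le> B"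
    unfolding bounded_iff by blast
  have Bim: "\<bar>Im z\<bar> \<le> B" if "z \<in> path_image f \<union> path_image g" for z
    using B[OF that] abs_Im_le_cmod[of z] by linarith
  have in_f: "pathstart f \<in> path_image f" "pathfinish f \<in> path_image f" 
    and in_g: "pathstart g \<in> path_image g" "pathfinish g \<in> path_image g" by auto
  have strip_f: "c' \<le> Re z \<and> Re z \<le> c \<and> - B \<le> Im z \<and> Im z \<le> B" if "z \<in> path_image f" for z
    using that strip[of z] Bim[of z] by auto
  have strip_g: "c' \<le> Re z \<and> Re z \<le> c \<and> - B \<le> Im z \<and> Im z \<le> B" if "z \<in> path_image g" for z
    using that strip[of z] Bim[of z] by auto
  \<comment> \<open>Outside the strip, \<open>p\<close> only runs horizontally to the right of the starting point of \<open>g\<close>,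
    while the tails of \<open>q\<close> leave the strip below and above that height.\<close>
  define p where "p = linepath (Complex (c + 1) (Im (pathstart g))) (pathstart g) +++ g"
  define a1 a2 where "a1 = Complex (c + 1) (Im (pathstart f))" and "a2 = Complex (c + 1) (Im (pathfinish f))"
  define q where "q = (linepath (Complex (c + 1/2) (- B)) (Complex (c + 1/2) (Im (pathstart f)))
     +++ linepath (Complex (c + 1/2) (Im (pathstart f))) (pathstart f))
     +++ f +++ linepath (pathfinish f) (Complex (c + 1/2) (Im (pathfinish f)))
     +++ linepath (Complex (c + 1/2) (Im (pathfinish f))) (Complex (c + 1/2) B)"
  have imp: "path_image p = {z. Im z = Im (pathstart g) \<and> c \<le> Re z \<and> Re z \<le> c + 1} \<union> path_image g"
    using ends by (simp add: p_def path_image_join horizontal_segment Un_assoc)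
  have imq: "path_image q = {z. Re z = c + 1/2 \<and> - B \<le> Im z \<and> Im z \<le> Im (pathstart f)}
     \<union> {z. Im z = Im (pathstart f) \<and> c \<le> Re z \<and> Re z \<le> c + 1/2} \<union> path_image f
     \<union> {z. Im z = Im (pathfinish f) \<and> c \<le> Re z \<and> Re z \<le> c + 1/2}
     \<union> {z. Re z = c + 1/2 \<and> Im (pathfinish f) \<le> Im z \<and> Im z \<le> B}"
    using ends strip_f[OF in_f(1)] strip_f[OF in_f(2)]
    by (simp add: q_def path_image_join horizontal_segment vertical_segment Un_assoc)
  have "c' \<le> c" using strip[of "pathstart f"] in_f by auto
  have corner: "w = z" if "Re w = Re z" "Im w = Im z" for w z
    using that by (simp add: complex_eq_iff)
  have "path_image (reversepath p) \<inter> path_image q \<noteq> {}"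
  proof (rule fashoda_complex)
    show "path (reversepath p)" "path q"
      using f g by (auto simp: p_def q_def)
    show "path_image (reversepath p) \<subseteq> cbox (Complex c' (- B)) (Complex (c + 1) B)"
      "path_image q \<subseteq> cbox (Complex c' (- B)) (Complex (c + 1) B)"
      using \<open>c' \<le> c\<close> strip_f[OF in_f(1)] strip_f[OF in_f(2)] strip_g[OF in_g(1)] strip_g[OF in_g(2)]
      unfolding path_image_reversepath imp imq
      by (auto simp: in_cbox_complex_iff dest!: strip_f strip_g)
  qed (simp_all add: p_def q_def ends)
  then obtain z where z: "z \<in> path_image p" "z \<in> path_image q" by auto
  have "z \<in> path_image g \<inter> path_image f"
  proof (cases "z \<in> path_image g")
    case True
    then have "Re z \<le> c" using strip by blast
    then have "z \<in> path_image f \<or> z = pathstart f \<or> z = pathfinish f"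
      using z(2) ends less unfolding imq by (auto intro: corner)
    then show ?thesis using True in_f by auto
  next
    case False
    then have 1: "Im z = Im (pathstart g)" "c \<le> Re z" using z(1) by (auto simp: imp)
    then have "z \<in> path_image f" using z(2) less by (auto simp: imq)
    then have "z = pathstart g" using 1 strip[of z] ends by (intro corner) auto
    then show ?thesis using False in_g by auto
  qed
  then show ?thesis by auto
qed

text \<open>
Prolong \<open>f\<close> horizontally on both sides, and let \<open>g\<close> turn upwards on the right and downwards on the
left. As \<open>g\<close> starts above and ends below \<open>f\<close>, the tails do not meet the other path, and the Fashoda
theorem applies.
\<close>

lemma threads_keep_order:
  fixes f g :: "real \<Rightarrow> complex"
  assumes f: "path f" and g: "path g"
    and strip: "\<And>z. z \<in> path_image f \<union> path_image g \<Longrightarrow> c' \<le> Re z \<and> Re z \<le> c"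
    and ends: "Re (pathstart f) = c" "Re (pathfinish f) = c'" "Re (pathstart g) = c" "Re (pathfinish g) = c'"
    and less: "Im (pathstart f) < Im (pathstart g)" "Im (pathfinish g) < Im (pathfinish f)"
    and "c' < c"
  shows "path_image f \<inter> path_image g \<noteq> {}"
proof -
  have "bounded (path_image f \<union> path_image g)"
    using f g by (simp add: bounded_path_image)
  then obtain B where B: "\<And>z. z \<in> path_image f \<union> path_image g \<Longrightarrow> norm z \<le> B"
    unfolding bounded_iff by blast
  have Bim: "\<bar>Im z\<bar> \<le> B" if "z \<in> path_image f \<union> path_image g" for z
    using B[OF that] abs_Im_le_cmod[of z] by linarith
  have in_f: "pathstart f \<in> path_image f" "pathfinish f \<in> path_image f"
    and in_g: "pathstart g \<in> path_image g" "pathfinish g \<in> path_image g" by auto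
  have strip_f: "c' \<le> Re z \<and> Re z \<le> c \<and> - B \<le> Im z \<and> Im z \<le> B" if "z \<in> path_image f" for z
    using that strip[of z] Bim[of z] by auto
  have strip_g: "c' \<le> Re z \<and> Re z \<le> c \<and> - B \<le> Im z \<and> Im z \<le> B" if "z \<in> path_image g" for z
    using that strip[of z] Bim[of z] by auto
  define p where "p = linepath (Complex (c + 1) (Im (pathstart f))) (pathstart f) +++ f
     +++ linepath (pathfinish f) (Complex (c' - 1) (Im (pathfinish f)))"
  define q where "q = (linepath (Complex (c + 1/2) B) (Complex (c + 1/2) (Im (pathstart g)))
     +++ linepath (Complex (c + 1/2) (Im (pathstart g))) (pathstart g))
     +++ g +++ linepath (pathfinish g) (Complex (c' - 1/2) (Im (pathfinish g)))
     +++ linepath (Complex (c' - 1/2) (Im (pathfinish g))) (Complex (c' - 1/2) (- B))"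
  have imp: "path_image p = {z. Im z = Im (pathstart f) \<and> c \<le> Re z \<and> Re z \<le> c + 1} \<union> path_image f
     \<union> {z. Im z = Im (pathfinish f) \<and> c' - 1 \<le> Re z \<and> Re z \<le> c'}"
    using ends by (simp add: p_def path_image_join horizontal_segment Un_assoc)
  have imq: "path_image q = {z. Re z = c + 1/2 \<and> Im (pathstart g) \<le> Im z \<and> Im z \<le> B}
     \<union> {z. Im z = Im (pathstart g) \<and> c \<le> Re z \<and> Re z \<le> c + 1/2} \<union> path_image g
     \<union> {z. Im z = Im (pathfinish g) \<and> c' - 1/2 \<le> Re z \<and> Re z \<le> c'}
     \<union> {z. Re z = c' - 1/2 \<and> - B \<le> Im z \<and> Im z \<le> Im (pathfinish g)}"
    using ends strip_g[OF in_g(1)] strip_g[OF in_g(2)]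
    by (simp add: q_def path_image_join horizontal_segment vertical_segment Un_assoc)
  have corner: "w = z" if "Re w = Re z" "Im w = Im z" for w z
    using that by (simp add: complex_eq_iff)
  have "path_image (reversepath p) \<inter> path_image (reversepath q) \<noteq> {}"
  proof (rule fashoda_complex)
    show "path (reversepath p)" "path (reversepath q)"
      using f g by (auto simp: p_def q_def)
    show "path_image (reversepath p) \<subseteq> cbox (Complex (c' - 1) (- B)) (Complex (c + 1) B)"
      "path_image (reversepath q) \<subseteq> cbox (Complex (c' - 1) (- B)) (Complex (c + 1) B)"
      using \<open>c' < c\<close> strip_f[OF in_f(1)] strip_f[OF in_f(2)] strip_g[OF in_g(1)] strip_g[OF in_g(2)]
      unfolding path_image_reversepath imp imq
      by (auto simp: in_cbox_complex_iff dest!: strip_f strip_g)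
  qed (simp_all add: p_def q_def ends)
  then obtain z where z: "z \<in> path_image p" "z \<in> path_image q" by auto
  have "z \<in> path_image g \<inter> path_image f"
  proof (cases "z \<in> path_image g")
    case True
    then have "Re z \<le> c" "c' \<le> Re z" using strip by auto
    then have "z \<in> path_image f \<or> z = pathstart f \<or> z = pathfinish f"
      using z(1) ends unfolding imp by (auto intro: corner)
    then show ?thesis using True in_f by auto
  next
    case False
    show ?thesis
    proof (cases "z \<in> path_image f")
      case True
      then have "Re z \<le> c" "c' \<le> Re z" using strip by auto
      then have "z = pathstart g \<or> z = pathfinish g"
        using z(2) False ends unfolding imq by (auto intro: corner)
      then show ?thesis using False in_g by auto
    next
      case no_f: False
      show ?thesis
        using z False no_f less \<open>c' < c\<close> by (auto simp: imp imq)
    qed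
  qed
  then show ?thesis by auto
qed

text \<open>
The crossing lemmas, read for disjoint paths.
\<close>

lemma arch_traps_thread:
  fixes f g :: "real \<Rightarrow> complex"
  assumes f: "path f" and g: "path g"
    and strip: "\<And>z. z \<in> path_image f \<union> path_image g \<Longrightarrow> c' \<le> Re z \<and> Re z \<le> c"
    and ends: "Re (pathstart f) = c" "Re (pathfinish f) = c" "Re (pathstart g) = c"
    and less: "Im (pathfinish f) < Im (pathstart g)" "Im (pathstart g) < Im (pathstart f)"
    and disj: "path_image f \<inter> path_image g = {}"
  shows "Re (pathfinish g) \<noteq> c'"
    and "Re (pathfinish g) = c \<Longrightarrow>
           Im (pathfinish f) < Im (pathfinish g) \<and> Im (pathfinish g) < Im (pathstart f)"
proof -
  show "Re (pathfinish g) \<noteq> c'"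
    using thread_meets_arch[of "reversepath f" g c' c] assms by auto
  assume e: "Re (pathfinish g) = c"
  have "pathfinish g \<noteq> pathstart f" "pathfinish g \<noteq> pathfinish f"
    using disj by (metis disjoint_iff pathfinish_in_path_image pathstart_in_path_image)+
  then have ne: "Im (pathfinish g) \<noteq> Im (pathstart f)" "Im (pathfinish g) \<noteq> Im (pathfinish f)"
    using e ends by (auto simp: complex_eq_iff)
  have "\<not> Im (pathstart f) < Im (pathfinish g)"
    using fashoda_interlace_complex[of "reversepath f" g c] assms e by auto
  moreover have "\<not> Im (pathfinish g) < Im (pathfinish f)"
    using fashoda_interlace_complex[of "reversepath g" "reversepath f" c] assms e by auto
  ultimately show "Im (pathfinish f) < Im (pathfinish g) \<and> Im (pathfinish g) < Im (pathstart f)"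
    using ne by linarith
qed

lemma disjoint_threads_keep_order:
  fixes f g :: "real \<Rightarrow> complex"
  assumes f: "path f" and g: "path g"
    and strip: "\<And>z. z \<in> path_image f \<union> path_image g \<Longrightarrow> c' \<le> Re z \<and> Re z \<le> c"
    and ends: "Re (pathstart f) = c" "Re (pathfinish f) = c'" "Re (pathstart g) = c" "Re (pathfinish g) = c'"
    and "c' < c"
    and disj: "path_image f \<inter> path_image g = {}"
  shows "Im (pathstart f) < Im (pathstart g) \<longleftrightarrow> Im (pathfinish f) < Im (pathfinish g)"
proof -
  have "pathfinish g \<noteq> pathfinish f" "pathstart g \<noteq> pathstart f"
    using disj by (metis disjoint_iff pathfinish_in_path_image pathstart_in_path_image)+
  then have ne: "Im (pathfinish g) \<noteq> Im (pathfinish f)" "Im (pathstart g) \<noteq> Im (pathstart f)"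
    using ends by (auto simp: complex_eq_iff)
  show ?thesis
    using threads_keep_order[of f g c' c] threads_keep_order[of g f c' c] assms ne
    by (metis Int_commute Un_commute linorder_neqE_linordered_idom)
qed

section \<open>Lifting arcs from the annulus to the strip\<close>

text \<open>
The exponential map covers the annulus by the strip \<open>0 \<le> Re z \<le> ln 2\<close>. In the strip there is no hole,
so crossing arguments of the plane apply to lifted arcs.
\<close>

lemma path_lift_exp:
  fixes q :: "real \<Rightarrow> complex"
  assumes "path q" "0 \<notin> path_image q" "exp w = pathstart q"
  obtains h where "path h" "pathstart h = w" "\<And>t. t \<in> {0..1} \<Longrightarrow> exp (h t) = q t"
proof -
  obtain h0 where h0: "continuous_on {0..1} h0" "\<And>t. t \<in> {0..1} \<Longrightarrow> q t = exp (h0 t)"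
  proof (rule continuous_logarithm_on_contractible[of "{0..1::real}" q])
    show "continuous_on {0..1} q" using assms by (simp add: path_def)
    show "contractible {0..1::real}" by (simp add: convex_imp_contractible)
    show "q t \<noteq> 0" if "t \<in> {0..1}" for t using assms that by (auto simp: path_image_def)
  qed blast
  define h where "h t = h0 t + (w - h0 0)" for t
  show thesis
  proof (rule that[of h])
    show "path h" unfolding path_def h_def using h0 by (intro continuous_intros) auto
    show "pathstart h = w" by (simp add: h_def pathstart_def)
    show "exp (h t) = q t" if "t \<in> {0..1}" for t
      using h0(2)[OF that] h0(2)[of 0] assms(3) by (simp add: h_def exp_add exp_diff pathstart_def)
  qed
qed

text \<open>
The sign distinguishes the outer circle from the inner one. It also records the direction of the
labels, which run clockwise outside and counter-clockwise inside.
\<close>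

definition side :: "nat \<Rightarrow> nat \<Rightarrow> real" where
  "side k j = (if j \<le> k then 1 else - 1)"

lemma side_cases: "side k j = 1 \<or> side k j = - 1"
  by (auto simp: side_def)

lemma norm_label_point: "cmod (label_point k l j) = (if side k j = 1 then 2 else 1)"
  by (auto simp: label_point_def side_def norm_mult)

lemma label_point_nonzero: "label_point k l j \<noteq> 0"
  using norm_label_point[of k l j] by (metis norm_zero zero_neq_numeral zero_neq_one)

lemma label_point_log: "\<exists>w. exp w = label_point k l j"
  using exp_Ln[OF label_point_nonzero] by blast

text \<open>
\<open>\<gamma>\<close> moves every label to the next label of \<open>S\<close> on its circle. The condition speaks about angles instead
of the numbers of the labels, so that it makes sense for arbitrary sets of remaining labels.
\<close>

definition successor_on :: "nat \<Rightarrow> nat \<Rightarrow> nat set \<Rightarrow> (nat \<Rightarrow> nat) \<Rightarrow> bool" where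
  "successor_on k l S \<gamma> \<longleftrightarrow> \<gamma> permutes S \<and>
     (\<forall>j\<in>S. side k (\<gamma> j) = side k j \<and>
        (\<exists>d>0. label_point k l (\<gamma> j) = label_point k l j * cis (- side k j * d) \<and>
           (\<forall>e. 0 < e \<and> e < d \<longrightarrow> label_point k l j * cis (- side k j * e) \<notin> label_point k l ` S)))"

text \<open>
The label before \<open>a\<close> inherits the gap behind \<open>a\<close>.
\<close>

lemma successor_on_skip:
  assumes succ: "successor_on k l S \<gamma>" and inj: "inj_on (label_point k l) S" and a: "a \<in> S"
  shows "successor_on k l (S - {a}) (skip \<gamma> a)"
proof -
  let ?P = "label_point k l"
  have perm: "\<gamma> permutes S" using succ by (simp add: successor_on_def)
  note sk = skip_simps[OF perm]
  have step: "side k (\<gamma> j) = side k j \<and>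
        (\<exists>d>0. ?P (\<gamma> j) = ?P j * cis (- side k j * d) \<and>
           (\<forall>e. 0 < e \<and> e < d \<longrightarrow> ?P j * cis (- side k j * e) \<notin> ?P ` S))" if "j \<in> S" for j
    using succ that by (simp add: successor_on_def)
  have "side k (skip \<gamma> a j) = side k j \<and>
        (\<exists>d>0. ?P (skip \<gamma> a j) = ?P j * cis (- side k j * d) \<and>
           (\<forall>e. 0 < e \<and> e < d \<longrightarrow> ?P j * cis (- side k j * e) \<notin> ?P ` (S - {a})))" if j: "j \<in> S - {a}" for j
  proof (cases "\<gamma> j = a")
    case False
    then show ?thesis using step[of j] j sk(3)[of j a] by auto
  next
    case True
    have sj: "side k a = side k j" using step[of j] j True by auto
    obtain d where d: "d > 0" "?P a = ?P j * cis (- side k j * d)"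
      "\<And>e. 0 < e \<Longrightarrow> e < d \<Longrightarrow> ?P j * cis (- side k j * e) \<notin> ?P ` S"
      using step[of j] j True by auto
    obtain d' where d': "d' > 0" "?P (\<gamma> a) = ?P a * cis (- side k j * d')"
      "\<And>e. 0 < e \<Longrightarrow> e < d' \<Longrightarrow> ?P a * cis (- side k j * e) \<notin> ?P ` S"
      using step[of a] a sj by auto
    have "?P j * cis (- side k j * e) \<notin> ?P ` (S - {a})" if e: "0 < e" "e < d + d'" for e
    proof -
      consider "e < d" | "e = d" | "d < e" by linarith
      then show ?thesis
      proof cases
        case 1 then show ?thesis using d(3) e by auto
      next
        case 2 then show ?thesis using d(2) inj a by (auto dest: inj_onD)
      next
        case 3
        have "?P a * cis (- side k j * (e - d)) \<notin> ?P ` S" using d'(3)[of "e - d"] 3 e by auto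
        moreover have "?P a * cis (- side k j * (e - d)) = ?P j * cis (- side k j * e)"
          unfolding d(2) by (simp add: cis_mult algebra_simps)
        ultimately show ?thesis by auto
      qed
    qed
    moreover have "?P (\<gamma> a) = ?P j * cis (- side k j * (d + d'))"
      unfolding d'(2) d(2) by (simp add: cis_mult algebra_simps)
    ultimately show ?thesis
      using sk(2)[of j a] True step[of a] a sj d(1) d'(1) by (auto intro!: exI[of _ "d + d'"])
  qed
  then show ?thesis using skip_permutes[OF perm a] by (simp add: successor_on_def)
qed

text \<open>
What is left of a drawing if only crossings matter. The set \<open>Q j\<close> is shared by \<open>j\<close> and its partner,
and it may contain different arcs for the two directions, as the loop of a two-cycle does.
\<close>

definition drawn_arcs :: "nat \<Rightarrow> nat \<Rightarrow> nat set \<Rightarrow> (nat \<Rightarrow> nat) \<Rightarrow> (nat \<Rightarrow> complex set) \<Rightarrow> bool" where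
  "drawn_arcs k l S p Q \<longleftrightarrow>
     (\<forall>j\<in>S. Q j \<subseteq> annulus \<and> (\<exists>q. arc q \<and> path_image q \<subseteq> Q j \<and>
        pathstart q = label_point k l j \<and> pathfinish q = label_point k l (p j))) \<and>
     (\<forall>j\<in>S. Q (p j) = Q j) \<and>
     (\<forall>i\<in>S. \<forall>j\<in>S. j \<noteq> i \<and> j \<noteq> p i \<longrightarrow> Q i \<inter> Q j = {})"

text \<open>
A lift to the strip of an arc in \<open>Q i\<close> from label \<open>i\<close> to label \<open>j\<close>. Injectivity of \<open>exp \<circ> f\<close> keeps a
thread disjoint from its translates by multiples of \<open>2 * pi * \<i>\<close>.
\<close>

definition thread :: "nat \<Rightarrow> nat \<Rightarrow> (nat \<Rightarrow> complex set) \<Rightarrow> nat \<Rightarrow> nat \<Rightarrow> (real \<Rightarrow> complex) \<Rightarrow> bool" where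
  "thread k l Q i j f \<longleftrightarrow> path f \<and> inj_on (exp \<circ> f) {0..1} \<and> exp ` path_image f \<subseteq> Q i \<and> Q i \<subseteq> annulus
     \<and> exp (pathstart f) = label_point k l i \<and> exp (pathfinish f) = label_point k l j"

lemma thread_exists:
  assumes "drawn_arcs k l S p Q" "j \<in> S" "exp w = label_point k l j"
  obtains f where "thread k l Q j (p j) f" "pathstart f = w"
proof -
  have "Q j \<subseteq> annulus \<and> (\<exists>q. arc q \<and> path_image q \<subseteq> Q j \<and>
        pathstart q = label_point k l j \<and> pathfinish q = label_point k l (p j))"
    using assms(1,2) by (simp add: drawn_arcs_def)
  then obtain q where q: "arc q" "path_image q \<subseteq> Q j" "pathstart q = label_point k l j"
     "pathfinish q = label_point k l (p j)" and Q: "Q j \<subseteq> annulus"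
    by blast
  have "0 \<notin> path_image q" using q(2) Q by (auto simp: annulus_def)
  then obtain h where h: "path h" "pathstart h = w" "\<And>t. t \<in> {0..1} \<Longrightarrow> exp (h t) = q t"
    using path_lift_exp[of q w] q assms(3) by (metis arc_imp_path)
  have "inj_on (exp \<circ> h) {0..1}"
    using q(1) h(3) by (auto simp: arc_def inj_on_def)
  moreover have "exp ` path_image h \<subseteq> Q j"
    using h(3) q(2) by (auto simp: path_image_def)
  moreover have "exp (pathfinish h) = label_point k l (p j)"
    using h(3)[of 1] q(4) by (simp add: pathfinish_def)
  ultimately show thesis using that[of h] h Q assms(3) by (auto simp: thread_def)
qed

lemma thread_translate:
  assumes "thread k l Q i j f" "exp c = 1"
  shows "thread k l Q i j (\<lambda>t. f t + c)"
  using assms by (auto simp: thread_def path_image_def exp_add pathstart_def pathfinish_def path_def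
      o_def image_image intro!: continuous_intros)

lemma thread_reverse:
  assumes "thread k l Q i j f" "Q j = Q i"
  shows "thread k l Q j i (reversepath f)"
proof -
  have "inj_on (exp \<circ> reversepath f) {0..1}"
  proof (rule inj_onI)
    fix x y :: real assume xy: "x \<in> {0..1}" "y \<in> {0..1}"
      "(exp \<circ> reversepath f) x = (exp \<circ> reversepath f) y"
    have "inj_on (exp \<circ> f) {0..1}" using assms by (simp add: thread_def)
    from inj_onD[OF this, of "1 - x" "1 - y"] show "x = y"
      using xy by (auto simp: reversepath_def)
  qed
  then show ?thesis using assms by (auto simp: thread_def)
qed

lemma thread_disjoint_translate:
  assumes "thread k l Q i j f" "c \<noteq> 0" "exp c = 1"
  shows "path_image f \<inter> path_image (\<lambda>t. f t + c) = {}"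
proof -
  have "f s \<noteq> f t + c" if "s \<in> {0..1}" "t \<in> {0..1}" for s t
  proof
    assume e: "f s = f t + c"
    then have "exp (f s) = exp (f t)" using assms(3) by (simp add: exp_add)
    then have "s = t" using assms(1) that unfolding thread_def inj_on_def by auto
    then show False using e assms(2) by simp
  qed
  then show ?thesis by (auto simp: path_image_def)
qed

lemma thread_disjoint:
  assumes "thread k l Q i i' f" "thread k l Q j j' g" "Q i \<inter> Q j = {}"
  shows "path_image f \<inter> path_image g = {}"
  using assms unfolding thread_def by (metis Int_emptyI disjoint_iff image_subset_iff)

lemma thread_strip:
  assumes "thread k l Q i j f" "z \<in> path_image f"
  shows "0 \<le> Re z" "Re z \<le> ln 2"
proof -
  have "exp z \<in> annulus" using assms by (auto simp: thread_def)
  then have "1 \<le> exp (Re z)" "exp (Re z) \<le> 2" by (auto simp: annulus_def)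
  then show "0 \<le> Re z" "Re z \<le> ln 2" using ln_ge_iff[of 2 "Re z"]  by auto
qed

lemma exp_label_Re:
  assumes "exp w = label_point k l j"
  shows "Re w = (if side k j = 1 then ln 2 else 0)"
proof -
  have "exp (Re w) = (if side k j = 1 then 2 else 1)"
    using assms norm_label_point[of k l j] by (metis norm_exp_eq_Re)
  then show ?thesis by (metis exp_ln_iff exp_zero ln_exp ln_unique)
qed

text \<open>
The rotation by \<open>-1\<close> exchanges the two edges of the strip and reverses their direction, just as \<^const>\<open>side\<close>
demands. So it suffices to prove statements about pairs on one circle for the outer circle.
\<close>

lemma thread_rotate_strip:
  assumes f: "thread k l Q i i' f" and s: "s = 1 \<or> s = - 1"
    and z: "z \<in> path_image (\<lambda>t. complex_of_real s * f t)"
  shows "(if s = 1 then 0 else - ln 2) \<le> Re z \<and> Re z \<le> (if s = 1 then ln 2 else 0)"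
proof -
  from z obtain t where "t \<in> {0..1}" "z = s * f t" by (auto simp: path_image_def)
  then show ?thesis
    using thread_strip[OF f, of "f t"] s by (auto simp: path_image_def)
qed

lemma thread_path_rotate:
  assumes "thread k l Q i i' f"
  shows "path (\<lambda>t. complex_of_real s * f t)"
  using assms by (auto simp: thread_def path_def intro!: continuous_intros)

lemma disjoint_rotate:
  assumes "path_image f \<inter> path_image g = {}" "s = 1 \<or> s = - 1"
  shows "path_image (\<lambda>t. complex_of_real s * f t) \<inter> path_image (\<lambda>t. complex_of_real s * g t) = {}"
  using assms by (auto simp: path_image_def)

lemma thread_ends_Re:
  assumes "thread k l Q i i' f"
  shows "Re (pathstart f) = (if side k i = 1 then ln 2 else 0)"
    "Re (pathfinish f) = (if side k i' = 1 then ln 2 else 0)"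
  using assms by (auto simp: thread_def dest: exp_label_Re)

lemma thread_trapped:
  assumes f: "thread k l Q i i' f" and g: "thread k l Q j j' g"
    and disj: "path_image f \<inter> path_image g = {}"
    and sides: "side k i = s" "side k i' = s" "side k j = s"
    and less: "s * Im (pathfinish f) < s * Im (pathstart g)" "s * Im (pathstart g) < s * Im (pathstart f)"
  shows "side k j' = s"
    and "s * Im (pathfinish f) < s * Im (pathfinish g)" "s * Im (pathfinish g) < s * Im (pathstart f)"
proof -
  let ?F = "\<lambda>t. complex_of_real s * f t" and ?G = "\<lambda>t. complex_of_real s * g t"
  define c' c where "c' = (if s = 1 then 0 else - ln 2 :: real)" and "c = (if s = 1 then ln 2 else 0 :: real)"
  have s: "s = 1 \<or> s = - 1" using sides side_cases by metis
  have c: "c' < c" by (auto simp: c_def c'_def)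
  have ends: "pathstart ?F = s * pathstart f" "pathfinish ?F = s * pathfinish f"
    "pathstart ?G = s * pathstart g" "pathfinish ?G = s * pathfinish g"
    by (auto simp: pathstart_def pathfinish_def)
  have "path ?F" "path ?G" using thread_path_rotate f g by blast+
  moreover have "c' \<le> Re z \<and> Re z \<le> c" if "z \<in> path_image ?F \<union> path_image ?G" for z
    using that thread_rotate_strip[OF f s] thread_rotate_strip[OF g s] unfolding c'_def c_def by blast
  moreover have "Re (pathstart ?F) = c" "Re (pathfinish ?F) = c" "Re (pathstart ?G) = c"
    using thread_ends_Re[OF f] thread_ends_Re[OF g] sides s unfolding ends c_def by auto
  moreover have "Im (pathfinish ?F) < Im (pathstart ?G)" "Im (pathstart ?G) < Im (pathstart ?F)"
    using less by (auto simp: ends)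
  ultimately have *: "Re (pathfinish ?G) \<noteq> c'" "Re (pathfinish ?G) = c \<Longrightarrow>
           Im (pathfinish ?F) < Im (pathfinish ?G) \<and> Im (pathfinish ?G) < Im (pathstart ?F)"
    using arch_traps_thread[of ?F ?G c' c] disjoint_rotate[OF disj s] by blast+
  show 1: "side k j' = s"
    using * thread_ends_Re(2)[OF g] s side_cases[of k j'] unfolding ends c'_def
    by (auto split: if_splits)
  then have "Re (pathfinish ?G) = c"
    using thread_ends_Re(2)[OF g] s unfolding ends c_def by auto
  with * show "s * Im (pathfinish f) < s * Im (pathfinish g)" "s * Im (pathfinish g) < s * Im (pathstart f)"
    by (auto simp: ends)
qed

lemma threads_order:
  assumes f: "thread k l Q i i' f" and g: "thread k l Q j j' g"
    and disj: "path_image f \<inter> path_image g = {}"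
    and sides: "side k j = side k i" "side k i' = - side k i" "side k j' = - side k i"
  shows "Im (pathstart f) < Im (pathstart g) \<longleftrightarrow> Im (pathfinish f) < Im (pathfinish g)"
proof -
  have strip: "0 \<le> Re z \<and> Re z \<le> ln 2" if "z \<in> path_image f \<union> path_image g" for z
    using that thread_strip[OF f] thread_strip[OF g] by auto
  have pth: "path f" "path g" using f g by (auto simp: thread_def)
  show ?thesis
  proof (cases "side k i = 1")
    case True
    show ?thesis
      using thread_ends_Re[OF f] thread_ends_Re[OF g] sides True disj
      by (intro disjoint_threads_keep_order[OF pth strip]) auto
  next
    case False
    then have i: "side k i = - 1" using side_cases by metis
    have "Im (pathstart (reversepath f)) < Im (pathstart (reversepath g)) \<longleftrightarrow>
      Im (pathfinish (reversepath f)) < Im (pathfinish (reversepath g))"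
      using thread_ends_Re[OF f] thread_ends_Re[OF g] sides i disj pth strip
      by (intro disjoint_threads_keep_order[where c = "ln 2" and c' = 0]) auto
    then show ?thesis by auto
  qed
qed

lemma thread_ends_distinct:
  assumes "thread k l Q i j f"
  shows "label_point k l i \<noteq> label_point k l j"
proof
  assume "label_point k l i = label_point k l j"
  then have "(exp \<circ> f) 0 = (exp \<circ> f) 1" using assms by (simp add: thread_def pathstart_def pathfinish_def)
  moreover have "inj_on (exp \<circ> f) {0..1}" using assms by (simp add: thread_def)
  ultimately show False using inj_onD[of "exp \<circ> f" "{0..1}" 0 1] by auto
qed

lemma exp_down: "exp (w - \<i> * complex_of_real (s * d)) = exp w * cis (- s * d)"
  by (simp add: exp_diff cis_conv_exp exp_minus field_simps)

lemma exp_shift_eq_iff: "exp (w + t) = exp w \<longleftrightarrow> exp t = (1 :: complex)"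
  by (simp add: exp_add)

section \<open>Drawings determine the number of cycles\<close>

text \<open>
Among the pairs with both labels on one circle choose one whose lifted arc has least height. The label
next to it in the direction of \<open>\<gamma>\<close> is not its partner, so it is trapped by the arc together with its own
partner. This pair has a lower arc, a contradiction.
\<close>

lemma no_adjacent_imp_through:
  assumes fin: "finite S" and inj: "inj_on (label_point k l) S"
    and succ: "successor_on k l S \<gamma>" and p: "p \<in> pairings S" and drawn: "drawn_arcs k l S p Q"
    and no_adj: "\<And>x. x \<in> S \<Longrightarrow> p (\<gamma> x) \<noteq> x"
    and j: "j \<in> S"
  shows "side k (p j) = - side k j"
proof (rule ccontr)
  note p_simps = pairingsD[OF p]
  define T where "T = {j \<in> S. side k (p j) = side k j}"
  assume "side k (p j) \<noteq> - side k j"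
  then have "j \<in> T" using j side_cases[of k j] side_cases[of k "p j"] by (auto simp: T_def)
  have ex: "\<exists>f. thread k l Q j (p j) f" if "j \<in> S" for j
  proof -
    obtain w where "exp w = label_point k l j" using label_point_log[of k l j] by blast
    then show ?thesis using thread_exists[OF drawn that] by blast
  qed
  \<comment> \<open>One arc and one lift of it per label; the other lifts of this arc are translates of the same
    height \<open>D\<close>.\<close>
  define h where "h j = (SOME f. thread k l Q j (p j) f)" for j
  have h: "thread k l Q j (p j) (h j)" if "j \<in> S" for j
    unfolding h_def using someI_ex[OF ex[OF that]] .
  define D where "D j = \<bar>Im (pathstart (h j)) - Im (pathfinish (h j))\<bar>" for j
  have "finite T" "T \<noteq> {}" using fin \<open>j \<in> T\<close> by (auto simp: T_def)
  then obtain a where a: "a \<in> T" and amin: "\<And>j. j \<in> T \<Longrightarrow> D a \<le> D j"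
    using ex_min_if_finite[of "D ` T"] by (metis arg_min_if_finite(1) arg_min_least)
  define s where "s = side k a"
  have s: "s = 1 \<or> s = - 1" using side_cases s_def by metis
  have aS: "a \<in> S" and side_pa: "side k (p a) = s" using a by (auto simp: T_def s_def)
  have Qp: "Q (p j) = Q j" if "j \<in> S" for j using drawn that by (auto simp: drawn_arcs_def)
  have Qdisj: "Q i \<inter> Q j = {}" if "i \<in> S" "j \<in> S" "j \<noteq> i" "j \<noteq> p i" for i j
    using drawn that by (auto simp: drawn_arcs_def)
  \<comment> \<open>Replace \<open>a\<close> by its partner if necessary, so that the arc descends in the direction of \<open>\<gamma>\<close>.\<close>
  obtain b f where b: "b \<in> S" "side k b = s" "side k (p b) = s" and f: "thread k l Q b (p b) f"
    and fD: "s * Im (pathstart f) - s * Im (pathfinish f) = D a"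
  proof (cases "s * Im (pathstart (h a)) - s * Im (pathfinish (h a)) = D a")
    case True
    then show ?thesis using that[of a "h a"] h[OF aS] aS side_pa s_def by auto
  next
    case False
    then have "s * Im (pathfinish (h a)) - s * Im (pathstart (h a)) = D a"
      using s by (auto simp: D_def)
    moreover have "thread k l Q (p a) (p (p a)) (reversepath (h a))"
      using thread_reverse[OF h[OF aS]] Qp[OF aS] p_simps(4) by simp
    ultimately show ?thesis
      using that[of "p a" "reversepath (h a)"] aS side_pa s_def p_simps by auto
  qed
  define w where "w = pathstart f"
  have exp_w: "exp w = label_point k l b" using f by (auto simp: thread_def w_def)
  have fin_f: "pathfinish f = w - \<i> * complex_of_real (s * D a)"
    using fD s thread_ends_Re[OF f] b by (auto simp: complex_eq_iff w_def)
  have "D a \<noteq> 0"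
  proof
    assume "D a = 0"
    then have "pathfinish f = pathstart f" using fin_f w_def by simp
    then show False using thread_ends_distinct[OF f] f by (auto simp: thread_def)
  qed
  then have Dpos: "D a > 0" by (simp add: D_def)
  define c where "c = \<gamma> b"
  obtain d where d: "d > 0" "label_point k l c = label_point k l b * cis (- s * d)"
      "\<And>e. 0 < e \<Longrightarrow> e < d \<Longrightarrow> label_point k l b * cis (- s * e) \<notin> label_point k l ` S"
    and side_c: "side k c = s" and cS: "c \<in> S"
    using succ b unfolding successor_on_def c_def by (metis permutes_in_image)
  have exp_fin: "exp (pathfinish f) = label_point k l (p b)" using f by (simp add: thread_def)
  have expd: "exp (w - \<i> * complex_of_real (s * d)) = label_point k l c"
    unfolding exp_down exp_w d(2) ..
  have "label_point k l b * cis (- s * D a) = label_point k l (p b)"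
    using exp_fin unfolding fin_f exp_down exp_w .
  then have "\<not> D a < d" using d(3)[OF Dpos] p_simps(2)[OF b(1)] by auto
  moreover have "D a \<noteq> d"
  proof
    assume "D a = d"
    then have "label_point k l c = label_point k l (p b)" using expd fin_f exp_fin by simp
    then have "c = p b" using inj cS p_simps(2)[OF b(1)] by (auto dest: inj_onD)
    then show False using no_adj[OF b(1)] p_simps(4) by (simp add: c_def)
  qed
  ultimately have dD: "d < D a" by simp
  have im_start: "s * Im (w - \<i> * complex_of_real (s * d)) = s * Im w - d"
    and im_fin: "s * Im (pathfinish f) = s * Im w - D a"
    using s by (auto simp: fin_f)
  have trapped: "side k j' = s \<and> \<bar>Im (pathstart g) - Im (pathfinish g)\<bar> < D a
       \<and> s * Im w - D a < s * Im (pathfinish g) \<and> s * Im (pathfinish g) < s * Im w"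
    if g: "thread k l Q c j' g" and start: "pathstart g = w - \<i> * complex_of_real (s * d)"
      and disj: "path_image f \<inter> path_image g = {}" for j' g
  proof -
    have "s * Im (pathfinish f) < s * Im (pathstart g)" "s * Im (pathstart g) < s * Im (pathstart f)"
      using dD d(1) unfolding start im_start im_fin w_def[symmetric] by auto
    from thread_trapped[OF f g disj b(2,3) side_c this]
    have *: "side k j' = s" "s * Im (pathfinish f) < s * Im (pathfinish g)" "s * Im (pathfinish g) < s * Im w"
      by (simp_all add: w_def)
    then show ?thesis
      using s d(1) dD unfolding im_fin start by (auto simp: abs_less_iff)
  qed
  \<comment> \<open>If \<open>c\<close> is one of the ends of the pair, then a translate of \<open>f\<close> or of its reversal by a
    multiple of \<open>2 * pi * \<i>\<close> would be trapped; but it reaches beyond \<open>f\<close>.\<close>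
  consider "c = b" | "c = p b" "c \<noteq> b" | "c \<noteq> b" "c \<noteq> p b" by blast
  then show False
  proof cases
    case 1
    define t where "t = - (\<i> * complex_of_real (s * d))"
    have "t \<noteq> 0" using s d(1) by (auto simp: t_def)
    have "exp (w + t) = exp w" using expd exp_w 1 unfolding t_def by simp
    then have "exp t = 1" by (simp only: exp_shift_eq_iff)
    from trapped[of "p b" "\<lambda>x. f x + t"] thread_translate[OF f this] thread_disjoint_translate[OF f \<open>t \<noteq> 0\<close> this]
    have "s * Im w - D a < s * Im (pathfinish f + t)"
      unfolding 1 by (auto simp: pathstart_def pathfinish_def w_def t_def)
    then show False using s d(1) im_fin by (auto simp: t_def)
  next
    case 2
    define t where "t = \<i> * complex_of_real (s * (D a - d))"
    have "t \<noteq> 0" using s dD by (auto simp: t_def)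
    have eq: "w - \<i> * complex_of_real (s * d) = pathfinish f + t"
      by (simp add: t_def fin_f algebra_simps)
    have "exp (pathfinish f + t) = exp (pathfinish f)"
      using expd exp_fin 2 unfolding eq by simp
    then have t1: "exp t = 1" by (simp only: exp_shift_eq_iff)
    have th: "thread k l Q c b (reversepath (\<lambda>x. f x + t))"
      using thread_reverse[OF thread_translate[OF f t1]] Qp[OF b(1)] 2 by simp
    from trapped[OF th] thread_disjoint_translate[OF f \<open>t \<noteq> 0\<close> t1]
    have "s * Im (w + t) < s * Im w"
      unfolding eq path_image_reversepath by (simp add: pathstart_def pathfinish_def w_def reversepath_def)
    then show False using s dD by (auto simp: t_def)
  next
    case 3
    define t where "t = w - \<i> * complex_of_real (s * d) - pathstart (h c)"
    have "exp (pathstart (h c)) = label_point k l c" using h[OF cS] by (simp add: thread_def)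
    then have "exp (pathstart (h c) + t) = exp (pathstart (h c))" using expd by (simp add: t_def)
    then have "exp t = 1" by (simp only: exp_shift_eq_iff)
    have th: "thread k l Q c (p c) (\<lambda>x. h c x + t)"
      by (rule thread_translate[OF h[OF cS] \<open>exp t = 1\<close>])
    have "path_image f \<inter> path_image (\<lambda>x. h c x + t) = {}"
      by (rule thread_disjoint[OF f th]) (use Qdisj b(1) cS 3 in auto)
    from trapped[OF th _ this] have "side k (p c) = s" "D c < D a"
      by (simp_all add: pathstart_def pathfinish_def t_def D_def)
    then have "c \<in> T" using cS side_c by (simp add: T_def)
    then show False using amin[of c] \<open>D c < D a\<close> by simp
  qed
qed

text \<open>
Threads across the strip keep their order, so the partners of \<open>x\<close> and of \<open>\<gamma> x\<close> follow each other in the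
opposite direction. They are neighbours, because the thread of a label between them would have to end
in the gap between \<open>x\<close> and \<open>\<gamma> x\<close>.
\<close>

lemma through_reverses_successor:
  assumes inj: "inj_on (label_point k l) S"
    and succ: "successor_on k l S \<gamma>" and p: "p \<in> pairings S" and drawn: "drawn_arcs k l S p Q"
    and through: "\<And>x. x \<in> S \<Longrightarrow> side k (p x) = - side k x"
    and x: "x \<in> S"
  shows "\<gamma> (p (\<gamma> x)) = p x"
proof -
  note p_simps = pairingsD[OF p]
  define s where "s = side k x"
  have s: "s = 1 \<or> s = - 1" using side_cases s_def by metis
  have Qp: "Q (p j) = Q j" if "j \<in> S" for j using drawn that by (auto simp: drawn_arcs_def)
  have Qdisj: "Q i \<inter> Q j = {}" if "i \<in> S" "j \<in> S" "j \<noteq> i" "j \<noteq> p i" for i j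
    using drawn that by (auto simp: drawn_arcs_def)
  have side_ne: "i \<noteq> j" if "side k i = - side k j" for i j
    using that side_cases[of k j] by auto
  have succ_side: "\<gamma> j \<in> S" "side k (\<gamma> j) = side k j" if "j \<in> S" for j
    using succ that unfolding successor_on_def by (metis permutes_in_image)+
  obtain w where exp_w: "exp w = label_point k l x" using label_point_log[of k l x] by blast
  obtain f where f: "thread k l Q x (p x) f" and start_f: "pathstart f = w"
    using thread_exists[OF drawn x exp_w] .
  define c where "c = \<gamma> x"
  obtain d where d: "d > 0" "label_point k l c = label_point k l x * cis (- s * d)"
      "\<And>e. 0 < e \<Longrightarrow> e < d \<Longrightarrow> label_point k l x * cis (- s * e) \<notin> label_point k l ` S"
    using succ x unfolding successor_on_def c_def s_def by blast
  have cS: "c \<in> S" and side_c: "side k c = s" using succ_side[OF x] by (auto simp: c_def s_def)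
  have side_px: "side k (p x) = - s" and side_pc: "side k (p c) = - s"
    using through x cS side_c by (auto simp: s_def)
  define w' where "w' = w - \<i> * complex_of_real (s * d)"
  have exp_w': "exp w' = label_point k l c" unfolding w'_def exp_down exp_w d(2) ..
  \<comment> \<open>If \<open>x\<close> is the only label of its circle, the next thread is the translate of \<open>f\<close> by one turn.\<close>
  obtain g where g: "thread k l Q c (p c) g" and start_g: "pathstart g = w'"
    and fg: "path_image f \<inter> path_image g = {}"
  proof (cases "c = x")
    case True
    define t where "t = - (\<i> * complex_of_real (s * d))"
    have "t \<noteq> 0" using s d(1) by (auto simp: t_def)
    have "exp (w + t) = exp w" using exp_w' exp_w True unfolding t_def w'_def by simp
    then have t1: "exp t = 1" by (simp only: exp_shift_eq_iff)
    show ?thesis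
      using that[of "\<lambda>x. f x + t"] thread_translate[OF f t1] thread_disjoint_translate[OF f \<open>t \<noteq> 0\<close> t1]
        start_f True by (simp add: pathstart_def w'_def t_def)
  next
    case False
    obtain g where g: "thread k l Q c (p c) g" "pathstart g = w'"
      using thread_exists[OF drawn cS exp_w'] .
    moreover have "path_image f \<inter> path_image g = {}"
      by (rule thread_disjoint[OF f g(1)])
        (use Qdisj x cS False side_ne[of "p x" c] side_px side_c in auto)
    ultimately show ?thesis using that by blast
  qed
  define v v' where "v = pathfinish f" and "v' = pathfinish g"
  define e where "e = s * (Im v - Im v')"
  have im_w': "Im w' = Im w - s * d" by (simp add: w'_def)
  have e: "e > 0"
    using threads_order[OF f g fg] threads_order[OF g f] fg fg[unfolded Int_commute[of "path_image f"]] d(1) s side_px side_pc side_c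
    unfolding start_f start_g im_w' e_def v_def v'_def s_def[symmetric] by auto
  have v: "v = v' + \<i> * complex_of_real (s * e)"
    using s thread_ends_Re(2)[OF f] thread_ends_Re(2)[OF g] side_px side_pc
    by (auto simp: complex_eq_iff e_def v_def v'_def)
  have exp_v: "exp v = label_point k l (p x)" "exp v' = label_point k l (p c)"
    using f g by (auto simp: thread_def v_def v'_def)
  define y where "y = \<gamma> (p c)"
  obtain d' where d': "d' > 0" "label_point k l y = label_point k l (p c) * cis (s * d')"
      "\<And>e. 0 < e \<Longrightarrow> e < d' \<Longrightarrow> label_point k l (p c) * cis (s * e) \<notin> label_point k l ` S"
    using succ p_simps(2)[OF cS] side_pc unfolding successor_on_def y_def
    by (metis minus_minus)
  have yS: "y \<in> S" and side_y: "side k y = - s"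
    using succ_side[OF p_simps(2)[OF cS]] side_pc by (auto simp: y_def)
  have exp_up: "exp (v' + \<i> * complex_of_real (s * r)) = label_point k l (p c) * cis (s * r)" for r
    by (simp add: exp_add exp_v cis_conv_exp)
  have "\<not> e < d'"
    using d'(3)[OF e] exp_up[of e] exp_v(1) p_simps(2)[OF x] unfolding v by auto
  have "y = p x"
  proof (rule ccontr)
    assume y: "y \<noteq> p x"
    have "d' \<noteq> e"
    proof
      assume "d' = e"
      then have "label_point k l y = label_point k l (p x)" using d'(2) exp_up[of e] exp_v(1) v by simp
      then show False using y inj yS p_simps(2)[OF x] by (auto dest: inj_onD)
    qed
    with \<open>\<not> e < d'\<close> have d'e: "d' < e" by simp
    \<comment> \<open>The thread from \<open>y\<close> starts between the ends of \<open>f\<close> and \<open>g\<close>, hence it ends between their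
      starting points, where there is no label.\<close>
    define v'' where "v'' = v' + \<i> * complex_of_real (s * d')"
    have exp_v'': "exp v'' = label_point k l y" using exp_up[of d'] d'(2) by (simp add: v''_def)
    obtain u where u: "thread k l Q y (p y) u" and start_u: "pathstart u = v''"
      and uf: "path_image u \<inter> path_image f = {}" and ug: "path_image u \<inter> path_image g = {}"
    proof (cases "y = p c")
      case True
      define t where "t = \<i> * complex_of_real (s * d')"
      have "t \<noteq> 0" using s d'(1) by (auto simp: t_def)
      have "exp (v' + t) = exp v'" using exp_v'' exp_v True unfolding t_def v''_def by simp
      then have t1: "exp t = 1" by (simp only: exp_shift_eq_iff)
      have u: "thread k l Q y (p y) (reversepath (\<lambda>x. g x + t))"
        using thread_reverse[OF thread_translate[OF g t1]] Qp[OF cS] True p_simps(4) by simp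
      have "c \<noteq> x" using y True by auto
      have "path_image (reversepath (\<lambda>x. g x + t)) \<inter> path_image f = {}"
        by (rule thread_disjoint[OF u f])
          (use Qdisj[OF x yS] x yS y side_ne[of y x] side_y s_def in auto)
      with u show ?thesis
        using that[OF u] thread_disjoint_translate[OF g \<open>t \<noteq> 0\<close> t1]
        unfolding path_image_reversepath
        by (simp add: v''_def v'_def t_def reversepath_def pathstart_def pathfinish_def Int_commute)
    next
      case False
      obtain u where u: "thread k l Q y (p y) u" "pathstart u = v''"
        using thread_exists[OF drawn yS exp_v''] .
      moreover have "path_image u \<inter> path_image f = {}"
        by (rule thread_disjoint[OF u(1) f])
          (use Qdisj[OF x yS] x yS y side_ne[of y x] side_y s_def in auto)
      moreover have "path_image u \<inter> path_image g = {}"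
        by (rule thread_disjoint[OF u(1) g])
          (use Qdisj[OF cS yS] False side_ne[of y c] side_y side_c in auto)
      ultimately show ?thesis using that by blast
    qed
    define z where "z = pathfinish u"
    have side_py: "side k (p y) = s" using through[OF yS] side_y by simp
    have rf: "thread k l Q (p x) x (reversepath f)" and rg: "thread k l Q (p c) c (reversepath g)"
      using thread_reverse[OF f] thread_reverse[OF g] Qp x cS by auto
    have im_v'': "Im v'' = Im v' + s * d'" "Im v = Im v' + s * e" by (auto simp: v''_def v)
    define e' where "e' = s * (Im w - Im z)"
    have "0 < e'" "e' < d"
      using threads_order[OF rf u] threads_order[OF u rf] threads_order[OF rg u] threads_order[OF u rg]
        uf ug uf[unfolded Int_commute[of "path_image u"]] ug[unfolded Int_commute[of "path_image u"]]
        s d'(1) d'e side_px side_pc side_c side_y side_py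
      unfolding e'_def path_image_reversepath
      by (auto simp: start_f start_g start_u im_v'' im_w' z_def[symmetric]
          v_def[symmetric] v'_def[symmetric] s_def[symmetric])
    moreover have "z = w - \<i> * complex_of_real (s * e')"
      using s thread_ends_Re(2)[OF u] thread_ends_Re(1)[OF f] start_f side_py
      by (auto simp: complex_eq_iff e'_def z_def s_def[symmetric])
    then have "exp z = label_point k l x * cis (- s * e')" by (simp only: exp_down exp_w)
    moreover have "exp z = label_point k l (p y)" using u by (simp add: thread_def z_def)
    ultimately show False using d(3)[of e'] p_simps(2)[OF yS] by (metis image_eqI)
  qed
  then show ?thesis by (simp add: y_def c_def)
qed

text \<open>
A drawing stays a drawing when pairs are removed. If no adjacent pair is left, all pairs cross the
annulus and reverse \<open>\<gamma>\<close>, which makes \<open>p \<circ> \<gamma>\<close> an involution without fixed points.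
\<close>

lemma drawn_arcs_imp_cycle_count:
  assumes "finite S" "inj_on (label_point k l) S" "successor_on k l S \<gamma>" "p \<in> pairings S"
    "linked S \<gamma> p (side k)" "drawn_arcs k l S p Q"
  shows "2 * card (cycle_sets S (p \<circ> \<gamma>)) = card S"
  using assms
proof (induction "card S" arbitrary: S \<gamma> p rule: less_induct)
  case less
  have g: "\<gamma> permutes S" using less.prems(3) by (simp add: successor_on_def)
  show ?case
  proof (cases "\<exists>x\<in>S. p (\<gamma> x) = x")
    case True
    then obtain x where x: "x \<in> S" "p (\<gamma> x) = x" by blast
    note R = remove_adjacent_pair[OF less.prems(1) g less.prems(4,5) x]
    let ?S = "S - {x} - {\<gamma> x}"
    have inj1: "inj_on (label_point k l) (S - {x})" and inj2: "inj_on (label_point k l) ?S"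
      using less.prems(2) by (auto intro: inj_on_subset)
    have "successor_on k l (S - {x}) (skip \<gamma> x)"
      by (rule successor_on_skip[OF less.prems(3,2) x(1)])
    then have succ: "successor_on k l ?S (skip (skip \<gamma> x) (\<gamma> x))"
      by (rule successor_on_skip[OF _ inj1]) (use R(1,2) in auto)
    have drawn: "drawn_arcs k l ?S (Transposition.transpose x (\<gamma> x) \<circ> p) Q"
      using less.prems(6) R(8) unfolding drawn_arcs_def by simp
    have "2 * card (cycle_sets ?S
        ((Transposition.transpose x (\<gamma> x) \<circ> p) \<circ> skip (skip \<gamma> x) (\<gamma> x))) = card ?S"
      by (rule less.hyps[OF _ _ inj2 succ R(7) R(9) drawn]) (use R(6) less.prems(1) in auto)
    then show ?thesis using R(6,10) by simp
  next
    case False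
    have k: "(p \<circ> \<gamma>) permutes S" using g pairingsD(1)[OF less.prems(4)] by (rule permutes_compose)
    have no_adj: "p (\<gamma> x) \<noteq> x" if "x \<in> S" for x using False that by blast
    have "p (\<gamma> (p (\<gamma> x))) = x" if "x \<in> S" for x
      using through_reverses_successor[OF less.prems(2-4,6) _ that]
        no_adjacent_imp_through[OF less.prems(1-4,6) no_adj] pairingsD(4)[OF less.prems(4)]
      by simp
    then show ?thesis using no_fixed_point_count(2)[OF less.prems(1) k] no_adj by auto
  qed
qed

section \<open>Loops from lenses in the strip\<close>

text \<open>
A segment from \<open>P\<close> to \<open>Q\<close>, bent in the direction of \<open>v\<close> along a parabola.
\<close>

definition bow :: "complex \<Rightarrow> complex \<Rightarrow> complex \<Rightarrow> real \<Rightarrow> real \<Rightarrow> complex" where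
  "bow P Q v c t = P + of_real t * (Q - P) + of_real (c * (t * (1 - t))) * v"

text \<open>
All loops will be images of such curves under \<^const>\<open>exp\<close>. In the strip, a lens with \<open>P\<close> and \<open>Q\<close> on the
same edge is an arch, and one with \<open>P\<close> and \<open>Q\<close> on different edges is a thickened spoke.
\<close>

definition lens :: "complex \<Rightarrow> complex \<Rightarrow> complex \<Rightarrow> real \<Rightarrow> real \<Rightarrow> complex set" where
  "lens P Q v c1 c2 = bow P Q v c1 ` {0..1} \<union> bow P Q v c2 ` {0..1}"

lemma real_independent:
  assumes "Im (cnj u * v) \<noteq> 0" "of_real a * u + of_real b * v = (0 :: complex)"
  shows "a = 0" "b = 0"
proof -
  have "Im (cnj u * (of_real a * u + of_real b * v)) = b * Im (cnj u * v)"
    by (simp add: algebra_simps)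
  then show b: "b = 0" using assms by simp
  then show "a = 0" using assms by auto
qed

lemma bow_eqD:
  assumes "Im (cnj (Q - P) * v) \<noteq> 0" "bow P Q v c t = bow P Q v c' t'"
  shows "t = t'" "c * (t * (1 - t)) = c' * (t' * (1 - t'))"
proof -
  have "of_real (t - t') * (Q - P) + of_real (c * (t * (1 - t)) - c' * (t' * (1 - t'))) * v = 0"
    using assms(2) by (simp add: bow_def algebra_simps)
  from real_independent[OF assms(1) this] show "t = t'" "c * (t * (1 - t)) = c' * (t' * (1 - t'))"
    by auto
qed

lemma lens_loop:
  assumes ind: "Im (cnj (Q - P) * v) \<noteq> 0" and c: "c1 \<noteq> c2"
  defines "h \<equiv> bow P Q v c1 +++ reversepath (bow P Q v c2)"
  shows "simple_path h" "path_image h = lens P Q v c1 c2" "h 0 = P" "h 1 = P" "h (1/2) = Q"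
proof -
  have pth: "path (bow P Q v c)" for c
    unfolding path_def bow_def by (intro continuous_intros)
  have ends: "bow P Q v c 0 = P" "bow P Q v c 1 = Q" for c by (auto simp: bow_def)
  have a: "arc (bow P Q v c)" for c
    using pth bow_eqD(1)[OF ind] by (auto simp: arc_def inj_on_def)
  show "path_image h = lens P Q v c1 c2"
    unfolding h_def lens_def
    by (subst path_image_join) (simp_all add: ends pathfinish_def path_image_def[of "bow P Q v _"])
  have sub: "path_image (bow P Q v c1) \<inter> path_image (reversepath (bow P Q v c2)) \<subseteq> {P, Q}"
  proof
    fix z assume "z \<in> path_image (bow P Q v c1) \<inter> path_image (reversepath (bow P Q v c2))"
    then obtain t t' where t: "z = bow P Q v c1 t" "bow P Q v c1 t = bow P Q v c2 t'"
      by (auto simp: path_image_def[of "bow P Q v _"])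
    from bow_eqD[OF ind t(2)] c have "t = 0 \<or> t = 1" by auto
    then show "z \<in> {P, Q}" using t(1) ends by auto
  qed
  show "simple_path h" unfolding h_def
    by (rule simple_path_join_loop)
      (use a sub ends in \<open>auto simp: pathstart_def pathfinish_def reversepath_def intro: arc_reversepath[unfolded reversepath_def]\<close>)
  show "h 0 = P" "h 1 = P" "h (1/2) = Q"
    by (simp_all add: h_def joinpaths_def reversepath_def ends)
qed

text \<open>
The part of \<^const>\<open>draws_cycle\<close> that has to be constructed. The orientation can be corrected afterwards by
reversal, and the inside of a simple closed curve is always a disk.
\<close>

definition draws_pair :: "nat \<Rightarrow> nat \<Rightarrow> nat \<Rightarrow> nat \<Rightarrow> (real \<Rightarrow> complex) \<Rightarrow> bool" where
  "draws_pair k l a b g \<longleftrightarrow> simple_path g \<and> pathfinish g = pathstart g \<and> path_image g \<subseteq> annulus \<and>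
     inside (path_image g) \<subseteq> annulus \<and> g 0 = label_point k l a \<and> g (1/2) = label_point k l b"

text \<open>
A loop that does not wind around \<open>0\<close> has \<open>0\<close>, and with it the whole hole, outside. The points beyond
the outer circle are outside because the loop lies in a convex disk.
\<close>

lemma inside_subset_annulus:
  assumes g: "path g" "pathfinish g = pathstart g" "path_image g \<subseteq> annulus" and w: "winding_number g 0 = 0"
    and sg: "simple_path g"
  shows "inside (path_image g) \<subseteq> annulus"
proof
  let ?K = "path_image g"
  fix z assume z: "z \<in> inside ?K"
  show "z \<in> annulus"
  proof (rule ccontr)
    assume "z \<notin> annulus"
    then consider "cmod z < 1" | "2 < cmod z" by (force simp: annulus_def)
    then show False
    proof cases
      case 1
      have "ball 0 1 \<subseteq> - ?K" using g(3) by (auto simp: annulus_def)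
      then have "connected_component (- ?K) z 0"
        unfolding connected_component_def using 1 by (intro exI[of _ "ball 0 1"]) auto
      then have "0 \<in> inside ?K" using z by (rule inside_same_component)
      then have "norm (winding_number g 0) = 1"
        by (rule simple_closed_path_norm_winding_number_inside[OF sg])
      then show False using w by simp
    next
      case 2
      have "z \<in> outside ?K"
      proof (rule outside_subset_convex[THEN subsetD, of "cball 0 2"])
        show "?K \<subseteq> cball 0 2" using g(3) by (auto simp: annulus_def)
      qed (use 2 in auto)
      then show False using z by (metis disjoint_iff inside_Int_outside)
    qed
  qed
qed

text \<open>
The loop does not wind around \<open>0\<close>, because it has a closed lift.
\<close>

lemma lens_draws_pair:
  assumes ind: "Im (cnj (Q - P) * v) \<noteq> 0" and c: "c1 \<noteq> c2"
    and inj: "inj_on exp (lens P Q v c1 c2)"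
    and strip: "\<And>z. z \<in> lens P Q v c1 c2 \<Longrightarrow> 0 \<le> Re z \<and> Re z \<le> ln 2"
    and ends: "exp P = label_point k l a" "exp Q = label_point k l b"
  obtains g where "draws_pair k l a b g" "path_image g = exp ` lens P Q v c1 c2"
proof -
  define h where "h = bow P Q v c1 +++ reversepath (bow P Q v c2)"
  note L = lens_loop[OF ind c, folded h_def]
  have ph: "path h" using L(1) by (rule simple_path_imp_path)
  have pe: "path (exp \<circ> h)" by (intro path_continuous_image ph continuous_intros)
  have img: "path_image (exp \<circ> h) = exp ` lens P Q v c1 c2" by (simp add: path_image_compose L)
  have simple: "simple_path (exp \<circ> h)"
    unfolding simple_path_def loop_free_def
  proof (intro conjI ballI impI)
    show "path (exp \<circ> h)" by (rule pe)
    fix x y :: real assume xy: "x \<in> {0..1}" "y \<in> {0..1}" and e: "(exp \<circ> h) x = (exp \<circ> h) y"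
    have "h x \<in> lens P Q v c1 c2" "h y \<in> lens P Q v c1 c2" using xy L(2) by (auto simp: path_image_def)
    then have "h x = h y" using e inj by (auto dest: inj_onD)
    then show "x = y \<or> x = 0 \<and> y = 1 \<or> x = 1 \<and> y = 0"
      using L(1) xy by (auto simp: simple_path_def loop_free_def)
  qed
  have closed: "pathfinish (exp \<circ> h) = pathstart (exp \<circ> h)" by (simp add: pathfinish_def pathstart_def L)
  have sub: "path_image (exp \<circ> h) \<subseteq> annulus"
  proof -
    have "1 \<le> exp (Re z) \<and> exp (Re z) \<le> 2" if "z \<in> lens P Q v c1 c2" for z
      using strip[OF that] by (metis exp_le_cancel_iff exp_ln exp_zero zero_less_numeral)
    then show ?thesis by (auto simp: img annulus_def)
  qed
  have "winding_number (exp \<circ> h) 0 = 0"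
    using winding_number_compose_exp[OF ph] L(3,4) by (simp add: pathfinish_def pathstart_def)
  then have "inside (path_image (exp \<circ> h)) \<subseteq> annulus"
    by (rule inside_subset_annulus[OF pe closed sub _ simple])
  then have "draws_pair k l a b (exp \<circ> h)"
    using simple closed sub ends L(3,5) by (simp add: draws_pair_def)
  then show thesis using that img by blast
qed

text \<open>
The loops touch the two circles only at their own labels. This keeps the circle accessible between
neighbouring labels, so that further arches can be added.
\<close>

definition drawn_loops :: "nat \<Rightarrow> nat \<Rightarrow> nat set \<Rightarrow> (nat \<Rightarrow> nat) \<Rightarrow> (nat \<Rightarrow> complex set) \<Rightarrow> bool" where
  "drawn_loops k l S p G \<longleftrightarrow>
     (\<forall>j\<in>S. (\<exists>g. (draws_pair k l j (p j) g \<or> draws_pair k l (p j) j g) \<and> path_image g = G j) \<and>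
        (\<forall>z\<in>G j. cmod z = 1 \<or> cmod z = 2 \<longrightarrow> z \<in> label_point k l ` {j, p j}) \<and> G (p j) = G j) \<and>
     (\<forall>i\<in>S. \<forall>j\<in>S. j \<noteq> i \<and> j \<noteq> p i \<longrightarrow> G i \<inter> G j = {})"

text \<open>
The arc of the circle from \<open>x\<close> to \<open>y\<close> is compact and avoids the loops drawn so far, hence so does a lens
along this arc that is thin enough.
\<close>

lemma add_arch:
  assumes fin: "finite S'" and drawn: "drawn_loops k l S' p' G'" and p': "\<And>z. z \<in> S' \<Longrightarrow> p' z \<in> S'"
    and S: "S = insert x (insert y S')" "x \<notin> S'" "y \<notin> S'" "y \<noteq> x"
    and p: "\<And>z. z \<in> S' \<Longrightarrow> p' z = p z" "p x = y" "p y = x"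
    and inj: "inj_on (label_point k l) S"
    and s: "s = side k x" "side k y = s"
    and d: "d > 0" "label_point k l y = label_point k l x * cis (- s * d)"
      "\<And>e. 0 < e \<Longrightarrow> e < d \<Longrightarrow> label_point k l x * cis (- s * e) \<notin> label_point k l ` S"
  shows "\<exists>G. drawn_loops k l S p G"
proof -
  let ?P = "label_point k l"
  have s1: "s = 1 \<or> s = - 1" using side_cases s(1) by metis
  have cisp: "cis (- s * (2 * pi)) = 1" using s1 by (auto simp: cis.ctr complex_eq_iff)
  \<comment> \<open>A gap of a full turn or more would contain \<open>x\<close> itself.\<close>
  have d2: "d < 2 * pi"
  proof (rule ccontr)
    assume "\<not> d < 2 * pi"
    then consider "d = 2 * pi" | "2 * pi < d" by linarith
    then show False
    proof cases
      case 1
      then have "?P y = ?P x" using d(2) cisp by simp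
      then show False using inj S by (auto dest: inj_onD)
    next
      case 2
      then show False using d(3)[of "2 * pi"] cisp S(1) by simp
    qed
  qed
  define K where "K = (\<Union>j\<in>S'. G' j)"
  have "compact (G' j)" if "j \<in> S'" for j
    using drawn that unfolding drawn_loops_def draws_pair_def
    by (metis compact_path_image simple_path_imp_path)
  then have K: "closed K" unfolding K_def using fin by (intro compact_imp_closed compact_UN) auto
  define A where "A = (\<lambda>e. ?P x * cis (- s * e)) ` {0..d}"
  have "continuous_on {0..d} (\<lambda>e. ?P x * cis (- s * e))" by (intro continuous_intros)
  then have A: "compact A" unfolding A_def by (rule compact_continuous_image) simp
  have nx: "cmod (?P x) = 1 \<or> cmod (?P x) = 2" by (auto simp: norm_label_point)
  have "A \<inter> K = {}"
  proof (rule ccontr)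
    assume "A \<inter> K \<noteq> {}"
    then obtain e j where e: "0 \<le> e" "e \<le> d" and j: "j \<in> S'" "?P x * cis (- s * e) \<in> G' j"
      by (auto simp: A_def K_def)
    have "cmod (?P x * cis (- s * e)) = cmod (?P x)" by (simp add: norm_mult)
    then have "?P x * cis (- s * e) \<in> ?P ` {j, p' j}"
      using drawn j nx unfolding drawn_loops_def by (metis (no_types, lifting))
    then have *: "?P x * cis (- s * e) \<in> ?P ` S'" using j(1) p' by auto
    consider "e = 0" | "e = d" | "0 < e" "e < d" using e by linarith
    then show False
    proof cases
      case 1 then show ?thesis using * inj S by (auto dest!: inj_onD)
    next
      case 2 then have "?P y \<in> ?P ` S'" using * d(2) by simp
      then show ?thesis using inj S by (auto dest!: inj_onD)
    next
      case 3 then show ?thesis using d(3)[of e] * S(1) by auto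
    qed
  qed
  \<comment> \<open>Shrinking the radius by the factor \<open>exp (- r)\<close> (or growing it, on the inner circle) with \<open>r \<le> \<epsilon>\<close>
    moves points of \<open>A\<close> by less than their distance \<open>\<delta>\<close> to the loops in \<open>K\<close>.\<close>
  then obtain \<delta> where \<delta>: "\<delta> > 0" "\<And>a b. a \<in> A \<Longrightarrow> b \<in> K \<Longrightarrow> \<delta> \<le> dist a b"
    using separate_compact_closed[OF A K] by blast
  have "(\<lambda>r. exp (- s * r)) \<midarrow>0\<rightarrow> 1" by (auto intro!: tendsto_eq_intros)
  from LIM_D[OF this, of "\<delta> / 2"] \<delta>(1) obtain \<eta> where \<eta>: "\<eta> > 0"
    "\<And>r. r \<noteq> 0 \<and> \<bar>r\<bar> < \<eta> \<Longrightarrow> \<bar>exp (- s * r) - 1\<bar> < \<delta> / 2"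
    by auto
  define \<epsilon> where "\<epsilon> = min (\<eta> / 2) (ln 2 / 2)"
  have \<epsilon>: "0 < \<epsilon>" "\<epsilon> < \<eta>" "\<epsilon> < ln 2" using \<eta>(1) by (auto simp: \<epsilon>_def min_def)
  obtain w where w: "exp w = ?P x" using label_point_log[of k l x] by blast
  have Rew: "Re w = (if s = 1 then ln 2 else 0)" using exp_label_Re[OF w] s(1) by simp
  define q where "q = w - \<i> * complex_of_real (s * d)"
  have q: "exp q = ?P y" unfolding q_def exp_down w d(2) ..
  let ?v = "complex_of_real (- s)"
  let ?L = "lens w q ?v \<epsilon> (\<epsilon> / 2)"
  have pt: "\<exists>t r. 0 \<le> t \<and> t \<le> 1 \<and> 0 \<le> r \<and> r \<le> \<epsilon> \<and> (r = 0 \<longrightarrow> t = 0 \<or> t = 1) \<and>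
       z = w - \<i> * complex_of_real (s * (d * t)) - complex_of_real (s * r)" if "z \<in> ?L" for z
  proof -
    from that obtain c t where t: "t \<in> {0..1}" and c: "c = \<epsilon> \<or> c = \<epsilon> / 2" and z: "z = bow w q ?v c t"
      unfolding lens_def by blast
    have "t * (1 - t) \<le> 1" using t mult_mono[of t 1 "1 - t" 1] by auto
    then have "c * (t * (1 - t)) \<le> \<epsilon> * 1" using c \<epsilon>(1) t by (intro mult_mono) auto
    moreover have "0 \<le> c * (t * (1 - t))" using c \<epsilon>(1) t by auto
    moreover have "z = w - \<i> * complex_of_real (s * (d * t)) - complex_of_real (s * (c * (t * (1 - t))))"
      unfolding z bow_def q_def by (simp add: algebra_simps)
    ultimately show ?thesis using t c \<epsilon>(1)
      by (intro exI[of _ t] exI[of _ "c * (t * (1 - t))"]) auto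
  qed
  obtain g where g: "draws_pair k l x y g" "path_image g = exp ` ?L"
  proof (rule lens_draws_pair[of q w ?v \<epsilon> "\<epsilon> / 2" k l x y])
    show "Im (cnj (q - w) * ?v) \<noteq> 0" using s1 d(1) by (auto simp: q_def)
    show "\<epsilon> \<noteq> \<epsilon> / 2" using \<epsilon>(1) by simp
    show "inj_on exp ?L"
    proof (rule inj_onI)
      fix z z' assume z: "z \<in> ?L" "z' \<in> ?L" "exp z = exp z'"
      obtain t r where t: "0 \<le> t" "t \<le> 1" and
        zt: "z = w - \<i> * complex_of_real (s * (d * t)) - complex_of_real (s * r)" using pt[OF z(1)] by blast
      obtain t' r' where t': "0 \<le> t'" "t' \<le> 1" and
        zt': "z' = w - \<i> * complex_of_real (s * (d * t')) - complex_of_real (s * r')" using pt[OF z(2)] by blast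
      have "\<bar>Im z - Im z'\<bar> = \<bar>d * (t - t')\<bar>" using s1 by (auto simp: zt zt' algebra_simps)
      also have "\<dots> = d * \<bar>t - t'\<bar>" using d(1) by (simp add: abs_mult)
      also have "\<dots> \<le> d * 1" using t t' d(1) by (intro mult_left_mono) auto
      finally have "\<bar>Im z - Im z'\<bar> < 2 * pi" using d2 by linarith
      then show "z = z'" using z(3) by (rule exp_complex_eqI)
    qed
    show "0 \<le> Re z \<and> Re z \<le> ln 2" if "z \<in> ?L" for z
      using pt[OF that] \<epsilon> s1 Rew by auto
  qed (use w q in auto)
  have touch: "z \<in> ?P ` {x, y}" if "z \<in> exp ` ?L" "cmod z = 1 \<or> cmod z = 2" for z
  proof -
    from that obtain u where u: "u \<in> ?L" "z = exp u" by auto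
    obtain t r where t: "r \<le> \<epsilon>" "0 \<le> r" "r = 0 \<longrightarrow> t = 0 \<or> t = 1" and
      ut: "u = w - \<i> * complex_of_real (s * (d * t)) - complex_of_real (s * r)" using pt[OF u(1)] by blast
    have "exp (Re u) = 1 \<or> exp (Re u) = 2" using that u by simp
    then have "Re u = 0 \<or> Re u = ln 2" by (metis exp_eq_one_iff ln_exp)
    then have "r = 0" using s1 Rew t \<epsilon>(3) by (auto simp: ut)
    then have "u = w \<or> u = q" using t ut by (auto simp: q_def)
    then show ?thesis using u w q by auto
  qed
  have away: "exp ` ?L \<inter> K = {}"
  proof (rule ccontr)
    assume "exp ` ?L \<inter> K \<noteq> {}"
    then obtain u where u: "u \<in> ?L" "exp u \<in> K" by auto
    obtain t r where t: "0 \<le> t" "t \<le> 1" "0 \<le> r" "r \<le> \<epsilon>" and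
      ut: "u = w - \<i> * complex_of_real (s * (d * t)) - complex_of_real (s * r)" using pt[OF u(1)] by blast
    define a where "a = ?P x * cis (- s * (d * t))"
    have "a \<in> A" using t d(1) unfolding A_def a_def by (intro imageI) (auto simp: mult_left_le)
    have "exp u = a * exp (complex_of_real (- s * r))"
      unfolding ut exp_diff[of _ "complex_of_real (s * r)"] exp_down w a_def by (simp add: exp_minus divide_inverse)
    also have "\<dots> = a * complex_of_real (exp (- s * r))" by (simp only: exp_of_real)
    finally have "exp u - a = a * complex_of_real (exp (- s * r) - 1)" by (simp add: algebra_simps)
    then have "dist a (exp u) = cmod a * \<bar>exp (- s * r) - 1\<bar>"
      by (metis dist_commute dist_norm norm_mult norm_of_real)
    also have "\<dots> \<le> 2 * \<bar>exp (- s * r) - 1\<bar>"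
      by (intro mult_right_mono) (use nx in \<open>auto simp: a_def norm_mult\<close>)
    also have "\<dots> < \<delta>" using \<eta>(2)[of r] t \<epsilon> \<delta>(1) by (cases "r = 0") auto
    finally show False using \<delta>(2)[OF \<open>a \<in> A\<close> u(2)] by simp
  qed
  define G where "G j = (if j \<in> S' then G' j else exp ` ?L)" for j
  have old: "(\<exists>g. (draws_pair k l j (p j) g \<or> draws_pair k l (p j) j g) \<and> path_image g = G j) \<and>
        (\<forall>z\<in>G j. cmod z = 1 \<or> cmod z = 2 \<longrightarrow> z \<in> ?P ` {j, p j}) \<and> G (p j) = G j" if "j \<in> S'" for j
  proof -
    have e: "G j = G' j" "G (p j) = G' (p j)" using that p(1)[OF that] p'[OF that] by (auto simp: G_def)
    show ?thesis
      using drawn[unfolded drawn_loops_def, THEN conjunct1, THEN bspec, OF that]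
      unfolding e p(1)[OF that] .
  qed
  have new: "(\<exists>g. (draws_pair k l j (p j) g \<or> draws_pair k l (p j) j g) \<and> path_image g = G j) \<and>
        (\<forall>z\<in>G j. cmod z = 1 \<or> cmod z = 2 \<longrightarrow> z \<in> ?P ` {j, p j}) \<and> G (p j) = G j" if "j = x \<or> j = y" for j
  proof -
    have e: "G j = exp ` ?L" "G (p j) = exp ` ?L" "{j, p j} = {x, y}"
      using that p(2,3) S(2,3) by (auto simp: G_def)
    have "\<exists>g. (draws_pair k l j (p j) g \<or> draws_pair k l (p j) j g) \<and> path_image g = exp ` ?L"
      using that g p(2,3) by (intro exI[of _ g]) auto
    then show ?thesis unfolding e using touch by blast
  qed
  have disj: "G i \<inter> G j = {}" if "i \<in> S" "j \<in> S" "j \<noteq> i" "j \<noteq> p i" for i j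
  proof -
    have K1: "G' i \<inter> exp ` ?L = {}" if "i \<in> S'" for i using away that by (auto simp: K_def)
    show ?thesis
    proof (cases "i \<in> S'"; cases "j \<in> S'")
      assume "i \<in> S'" "j \<in> S'"
      then show ?thesis using drawn that p(1)[of i] unfolding drawn_loops_def G_def by auto
    next
      assume "i \<in> S'" "j \<notin> S'"
      then show ?thesis using K1[of i] by (simp add: G_def)
    next
      assume "i \<notin> S'" "j \<in> S'"
      then show ?thesis using K1[of j] by (simp add: G_def Int_commute)
    next
      assume "i \<notin> S'" "j \<notin> S'"
      then show ?thesis using that S p by auto
    qed
  qed
  have "drawn_loops k l S p G"
    unfolding drawn_loops_def using old new disj S(1) by (intro conjI ballI impI) auto
  then show ?thesis by blast
qed

section \<open>Spoke diagrams\<close>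

text \<open>
The depth \<open>\<phi>\<close> of \<open>z\<close> is the clockwise angle from \<open>z0\<close> to \<open>z\<close>, counted from \<open>0\<close> up to a full turn. It
gives the labels of a circle a linear order with first element \<open>z0\<close>.
\<close>

lemma depth_exists:
  fixes z z0 :: complex
  assumes "cmod z = cmod z0" "z0 \<noteq> 0"
  obtains \<phi> where "0 \<le> \<phi>" "\<phi> < 2 * pi" "z = z0 * cis (- \<phi>)"
proof -
  have "z \<noteq> 0" using assms by auto
  have "cmod (z0 / z) = 1" using assms by (simp add: norm_divide)
  then have "z0 / z = cis (Arg2pi (z0 / z))" using Arg2pi_eq[of "z0 / z"] by (simp add: cis_conv_exp)
  then obtain \<phi> where \<phi>: "0 \<le> \<phi>" "\<phi> < 2 * pi" and e: "z0 / z = cis \<phi>"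
    using Arg2pi_ge_0 Arg2pi_lt_2pi by blast
  have "z0 * cis (- \<phi>) = z * (z0 / z * cis (- \<phi>))" using \<open>z \<noteq> 0\<close> by simp
  also have "\<dots> = z" unfolding e by (simp add: cis_mult)
  finally show thesis using that \<phi> by simp
qed

lemma cis_depth_unique:
  assumes "cis (- \<phi>) = cis (- \<psi>)" "0 \<le> \<phi>" "\<phi> < 2 * pi" "0 \<le> \<psi>" "\<psi> < 2 * pi"
  shows "\<phi> = \<psi>"
proof -
  have "exp (\<i> * complex_of_real (- \<phi>)) = exp (\<i> * complex_of_real (- \<psi>))"
    using assms(1) by (simp only: cis_conv_exp)
  then have "\<i> * complex_of_real (- \<phi>) = \<i> * complex_of_real (- \<psi>)"
    by (rule exp_complex_eqI[rotated]) (use assms in auto)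
  then show ?thesis by simp
qed

text \<open>
The next point cannot lie behind \<open>z0\<close>, since \<open>z0\<close> itself belongs to \<open>A\<close>.
\<close>

lemma depth_step:
  fixes z0 :: complex
  assumes "z0 \<in> A" "z0 \<noteq> 0" "0 \<le> \<phi>" "\<phi> < 2 * pi" "0 < d"
    and gap: "\<And>e. 0 < e \<Longrightarrow> e < d \<Longrightarrow> z0 * cis (- \<phi>) * cis (- e) \<notin> A"
    and \<phi>': "0 \<le> \<phi>'" "\<phi>' < 2 * pi" "z0 * cis (- \<phi>') = z0 * cis (- \<phi>) * cis (- d)"
  shows "\<phi>' = 0 \<or> \<phi>' = \<phi> + d" "\<phi> + d \<le> 2 * pi" "\<phi>' = 0 \<Longrightarrow> \<phi> + d = 2 * pi"
proof -
  have turn: "z0 * cis (- \<phi>) * cis (- (2 * pi - \<phi>)) = z0"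
    by (simp add: mult.assoc cis_mult) (simp add: cis.ctr complex_eq_iff)
  show le: "\<phi> + d \<le> 2 * pi"
  proof (rule ccontr)
    assume "\<not> \<phi> + d \<le> 2 * pi"
    then have "z0 * cis (- \<phi>) * cis (- (2 * pi - \<phi>)) \<notin> A"
      using assms(4) by (intro gap) auto
    then show False unfolding turn using assms(1) by contradiction
  qed
  have e: "cis (- \<phi>') = cis (- (\<phi> + d))"
    using \<phi>'(3) \<open>z0 \<noteq> 0\<close> by (simp add: mult.assoc cis_mult)
  have *: "\<phi>' = 0" if "\<phi> + d = 2 * pi"
    using e \<phi>' that by (intro cis_depth_unique) (auto simp: cis.ctr)
  show disj: "\<phi>' = 0 \<or> \<phi>' = \<phi> + d"
    using cis_depth_unique[OF e] \<phi>' le * assms(3,5) by fastforce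
  show "\<phi> + d = 2 * pi" if "\<phi>' = 0"
  proof (rule ccontr)
    assume "\<phi> + d \<noteq> 2 * pi"
    then have "\<phi>' = \<phi> + d" using cis_depth_unique[OF e] \<phi>' le assms(3,5) by linarith
    then show False using that assms(3,5) by simp
  qed
qed

text \<open>
Outer labels and their partners are ordered alike, if depths are measured from the two ends of one
spoke. For neighbouring labels this holds because \<open>p\<close> reverses \<open>\<gamma>\<close>, and it extends to arbitrary labels
by following \<open>\<gamma>\<close>. It is the condition under which straight spokes do not cross.
\<close>

lemma spoke_depths:
  assumes fin: "finite S" and inj: "inj_on (label_point k l) S"
    and succ: "successor_on k l S \<gamma>" and p: "p \<in> pairings S"
    and through: "\<And>x. x \<in> S \<Longrightarrow> side k (p x) = - side k x"
    and rev: "\<And>x. x \<in> S \<Longrightarrow> \<gamma> (p (\<gamma> x)) = p x"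
    and x0: "x0 \<in> S" "side k x0 = 1"
  obtains \<phi> \<psi> :: "nat \<Rightarrow> real" where
    "\<And>a. a \<in> {a \<in> S. side k a = 1} \<Longrightarrow> 0 \<le> \<phi> a \<and> \<phi> a < 2 * pi \<and>
       label_point k l a = label_point k l x0 * cis (- \<phi> a)"
    "\<And>a. a \<in> {a \<in> S. side k a = 1} \<Longrightarrow> 0 \<le> \<psi> a \<and> \<psi> a < 2 * pi \<and>
       label_point k l (p a) = label_point k l (p x0) * cis (- \<psi> a)"
    "\<And>a b. a \<in> {a \<in> S. side k a = 1} \<Longrightarrow> b \<in> {a \<in> S. side k a = 1} \<Longrightarrow> \<phi> a < \<phi> b \<Longrightarrow> \<psi> a < \<psi> b"
    "\<And>a b. a \<in> {a \<in> S. side k a = 1} \<Longrightarrow> b \<in> {a \<in> S. side k a = 1} \<Longrightarrow> a \<noteq> b \<Longrightarrow> \<phi> a \<noteq> \<phi> b"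
proof -
  let ?P = "label_point k l"
  note P = pairingsD[OF p]
  note nz = label_point_nonzero[of k l]
  define O' where "O' = {a \<in> S. side k a = 1}"
  have O': "a \<in> S" "side k a = 1" "p a \<in> S" "side k (p a) = - 1" if "a \<in> O'" for a
    using that P(2) through by (auto simp: O'_def)
  have x0': "x0 \<in> O'" using x0 by (simp add: O'_def)
  have g: "\<gamma> a \<in> S" "side k (\<gamma> a) = side k a" if "a \<in> S" for a
    using succ that unfolding successor_on_def by (metis permutes_in_image)+
  have "\<exists>\<phi>\<ge>0. \<phi> < 2 * pi \<and> ?P a = ?P x0 * cis (- \<phi>)" if "a \<in> O'" for a
    by (rule depth_exists[of "?P a" "?P x0"]) (use O'[OF that] O'[OF x0'] nz in \<open>auto simp: norm_label_point\<close>)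
  then obtain \<phi> where \<phi>: "\<And>a. a \<in> O' \<Longrightarrow> 0 \<le> \<phi> a \<and> \<phi> a < 2 * pi \<and> ?P a = ?P x0 * cis (- \<phi> a)"
    by metis
  have "\<exists>\<psi>\<ge>0. \<psi> < 2 * pi \<and> ?P (p a) = ?P (p x0) * cis (- \<psi>)" if "a \<in> O'" for a
    by (rule depth_exists[of "?P (p a)" "?P (p x0)"]) (use O'[OF that] O'[OF x0'] nz in \<open>auto simp: norm_label_point\<close>)
  then obtain \<psi> where \<psi>: "\<And>a. a \<in> O' \<Longrightarrow> 0 \<le> \<psi> a \<and> \<psi> a < 2 * pi \<and> ?P (p a) = ?P (p x0) * cis (- \<psi> a)"
    by metis
  have \<phi>b: "0 \<le> \<phi> a" "\<phi> a < 2 * pi" if "a \<in> O'" for a using \<phi>[OF that] by auto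
  have \<psi>b: "0 \<le> \<psi> a" "\<psi> a < 2 * pi" if "a \<in> O'" for a using \<psi>[OF that] by auto
  have \<phi>inj: "a = b" if "a \<in> O'" "b \<in> O'" "\<phi> a = \<phi> b" for a b
    using \<phi>[OF that(1)] \<phi>[OF that(2)] that O' inj by (metis inj_onD)
  have \<psi>inj: "a = b" if "a \<in> O'" "b \<in> O'" "\<psi> a = \<psi> b" for a b
  proof -
    have "p a = p b" using \<psi>[OF that(1)] \<psi>[OF that(2)] that O' inj by (metis inj_onD)
    then show ?thesis using P(4) by metis
  qed
  have \<phi>0: "\<phi> x0 = 0"
  proof (rule cis_depth_unique)
    have "?P x0 = ?P x0 * cis (- \<phi> x0)" using \<phi>[OF x0'] by simp
    then show "cis (- \<phi> x0) = cis (- 0)" using nz[of x0] by simp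
  qed (use \<phi>[OF x0'] in auto)
  have \<psi>0: "\<psi> x0 = 0"
  proof (rule cis_depth_unique)
    have "?P (p x0) = ?P (p x0) * cis (- \<psi> x0)" using \<psi>[OF x0'] by simp
    then show "cis (- \<psi> x0) = cis (- 0)" using nz[of "p x0"] by simp
  qed (use \<psi>[OF x0'] in auto)
  have next_spoke: "\<gamma> a \<in> O' \<and> \<phi> a < \<phi> (\<gamma> a) \<and> \<phi> (\<gamma> a) \<le> \<phi> b \<and> \<psi> a < \<psi> (\<gamma> a)"
    if a: "a \<in> O'" and b: "b \<in> O'" and less: "\<phi> a < \<phi> b" for a b
  proof -
    have ga: "\<gamma> a \<in> O'" using g[of a] O'[OF a] by (simp add: O'_def)
    obtain d where d: "d > 0" "?P (\<gamma> a) = ?P a * cis (- d)"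
      "\<And>e. 0 < e \<Longrightarrow> e < d \<Longrightarrow> ?P a * cis (- e) \<notin> ?P ` S"
      using succ O'(1,2)[OF a] unfolding successor_on_def by auto
    have Pa: "?P x0 * cis (- \<phi> a) = ?P a" using \<phi>[OF a] by simp
    have Pga: "?P x0 * cis (- \<phi> (\<gamma> a)) = ?P x0 * cis (- \<phi> a) * cis (- d)"
      unfolding Pa using \<phi>[OF ga] d(2) by simp
    have step: "\<phi> (\<gamma> a) = 0 \<or> \<phi> (\<gamma> a) = \<phi> a + d" "\<phi> (\<gamma> a) = 0 \<longrightarrow> \<phi> a + d = 2 * pi"
    proof -
      have gap: "?P x0 * cis (- \<phi> a) * cis (- e) \<notin> ?P ` S" if "0 < e" "e < d" for e
        unfolding Pa using d(3) that .
      have "?P x0 \<in> ?P ` S" using x0 by simp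
      note depth_step[OF this nz \<phi>b[OF a] d(1) gap \<phi>b[OF ga] Pga]
      then show "\<phi> (\<gamma> a) = 0 \<or> \<phi> (\<gamma> a) = \<phi> a + d" "\<phi> (\<gamma> a) = 0 \<longrightarrow> \<phi> a + d = 2 * pi"
        by blast+
    qed
    have "?P a * cis (- (\<phi> b - \<phi> a)) = ?P b"
      using \<phi>[OF a] \<phi>[OF b] by (simp add: mult.assoc cis_mult del: mult_cancel_left)
    then have "\<not> \<phi> b - \<phi> a < d"
      using d(3)[of "\<phi> b - \<phi> a"] less O'(1)[OF b] by (metis diff_gt_0_iff_gt imageI)
    then have ab: "\<phi> a + d \<le> \<phi> b" by simp
    then have gaeq: "\<phi> (\<gamma> a) = \<phi> a + d" using step \<phi>b[OF b] by auto
    then have "\<gamma> a \<noteq> x0" using \<phi>0 \<phi>b[OF a] d(1) by auto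
    have retrace: "\<gamma> (p (\<gamma> a)) = p a" by (rule rev[OF O'(1)[OF a]])
    obtain d' where d': "d' > 0" "?P (p a) = ?P (p (\<gamma> a)) * cis d'"
      "\<And>e. 0 < e \<Longrightarrow> e < d' \<Longrightarrow> ?P (p (\<gamma> a)) * cis e \<notin> ?P ` S"
      using succ O'(3,4)[OF ga] retrace unfolding successor_on_def by auto
    have gap: "?P (p a) * cis (- e) \<notin> ?P ` S" if "0 < e" "e < d'" for e
      using d'(3)[of "d' - e"] that unfolding d'(2) by (simp add: mult.assoc cis_mult)
    have "?P (p (\<gamma> a)) = ?P (p a) * cis (- d')"
      unfolding d'(2) by (simp add: mult.assoc cis_mult)
    moreover have Ppa: "?P (p x0) * cis (- \<psi> a) = ?P (p a)" using \<psi>[OF a] by simp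
    ultimately have Ppga: "?P (p x0) * cis (- \<psi> (\<gamma> a)) = ?P (p x0) * cis (- \<psi> a) * cis (- d')"
      using \<psi>[OF ga] by simp
    have "\<psi> (\<gamma> a) = 0 \<or> \<psi> (\<gamma> a) = \<psi> a + d'"
    proof -
      have gap': "?P (p x0) * cis (- \<psi> a) * cis (- e) \<notin> ?P ` S" if "0 < e" "e < d'" for e
        unfolding Ppa using gap that .
      have "?P (p x0) \<in> ?P ` S" using O'(3)[OF x0'] by simp
      from depth_step(1)[OF this nz \<psi>b[OF a] d'(1) gap' \<psi>b[OF ga] Ppga] show ?thesis .
    qed
    moreover have "\<psi> (\<gamma> a) \<noteq> 0" using \<psi>inj[OF ga x0'] \<psi>0 \<open>\<gamma> a \<noteq> x0\<close> by auto
    ultimately show ?thesis using ga ab gaeq d(1) d'(1) by auto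
  qed
  \<comment> \<open>Induction on the number of labels between \<open>a\<close> and \<open>b\<close>, both included on the side of \<open>b\<close>.\<close>
  have mono: "\<psi> a < \<psi> b" if "a \<in> O'" "b \<in> O'" "\<phi> a < \<phi> b" for a b
    using that
  proof (induction "card {z \<in> O'. \<phi> a < \<phi> z \<and> \<phi> z \<le> \<phi> b}" arbitrary: a rule: less_induct)
    case less
    note n = next_spoke[OF less.prems]
    show ?case
    proof (cases "\<phi> (\<gamma> a) = \<phi> b")
      case True
      then have "\<gamma> a = b" using \<phi>inj n less.prems by blast
      then show ?thesis using n by auto
    next
      case False
      have "finite O'" using fin by (simp add: O'_def)
      then have "card {z \<in> O'. \<phi> (\<gamma> a) < \<phi> z \<and> \<phi> z \<le> \<phi> b} < card {z \<in> O'. \<phi> a < \<phi> z \<and> \<phi> z \<le> \<phi> b}"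
        using n by (intro psubset_card_mono) auto
      then have "\<psi> (\<gamma> a) < \<psi> b" using less.hyps[of "\<gamma> a"] n less.prems False by auto
      then show ?thesis using n by linarith
    qed
  qed
  show thesis
    by (rule that[of \<phi> \<psi>]; fold O'_def; use \<phi> \<psi> mono \<phi>inj in blast)
qed

text \<open>
At equal radius, the angles of two straight spokes differ by a convex combination of their differences
on the two circles, which lie between \<open>\<delta>\<close> and \<open>2 * pi - \<delta>\<close>. Bending both spokes by at most \<open>\<delta> / 4\<close>
keeps them apart.
\<close>

lemma drawn_spokes:
  assumes fin: "finite S" and inj: "inj_on (label_point k l) S"
    and succ: "successor_on k l S \<gamma>" and p: "p \<in> pairings S"
    and through: "\<And>x. x \<in> S \<Longrightarrow> side k (p x) = - side k x"
    and rev: "\<And>x. x \<in> S \<Longrightarrow> \<gamma> (p (\<gamma> x)) = p x"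
  shows "\<exists>G. drawn_loops k l S p G"
proof (cases "S = {}")
  case True
  then show ?thesis by (simp add: drawn_loops_def)
next
  case False
  let ?P = "label_point k l"
  note P = pairingsD[OF p]
  define O' where "O' = {a \<in> S. side k a = 1}"
  have O': "a \<in> S" "side k a = 1" "p a \<in> S" "side k (p a) = - 1" if "a \<in> O'" for a
    using that P(2) through by (auto simp: O'_def)
  have pO': "p a \<in> O'" if "a \<in> S" "a \<notin> O'" for a
    using that P(2) through[of a] side_cases[of k a] by (auto simp: O'_def)
  obtain x0 where x0': "x0 \<in> O'" using False pO' by blast
  obtain \<phi> \<psi> :: "nat \<Rightarrow> real" where
    \<phi>: "\<And>a. a \<in> O' \<Longrightarrow> 0 \<le> \<phi> a \<and> \<phi> a < 2 * pi \<and> ?P a = ?P x0 * cis (- \<phi> a)"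
    and \<psi>: "\<And>a. a \<in> O' \<Longrightarrow> 0 \<le> \<psi> a \<and> \<psi> a < 2 * pi \<and> ?P (p a) = ?P (p x0) * cis (- \<psi> a)"
    and mono: "\<And>a b. a \<in> O' \<Longrightarrow> b \<in> O' \<Longrightarrow> \<phi> a < \<phi> b \<Longrightarrow> \<psi> a < \<psi> b"
    and \<phi>inj: "\<And>a b. a \<in> O' \<Longrightarrow> b \<in> O' \<Longrightarrow> a \<noteq> b \<Longrightarrow> \<phi> a \<noteq> \<phi> b"
    using spoke_depths[OF fin inj succ p through rev O'(1,2)[OF x0'], folded O'_def] by blast
  have \<phi>b: "0 \<le> \<phi> a" "\<phi> a < 2 * pi" if "a \<in> O'" for a using \<phi>[OF that] by auto
  have \<psi>b: "0 \<le> \<psi> a" "\<psi> a < 2 * pi" if "a \<in> O'" for a using \<psi>[OF that] by auto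
  obtain w0 v0 where w0: "exp w0 = ?P x0" and v0: "exp v0 = ?P (p x0)"
    using label_point_log[of k l x0] label_point_log[of k l "p x0"] by blast
  have Re0: "Re w0 = ln 2" "Re v0 = 0"
    using exp_label_Re[OF w0] exp_label_Re[OF v0] O'[OF x0'] by auto
  define w v where "w a = w0 - \<i> * complex_of_real (1 * \<phi> a)" and "v a = v0 - \<i> * complex_of_real (1 * \<psi> a)" for a
  have exp_w: "exp (w a) = ?P a" and exp_v: "exp (v a) = ?P (p a)" if "a \<in> O'" for a
    unfolding w_def v_def exp_down w0 v0 using \<phi>[OF that] \<psi>[OF that] by simp_all
  \<comment> \<open>Angles count modulo \<open>2 * pi\<close>, so both a difference and its complement have to stay away from \<open>0\<close>.\<close>
  define gap where "gap a b = Min {\<bar>\<phi> a - \<phi> b\<bar>, 2 * pi - \<bar>\<phi> a - \<phi> b\<bar>, \<bar>\<psi> a - \<psi> b\<bar>, 2 * pi - \<bar>\<psi> a - \<psi> b\<bar>}" for a b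
  define \<delta> where "\<delta> = Min (insert 1 ((\<lambda>(a, b). gap a b) ` {(a, b). a \<in> O' \<and> b \<in> O' \<and> a \<noteq> b}))"
  have finO: "finite {(a, b). a \<in> O' \<and> b \<in> O' \<and> a \<noteq> b}"
    by (rule finite_subset[of _ "S \<times> S"]) (use fin in \<open>auto simp: O'_def\<close>)
  have gap_pos: "gap a b > 0" if "a \<in> O'" "b \<in> O'" "a \<noteq> b" for a b
  proof -
    have "\<phi> a \<noteq> \<phi> b" by (rule \<phi>inj[OF that])
    moreover then have "\<psi> a \<noteq> \<psi> b" using mono[of a b] mono[of b a] that by (cases "\<phi> a < \<phi> b") auto
    ultimately show ?thesis
      using \<phi>b[OF that(1)] \<phi>b[OF that(2)] \<psi>b[OF that(1)] \<psi>b[OF that(2)] by (simp add: gap_def) linarith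
  qed
  have \<delta>0: "\<delta> > 0" unfolding \<delta>_def using finO gap_pos by (subst Min_gr_iff) auto
  have \<delta>1: "\<delta> \<le> 1" unfolding \<delta>_def using finO by (intro Min_le) auto
  have \<delta>gap: "\<delta> \<le> gap a b" if "a \<in> O'" "b \<in> O'" "a \<noteq> b" for a b
    unfolding \<delta>_def using finO that by (intro Min_le) auto
  have sep: "\<delta> \<le> \<bar>\<phi> a - \<phi> b\<bar>" "\<bar>\<phi> a - \<phi> b\<bar> \<le> 2 * pi - \<delta>" "\<delta> \<le> \<bar>\<psi> a - \<psi> b\<bar>" "\<bar>\<psi> a - \<psi> b\<bar> \<le> 2 * pi - \<delta>"
    if "a \<in> O'" "b \<in> O'" "a \<noteq> b" for a b
    using \<delta>gap[OF that] by (simp_all add: gap_def)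
  define \<epsilon> where "\<epsilon> = \<delta> / 4"
  define L where "L a = lens (w a) (v a) \<i> \<epsilon> (- \<epsilon>)" for a
  have pt: "\<exists>t r. 0 \<le> t \<and> t \<le> 1 \<and> \<bar>r\<bar> \<le> \<epsilon> \<and> (t = 0 \<or> t = 1 \<longrightarrow> r = 0) \<and>
      z = Complex ((1 - t) * ln 2) ((1 - t) * (Im w0 - \<phi> a) + t * (Im v0 - \<psi> a) + r)" if z: "z \<in> L a" for z a
  proof -
    from z obtain c t where t: "t \<in> {0..1}" and c: "c = \<epsilon> \<or> c = - \<epsilon>" and zb: "z = bow (w a) (v a) \<i> c t"
      unfolding L_def lens_def by blast
    have "t * (1 - t) \<le> 1" using t mult_mono[of t 1 "1 - t" 1] by auto
    then have "\<epsilon> * (t * (1 - t)) \<le> \<epsilon> * 1" using \<delta>0 t by (intro mult_left_mono) (auto simp: \<epsilon>_def)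
    moreover have "0 \<le> \<epsilon> * (t * (1 - t))" using \<delta>0 t by (auto simp: \<epsilon>_def)
    ultimately have "\<bar>c * (t * (1 - t))\<bar> \<le> \<epsilon>" using c by auto
    moreover have "z = Complex ((1 - t) * ln 2) ((1 - t) * (Im w0 - \<phi> a) + t * (Im v0 - \<psi> a) + c * (t * (1 - t)))"
      unfolding zb bow_def w_def v_def by (simp add: complex_eq_iff Re0 algebra_simps)
    ultimately show ?thesis using t by (intro exI[of _ t] exI[of _ "c * (t * (1 - t))"]) auto
  qed
  have same_time: "t = t'" if "exp (Complex ((1 - t) * ln 2) y) = exp (Complex ((1 - t') * ln 2) y')" for t t' y y'
  proof -
    have "exp ((1 - t) * ln 2) = exp ((1 - t') * ln 2 :: real)"
      using arg_cong[OF that, of cmod] by simp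
    then show ?thesis by simp
  qed
  have injL: "inj_on exp (L a)" for a
  proof (rule inj_onI)
    fix z z' assume z: "z \<in> L a" "z' \<in> L a" and e: "exp z = exp z'"
    obtain t r where r: "\<bar>r\<bar> \<le> \<epsilon>" and
      zt: "z = Complex ((1 - t) * ln 2) ((1 - t) * (Im w0 - \<phi> a) + t * (Im v0 - \<psi> a) + r)"
      using pt[OF z(1)] by blast
    obtain t' r' where r': "\<bar>r'\<bar> \<le> \<epsilon>" and
      zt': "z' = Complex ((1 - t') * ln 2) ((1 - t') * (Im w0 - \<phi> a) + t' * (Im v0 - \<psi> a) + r')"
      using pt[OF z(2)] by blast
    have "t = t'" using e unfolding zt zt' by (rule same_time)
    then have "\<bar>Im z - Im z'\<bar> < 2 * pi" using r r' \<delta>1 pi_gt3 by (simp add: zt zt' \<epsilon>_def)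
    then show "z = z'" using e by (rule exp_complex_eqI)
  qed
  have apart: "exp z \<noteq> exp z'" if "a \<in> O'" "b \<in> O'" "\<phi> a < \<phi> b" and z: "z \<in> L a" "z' \<in> L b" for a b z z'
  proof
    assume e: "exp z = exp z'"
    obtain t r where t: "0 \<le> t" "t \<le> 1" and r: "\<bar>r\<bar> \<le> \<epsilon>" and
      zt: "z = Complex ((1 - t) * ln 2) ((1 - t) * (Im w0 - \<phi> a) + t * (Im v0 - \<psi> a) + r)"
      using pt[OF z(1)] by blast
    obtain t' r' where r': "\<bar>r'\<bar> \<le> \<epsilon>" and
      zt': "z' = Complex ((1 - t') * ln 2) ((1 - t') * (Im w0 - \<phi> b) + t' * (Im v0 - \<psi> b) + r')"
      using pt[OF z(2)] by blast
    have tt: "t = t'" using e unfolding zt zt' by (rule same_time)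
    have ne: "a \<noteq> b" using that(3) by auto
    have d: "\<delta> \<le> \<phi> b - \<phi> a" "\<phi> b - \<phi> a \<le> 2 * pi - \<delta>" "\<delta> \<le> \<psi> b - \<psi> a" "\<psi> b - \<psi> a \<le> 2 * pi - \<delta>"
      using sep[OF that(1,2) ne] that(3) mono[OF that(1-3)] by auto
    define X where "X = (1 - t) * (\<phi> b - \<phi> a) + t * (\<psi> b - \<psi> a)"
    have "(1 - t) * \<delta> + t * \<delta> \<le> X" "X \<le> (1 - t) * (2 * pi - \<delta>) + t * (2 * pi - \<delta>)"
      unfolding X_def using d t by (auto intro!: add_mono mult_left_mono)
    then have X: "\<delta> \<le> X" "X \<le> 2 * pi - \<delta>" by (auto simp: algebra_simps)
    have "Im z - Im z' = X + r - r'" unfolding X_def zt zt' tt by (simp add: algebra_simps)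
    then have "0 < Im z - Im z'" "Im z - Im z' < 2 * pi"
      using X r r' \<delta>0 unfolding \<epsilon>_def by linarith+
    then show False using exp_complex_eqI[OF _ e] by auto
  qed
  have disjL: "exp ` L a \<inter> exp ` L b = {}" if "a \<in> O'" "b \<in> O'" "a \<noteq> b" for a b
  proof -
    have "\<phi> a < \<phi> b \<or> \<phi> b < \<phi> a" using \<phi>inj[OF that] by auto
    then have "exp z \<noteq> exp z'" if "z \<in> L a" "z' \<in> L b" for z z'
      using apart[OF \<open>a \<in> O'\<close> \<open>b \<in> O'\<close> _ that] apart[OF \<open>b \<in> O'\<close> \<open>a \<in> O'\<close> _ that(2,1)] by metis
    then show ?thesis by (auto simp del: exp_not_eq_zero)
  qed
  have touch: "z \<in> ?P ` {a, p a}" if a: "a \<in> O'" and z: "z \<in> exp ` L a" and n: "cmod z = 1 \<or> cmod z = 2" for a z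
  proof -
    from z obtain u where u: "u \<in> L a" "z = exp u" by auto
    obtain t r where t: "t = 0 \<or> t = 1 \<longrightarrow> r = 0" and
      ut: "u = Complex ((1 - t) * ln 2) ((1 - t) * (Im w0 - \<phi> a) + t * (Im v0 - \<psi> a) + r)"
      using pt[OF u(1)] by blast
    have "exp (Re u) = 1 \<or> exp (Re u) = 2" using n u by simp
    then have "Re u = 0 \<or> Re u = ln 2" by (metis exp_eq_one_iff ln_exp)
    then have "t = 1 \<or> t = 0" by (auto simp: ut)
    then have "u = w a \<or> u = v a" using t by (auto simp: ut w_def v_def complex_eq_iff Re0)
    then show ?thesis using u exp_w[OF a] exp_v[OF a] by auto
  qed
  have loop: "\<exists>g. draws_pair k l a (p a) g \<and> path_image g = exp ` L a" if a: "a \<in> O'" for a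
  proof -
    have "0 \<le> Re z \<and> Re z \<le> ln 2" if "z \<in> L a" for z
      using pt[OF that] by (auto simp: mult_left_le_one_le)
    moreover have "Im (cnj (v a - w a) * \<i>) \<noteq> 0" by (simp add: v_def w_def Re0)
    moreover have "\<epsilon> \<noteq> - \<epsilon>" using \<delta>0 by (simp add: \<epsilon>_def)
    ultimately show ?thesis
      using lens_draws_pair[of "v a" "w a" \<i> \<epsilon> "- \<epsilon>" k l a "p a"] injL[of a] exp_w[OF a] exp_v[OF a]
      unfolding L_def by metis
  qed
  define rep where "rep j = (if j \<in> O' then j else p j)" for j
  have rep: "rep j \<in> O'" "{rep j, p (rep j)} = {j, p j}" "rep (p j) = rep j" if "j \<in> S" for j
  proof -
    have "j \<notin> O' \<or> p j \<notin> O'" using O'(2,4) by fastforce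
    then show "rep j \<in> O'" "{rep j, p (rep j)} = {j, p j}" "rep (p j) = rep j"
      using pO'[OF that] P(4)[of j] by (auto simp: rep_def)
  qed
  have "drawn_loops k l S p (\<lambda>j. exp ` L (rep j))"
    unfolding drawn_loops_def
  proof (intro conjI ballI impI)
    fix j assume j: "j \<in> S"
    obtain g where g: "draws_pair k l (rep j) (p (rep j)) g" "path_image g = exp ` L (rep j)"
      using loop[OF rep(1)[OF j]] by blast
    have "(rep j = j \<and> p (rep j) = p j) \<or> (rep j = p j \<and> p (rep j) = j)"
      using rep(2)[OF j] by (metis doubleton_eq_iff)
    then show "\<exists>g. (draws_pair k l j (p j) g \<or> draws_pair k l (p j) j g) \<and> path_image g = exp ` L (rep j)"
      using g by (intro exI[of _ g]) auto
    show "exp ` L (rep (p j)) = exp ` L (rep j)" using rep(3)[OF j] by simp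
    fix z assume "z \<in> exp ` L (rep j)" "cmod z = 1 \<or> cmod z = 2"
    from touch[OF rep(1)[OF j] this] show "z \<in> ?P ` {j, p j}" unfolding rep(2)[OF j] .
  next
    fix i j assume ij: "i \<in> S" "j \<in> S" "j \<noteq> i \<and> j \<noteq> p i"
    have "rep i \<noteq> rep j" using rep(2)[OF ij(1)] rep(2)[OF ij(2)] ij(3) by (metis insertI1 insertE singletonD)
    then show "exp ` L (rep i) \<inter> exp ` L (rep j) = {}" by (intro disjL rep ij)
  qed
  then show ?thesis by blast
qed

text \<open>
Equality in the cycle bound is inherited when an adjacent pair is removed, and the pair is drawn back
as an arch. In the final case \<open>p \<circ> \<gamma>\<close> is an involution; then links propagate along the orbits of \<open>\<gamma>\<close>,
and all pairs are spokes.
\<close>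

lemma cycle_count_imp_drawn_loops:
  assumes "finite S" "inj_on (label_point k l) S" "successor_on k l S \<gamma>" "p \<in> pairings S"
    "linked S \<gamma> p (side k)" "2 * card (cycle_sets S (p \<circ> \<gamma>)) = card S"
  shows "\<exists>G. drawn_loops k l S p G"
  using assms
proof (induction "card S" arbitrary: S \<gamma> p rule: less_induct)
  case less
  have g: "\<gamma> permutes S" using less.prems(3) by (simp add: successor_on_def)
  note P = pairingsD[OF less.prems(4)]
  show ?case
  proof (cases "\<exists>x\<in>S. p (\<gamma> x) = x")
    case True
    then obtain x where x: "x \<in> S" "p (\<gamma> x) = x" by blast
    note R = remove_adjacent_pair[OF less.prems(1) g less.prems(4,5) x]
    let ?S = "S - {x} - {\<gamma> x}" and ?p = "Transposition.transpose x (\<gamma> x) \<circ> p"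
    have inj1: "inj_on (label_point k l) (S - {x})" and inj2: "inj_on (label_point k l) ?S"
      using less.prems(2) by (auto intro: inj_on_subset)
    have "successor_on k l (S - {x}) (skip \<gamma> x)"
      by (rule successor_on_skip[OF less.prems(3,2) x(1)])
    then have succ: "successor_on k l ?S (skip (skip \<gamma> x) (\<gamma> x))"
      by (rule successor_on_skip[OF _ inj1]) (use R(1,2) in auto)
    have fin: "finite ?S" using less.prems(1) by simp
    obtain G' where G': "drawn_loops k l ?S ?p G'"
      using less.hyps[OF _ fin inj2 succ R(7) R(9)] R(6,10) less.prems(6) by auto
    obtain d where d: "d > 0" "label_point k l (\<gamma> x) = label_point k l x * cis (- side k x * d)"
      "\<And>e. 0 < e \<Longrightarrow> e < d \<Longrightarrow> label_point k l x * cis (- side k x * e) \<notin> label_point k l ` S"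
      and side: "side k (\<gamma> x) = side k x"
      using less.prems(3) x(1) unfolding successor_on_def by blast
    show ?thesis
      by (rule add_arch[OF fin G' pairingsD(2)[OF R(7)] R(5) _ _ R(2) R(8) R(3,4) less.prems(2) refl side d]) auto
  next
    case False
    have no_adj: "p (\<gamma> x) \<noteq> x" if "x \<in> S" for x using False that by blast
    have k: "(p \<circ> \<gamma>) permutes S" using g P(1) by (rule permutes_compose)
    have inv: "p (\<gamma> (p (\<gamma> x))) = x" if "x \<in> S" for x
      using no_fixed_point_count(2)[OF less.prems(1) k] no_adj less.prems(6) that by auto
    have rev: "\<gamma> (p (\<gamma> x)) = p x" if "x \<in> S" for x using inv[OF that] P(4) by metis
    have r: "side k (\<gamma> z) = side k z" if "z \<in> S" for z using less.prems(5) that by (simp add: linked_def)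
    \<comment> \<open>A link at \<open>\<gamma> x\<close> is carried back to \<open>x\<close>, so the link in the orbit of \<open>x\<close> reaches \<open>x\<close> itself.\<close>
    have back_step: "side k (p x) \<noteq> side k x" if x: "x \<in> S" and "side k (p (\<gamma> x)) \<noteq> side k (\<gamma> x)" for x
      using that r[OF x] r[of "p (\<gamma> x)"] rev[OF x] P(2) g by (metis permutes_in_image)
    have through: "side k (p x) = - side k x" if x: "x \<in> S" for x
    proof -
      obtain w where w: "w \<in> orbit \<gamma> x" "side k (p w) \<noteq> side k w"
        using less.prems(5) x by (auto simp: linked_def)
      have "w \<in> S \<and> (side k (p w) \<noteq> side k w \<longrightarrow> side k (p x) \<noteq> side k x)"
        using w(1)
      proof induction
        case base
        then show ?case using back_step[OF x] g x by (auto simp: permutes_in_image)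
      next
        case (step y)
        then show ?case using back_step[of y] g by (auto simp: permutes_in_image)
      qed
      then show ?thesis using w(2) side_cases[of k x] side_cases[of k "p x"] by auto
    qed
    show ?thesis by (rule drawn_spokes[OF less.prems(1-4) through rev])
  qed
qed

section \<open>The rotation of the annulus\<close>

definition circle_size :: "nat \<Rightarrow> nat \<Rightarrow> nat \<Rightarrow> nat" where
  "circle_size k l j = (if j \<le> k then k else l)"

definition circle_offset :: "nat \<Rightarrow> nat \<Rightarrow> nat" where
  "circle_offset k j = (if j \<le> k then 0 else k)"

lemma label_point_eq:
  "label_point k l j = (if side k j = 1 then 2 else 1) *
     cis (- side k j * (2 * pi * real (j - circle_offset k j) / real (circle_size k l j)))"
  by (simp add: label_point_def side_def circle_size_def circle_offset_def)

lemma same_side_circle: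
  assumes "side k i = side k j"
  shows "circle_size k l i = circle_size k l j" "circle_offset k i = circle_offset k j"
  using assms by (auto simp: side_def circle_size_def circle_offset_def split: if_splits)

lemma cis_eq_signed:
  assumes "cis (- s * x) = cis (- s * y)" "s = 1 \<or> s = - 1"
  shows "\<exists>m::int. x = y + 2 * pi * of_int m"
proof -
  have "sin x = sin y \<and> cos x = cos y"
    using assms by (auto simp: complex_eq_iff cis.ctr)
  then show ?thesis using sin_cos_eq_iff by blast
qed

text \<open>
The labels of a circle divide it into equal parts, so an equation between rotated labels is a
congruence between their positions.
\<close>

lemma label_coincide:
  assumes "label_point k l j * cis (- side k j * (2 * pi * f / real (circle_size k l j))) = label_point k l i"
    and "circle_size k l j > 0"
  shows "side k i = side k j \<and>
    (\<exists>m::int. real (j - circle_offset k j) + f = real (i - circle_offset k i) + m * real (circle_size k l j))"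
proof -
  have "cmod (label_point k l j) = cmod (label_point k l i)"
    using arg_cong[OF assms(1), of cmod] by (simp add: norm_mult)
  then have side: "side k i = side k j"
    using side_cases[of k i] side_cases[of k j] by (auto simp: norm_label_point split: if_splits)
  note c = same_side_circle(1)[OF side, of l] same_side_circle(2)[OF side]
  let ?q = "real (circle_size k l j)" and ?J = "real (j - circle_offset k j)" and ?I = "real (i - circle_offset k i)"
  have "cis (- side k j * (2 * pi * (?J + f) / ?q)) = cis (- side k j * (2 * pi * ?I / ?q))"
    using assms(1) unfolding label_point_eq[of k l j] label_point_eq[of k l i] side c
    by (simp add: mult.assoc cis_mult ring_distribs add_divide_distrib split: if_splits)
  then obtain m :: int where "2 * pi * (?J + f) / ?q = 2 * pi * ?I / ?q + 2 * pi * m"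
    using cis_eq_signed[OF _ side_cases] by blast
  then have "2 * pi * (?J + f) = 2 * pi * (?I + m * ?q)"
    using assms(2) by (simp add: field_simps)
  then have "?J + f = ?I + m * ?q" by simp
  then show ?thesis using side by blast
qed

lemma label_point_inj:
  "inj_on (label_point k l) {1..k + l}"
proof (rule inj_onI)
  fix i j assume ij: "i \<in> {1..k + l}" "j \<in> {1..k + l}" "label_point k l i = label_point k l j"
  have q: "circle_size k l i > 0" using ij(1) by (auto simp: circle_size_def)
  obtain m :: int where side: "side k j = side k i" and
    m: "real (i - circle_offset k i) = real (j - circle_offset k j) + m * real (circle_size k l i)"
    using label_coincide[of k l i 0 j] ij(3) q by auto
  have I: "i - circle_offset k i \<in> {1..circle_size k l i}" "j - circle_offset k j \<in> {1..circle_size k l i}"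
    using ij(1,2) same_side_circle(1)[OF side, of l] by (auto simp: circle_size_def circle_offset_def)
  have "real_of_int (int (i - circle_offset k i)) =
      real_of_int (int (j - circle_offset k j) + m * int (circle_size k l i))"
    using m by simp
  then have "int (i - circle_offset k i) = int (j - circle_offset k j) + m * int (circle_size k l i)"
    by (simp only: of_int_eq_iff)
  then have "m * int (circle_size k l i) = int (i - circle_offset k i) - int (j - circle_offset k j)" by simp
  moreover have "\<bar>int (i - circle_offset k i) - int (j - circle_offset k j)\<bar> < int (circle_size k l i)"
    using I by auto
  ultimately have "\<bar>m\<bar> * int (circle_size k l i) < 1 * int (circle_size k l i)"
    by (metis abs_mult abs_of_nat mult_1)
  then have "m = 0" using q by (simp add: mult_less_cancel_right)
  then have "i - circle_offset k i = j - circle_offset k j" using m by simp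
  then show "i = j" using side by (auto simp: side_def circle_offset_def split: if_splits)
qed

lemma cycle_of_list_upt:
  assumes "a < b"
  shows "cycle_of_list [a..<b] j = (if a \<le> j \<and> j < b then (if Suc j = b then a else Suc j) else j)"
proof (cases "a \<le> j \<and> j < b")
  case True
  have "map (cycle_of_list [a..<b]) [a..<b] = rotate1 [a..<b]"
    using cyclic_rotation[of "[a..<b]" 1] by simp
  then have "cycle_of_list [a..<b] ([a..<b] ! (j - a)) = rotate1 [a..<b] ! (j - a)"
    using True by (metis diff_less_mono length_upt nth_map)
  also have "\<dots> = [a..<b] ! (Suc (j - a) mod (b - a))"
    using True by (subst nth_rotate1) auto
  finally show ?thesis
    using True assms by (cases "Suc j = b") (auto simp: Suc_diff_le simp del: upt_Suc)
next
  case False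
  then show ?thesis by (subst id_outside_supp) auto
qed

lemma annular_rotation_eq:
  assumes "k \<ge> 1" "l \<ge> 1"
  shows "annular_rotation k l j =
    (if j = k then 1 else if j = k + l then k + 1 else if 1 \<le> j \<and> j < k + l then j + 1 else j)"
  using assms by (auto simp: annular_rotation_def cycle_of_list_upt simp del: upt_Suc)

lemma annular_rotation_permutes: "annular_rotation k l permutes {1..k + l}"
proof -
  have "cycle_of_list [1..<k + 1] permutes {1..k + l}" "cycle_of_list [k + 1..<k + l + 1] permutes {1..k + l}"
    by (rule permutes_subset[OF cycle_permutes]; auto)+
  then show ?thesis unfolding annular_rotation_def by (intro permutes_compose)
qed

lemma annular_rotation_successor:
  assumes "k \<ge> 1" "l \<ge> 1"
  shows "successor_on k l {1..k + l} (annular_rotation k l)"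
  unfolding successor_on_def
proof (intro conjI ballI annular_rotation_permutes)
  fix j assume j: "j \<in> {1..k + l}"
  let ?\<gamma> = "annular_rotation k l"
  show side: "side k (?\<gamma> j) = side k j"
    using j assms by (auto simp: annular_rotation_eq side_def)
  let ?q = "circle_size k l j"
  define d where "d = 2 * pi * 1 / real ?q"
  have q: "?q > 0" using assms by (simp add: circle_size_def)
  define c :: real where "c = (if j = k \<or> j = k + l then 1 else 0)"
  have c: "c = 0 \<or> c = 1" by (simp add: c_def)
  have shift: "real (?\<gamma> j - circle_offset k j) = real (j - circle_offset k j) + 1 - c * real ?q"
    using j assms by (auto simp: annular_rotation_eq circle_offset_def circle_size_def c_def of_nat_diff)
  have "2 * pi * real (?\<gamma> j - circle_offset k j) / real ?q =
      2 * pi * real (j - circle_offset k j) / real ?q + d - c * (2 * pi)"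
    unfolding shift using q by (simp add: d_def field_simps)
  moreover have "cis (- side k j * (x + d - c * (2 * pi))) = cis (- side k j * x) * cis (- side k j * d)" for x
    using side_cases[of k j] c
    by (auto simp: cis_mult complex_eq_iff cis.ctr cos_diff sin_diff cos_add sin_add algebra_simps)
  ultimately have step: "label_point k l (?\<gamma> j) = label_point k l j * cis (- side k j * d)"
    unfolding label_point_eq[of k l "?\<gamma> j"] label_point_eq[of k l j] side same_side_circle(1)[OF side] same_side_circle(2)[OF side]
    by (simp add: mult.assoc)
  have "label_point k l j * cis (- side k j * e) \<notin> label_point k l ` {1..k + l}" if e: "0 < e" "e < d" for e
  proof
    assume "label_point k l j * cis (- side k j * e) \<in> label_point k l ` {1..k + l}"
    then obtain i where i: "label_point k l j * cis (- side k j * e) = label_point k l i" by auto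
    define f where "f = e * real ?q / (2 * pi)"
    have "e = 2 * pi * f / real ?q" using q by (simp add: f_def)
    then obtain m :: int where
      "real (j - circle_offset k j) + f = real (i - circle_offset k i) + m * real ?q"
      using label_coincide[of k l j f i] i q by auto
    then have "f = of_int (int (i - circle_offset k i) - int (j - circle_offset k j) + m * int ?q)" by simp
    moreover have "0 < f" "f < 1" using e q by (auto simp: f_def d_def field_simps)
    ultimately show False by (metis int_one_le_iff_zero_less not_less of_int_0_less_iff of_int_1_le_iff)
  qed
  moreover have "d > 0" using q by (simp add: d_def)
  ultimately show "\<exists>d>0. label_point k l (?\<gamma> j) = label_point k l j * cis (- side k j * d) \<and>
       (\<forall>e. 0 < e \<and> e < d \<longrightarrow> label_point k l j * cis (- side k j * e) \<notin> label_point k l ` {1..k + l})"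
    using step by blast
qed

lemma annular_rotation_orbit:
  assumes "k \<ge> 1" "l \<ge> 1" "i \<in> {1..k + l}" "j \<in> {1..k + l}" "side k i = side k j"
  shows "j \<in> orbit (annular_rotation k l) i"
proof -
  let ?\<gamma> = "annular_rotation k l"
  define b where "b = circle_offset k i + 1"
  have self: "x \<in> orbit ?\<gamma> x" for x by (rule orbit_self[OF _ annular_rotation_permutes]) simp
  have up: "b + m \<in> orbit ?\<gamma> b" if "m < circle_size k l i" for m
    using that
  proof (induction m)
    case 0
    then show ?case using self by simp
  next
    case (Suc m)
    then have "?\<gamma> (b + m) = b + Suc m"
      using assms(1-3) by (auto simp: annular_rotation_eq b_def circle_offset_def circle_size_def split: if_splits)
    moreover have "?\<gamma> (b + m) \<in> orbit ?\<gamma> b" using Suc by (intro orbit.step) auto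
    ultimately show ?case by simp
  qed
  have in_orb: "x \<in> orbit ?\<gamma> b" if "x \<in> {1..k + l}" "side k x = side k i" for x
  proof -
    have "x = b + (x - b)" "x - b < circle_size k l i"
      using that assms(3) by (auto simp: b_def circle_offset_def circle_size_def side_def split: if_splits)
    then show ?thesis using up by metis
  qed
  have "orbit ?\<gamma> i = orbit ?\<gamma> b"
    by (rule orbit_eq_if_mem[OF _ annular_rotation_permutes in_orb]) (use assms in auto)
  then show ?thesis using in_orb[of j] assms by simp
qed

text \<open>
Each circle is one orbit of the rotation, so a single link is met from every label.
\<close>

lemma connected_pairing_linked:
  assumes "k \<ge> 1" "l \<ge> 1" and p: "p \<in> pairings {1..k + l}"
    and x: "x \<in> {1..k + l}" "side k (p x) \<noteq> side k x"
  shows "linked {1..k + l} (annular_rotation k l) p (side k)"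
  unfolding linked_def
proof (intro conjI ballI)
  fix z assume z: "z \<in> {1..k + l}"
  show "side k (annular_rotation k l z) = side k z"
    using annular_rotation_successor[OF assms(1,2)] z by (simp add: successor_on_def)
  have "side k z = side k x \<or> side k z = side k (p x)"
    using x side_cases[of k z] side_cases[of k x] side_cases[of k "p x"] by auto
  then show "\<exists>w\<in>orbit (annular_rotation k l) z. side k (p w) \<noteq> side k w"
  proof
    assume "side k z = side k x"
    then show ?thesis using annular_rotation_orbit[OF assms(1,2) z x(1)] x(2) by blast
  next
    assume "side k z = side k (p x)"
    then show ?thesis
      using annular_rotation_orbit[OF assms(1,2) z pairingsD(2)[OF p x(1)]] x(2) pairingsD(4)[OF p, of x]
      by (intro bexI[of _ "p x"]) auto
  qed
qed

section \<open>Annular non-crossing pairings by counting cycles\<close>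

text \<open>
Reversing a loop changes the sign of its winding numbers, but keeps the points at the parameters \<open>0\<close>
and \<open>1/2\<close>. The inside is simply connected, hence homeomorphic to a disk by the Riemann mapping theorem.
\<close>

lemma draws_pair_imp_draws_cycle:
  assumes g: "draws_pair k l a b g" and ab: "p a = b"
  obtains g' where "draws_cycle k l p {a, b} g'" "path_image g' = path_image g"
proof -
  have sg: "simple_path g" and closed: "pathfinish g = pathstart g"
    and sub: "path_image g \<subseteq> annulus" and ins: "inside (path_image g) \<subseteq> annulus"
    and g0: "g 0 = label_point k l a" and g1: "g (1/2) = label_point k l b"
    using g by (auto simp: draws_pair_def)
  have "x = y \<or> x = 0 \<and> y = 1 \<or> x = 1 \<and> y = 0" if "x \<in> {0..1}" "y \<in> {0..1}" "g x = g y" for x y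
    using sg that unfolding simple_path_def loop_free_def by blast
  from this[of 0 "1/2"] have ne: "g 0 \<noteq> g (1/2)" by auto
  have "a \<noteq> b" using ne g0 g1 by auto
  have disk: "inside (path_image g) homeomorphic ball (0::complex) 1"
  proof -
    have "inside (path_image g) \<noteq> {}" "open (inside (path_image g))"
      using Jordan_inside_outside[OF sg closed] by auto
    then show ?thesis
      using simply_connected_eq_homeomorphic_to_disc simply_connected_inside_simple_path[OF sg] by blast
  qed
  have visits: "\<exists>t. strict_mono_on {..<card {a, b}} t \<and> t ` {..<card {a, b}} \<subseteq> {0..<1} \<and>
        (\<forall>i<card {a, b}. h (t i) = label_point k l ((p ^^ i) a))"
    if "h 0 = label_point k l a" "h (1/2) = label_point k l b" for h :: "real \<Rightarrow> complex"
  proof (intro exI[of _ "\<lambda>i. real i / 2"] conjI allI impI)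
    have c: "card {a, b} = 2" using \<open>a \<noteq> b\<close> by simp
    show "strict_mono_on {..<card {a, b}} (\<lambda>i. real i / 2)" by (auto simp: strict_mono_on_def)
    show "(\<lambda>i. real i / 2) ` {..<card {a, b}} \<subseteq> {0..<1}" unfolding c by auto
    fix i assume "i < card {a, b}"
    then have "i = 0 \<or> i = 1" unfolding c by auto
    then show "h (real i / 2) = label_point k l ((p ^^ i) a)" using that ab by auto
  qed
  have "\<exists>g'. (\<forall>z\<in>inside (path_image g'). winding_number g' z = - 1) \<and> simple_path g' \<and>
     pathfinish g' = pathstart g' \<and> path_image g' = path_image g \<and> g' 0 = g 0 \<and> g' (1/2) = g (1/2)"
  proof (rule simple_closed_path_winding_number_inside[OF sg])
    assume w: "\<And>z. z \<in> inside (path_image g) \<Longrightarrow> winding_number g z = 1"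
    have "winding_number (reversepath g) z = - 1" if "z \<in> inside (path_image g)" for z
    proof -
      have "z \<notin> path_image g" using that inside_no_overlap by blast
      then show ?thesis using w[OF that] winding_number_reversepath[OF simple_path_imp_path[OF sg]] by simp
    qed
    then show ?thesis
      using sg closed by (intro exI[of _ "reversepath g"])
        (auto simp: simple_path_reversepath, auto simp: reversepath_def pathstart_def pathfinish_def)
  next
    assume "\<And>z. z \<in> inside (path_image g) \<Longrightarrow> winding_number g z = - 1"
    then show ?thesis using sg closed by blast
  qed
  then obtain g' where g': "\<forall>z\<in>inside (path_image g'). winding_number g' z = - 1" "simple_path g'"
    "pathfinish g' = pathstart g'" "path_image g' = path_image g" "g' 0 = g 0" "g' (1/2) = g (1/2)"
    by blast
  have "\<exists>c\<in>{a, b}. \<exists>t. strict_mono_on {..<card {a, b}} t \<and> t ` {..<card {a, b}} \<subseteq> {0..<1} \<and>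
        (\<forall>i<card {a, b}. g' (t i) = label_point k l ((p ^^ i) c))"
    using visits[of g'] g'(5,6) g0 g1 by (intro bexI[of _ a]) simp_all
  then have "draws_cycle k l p {a, b} g'"
    unfolding draws_cycle_def using g'(1-4) sub ins disk by simp
  then show thesis using g'(4) by (rule that)
qed

lemma orbit_of_pairing:
  assumes "p \<in> pairings S"
  shows "orbit p j = {j, p j}"
proof
  note P = pairingsD[OF assms]
  show "orbit p j \<subseteq> {j, p j}"
  proof
    fix y assume "y \<in> orbit p j"
    then show "y \<in> {j, p j}" by induction (use P(4) in auto)
  qed
  have "p (p j) \<in> orbit p j" by (intro orbit.intros)
  then show "{j, p j} \<subseteq> orbit p j" using P(4)[of j] by (auto intro: orbit.base)
qed

text \<open>
The two labels cut the loop of a two-cycle into two arcs, and either of them will do.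
\<close>

lemma annular_NCP2_imp_drawn_arcs:
  assumes "p \<in> annular_NCP2 k l"
  shows "p \<in> pairings {1..k + l}" "\<exists>x\<in>{1..k + l}. side k (p x) \<noteq> side k x"
    "\<exists>Q. drawn_arcs k l {1..k + l} p Q"
proof -
  let ?S = "{1..k + l}"
  have perm: "p permutes ?S" and two: "\<And>C. C \<in> cycle_sets ?S p \<Longrightarrow> card C = 2"
    using assms by (auto simp: annular_NCP2_def annular_NCP_def)
  obtain g where g: "\<And>C. C \<in> cycle_sets ?S p \<Longrightarrow> draws_cycle k l p C (g C)"
    and disj: "disjoint_family_on (\<lambda>C. path_image (g C)) (cycle_sets ?S p)"
    and ex: "\<exists>C\<in>cycle_sets ?S p. C \<inter> {1..k} \<noteq> {} \<and> C \<inter> {k + 1..k + l} \<noteq> {}"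
    using assms by (auto simp: annular_NCP2_def annular_NCP_def)
  have "p x \<noteq> x \<and> p (p x) = x" if "x \<in> ?S" for x
    using two[of "orbit p x"] card_orbit_eq_2_iff[OF _ perm that] that by (auto simp: cycle_sets_def)
  then show p: "p \<in> pairings ?S" using perm by (auto simp: pairings_def)
  note P = pairingsD[OF p] and orb = orbit_of_pairing[OF p]
  from ex obtain x where x: "x \<in> ?S" "orbit p x \<inter> {1..k} \<noteq> {}" "orbit p x \<inter> {k + 1..k + l} \<noteq> {}"
    unfolding cycle_sets_def by blast
  then have "side k (p x) \<noteq> side k x" unfolding orb by (auto simp: side_def split: if_splits)
  then show "\<exists>x\<in>?S. side k (p x) \<noteq> side k x" using x(1) by blast
  have C: "{j, p j} \<in> cycle_sets ?S p" if "j \<in> ?S" for j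
    using that orb[of j] by (auto simp: cycle_sets_def)
  define Q where "Q j = path_image (g {j, p j})" for j
  have "drawn_arcs k l ?S p Q"
    unfolding drawn_arcs_def
  proof (intro conjI ballI impI)
    fix j assume j: "j \<in> ?S"
    note dc = g[OF C[OF j]]
    then show "Q j \<subseteq> annulus" by (simp add: draws_cycle_def Q_def)
    have sg: "simple_path (g {j, p j})" using dc by (simp add: draws_cycle_def)
    have c2: "card {j, p j} = 2" using P(3)[OF j] by simp
    obtain a t where a: "a \<in> {j, p j}" and t: "strict_mono_on {..<2} t" "t ` {..<2} \<subseteq> {0..<1}"
       and gt: "\<And>i. i < 2 \<Longrightarrow> g {j, p j} (t i) = label_point k l ((p ^^ i) a)"
      using dc unfolding draws_cycle_def c2 by auto
    have "t 0 \<in> {0..<1}" "t (Suc 0) \<in> {0..<1}" using t(2) by (auto simp: image_subset_iff)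
    then have t01: "t 0 \<in> {0..1}" "t (Suc 0) \<in> {0..1}" by auto
    have ends: "g {j, p j} (t 0) = label_point k l a" "g {j, p j} (t (Suc 0)) = label_point k l (p a)"
      using gt[of 0] gt[of 1] by auto
    have "{a, p a} = {j, p j}" using a P(4)[of j] by auto
    have "label_point k l a \<noteq> label_point k l (p a)"
    proof
      assume "label_point k l a = label_point k l (p a)"
      moreover have "a \<in> ?S" "p a \<in> ?S" using a j P(2)[OF j] P(4)[of j] by auto
      ultimately have "a = p a" using label_point_inj[of k l] by (auto dest: inj_onD)
      then show False using P(3)[of a] \<open>a \<in> ?S\<close> by simp
    qed
    then have arcs: "arc (subpath (t 0) (t (Suc 0)) (g {j, p j}))" "arc (subpath (t (Suc 0)) (t 0) (g {j, p j}))"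
      using sg t01 ends by (auto intro!: arc_simple_path_subpath)
    have subs: "path_image (subpath (t 0) (t (Suc 0)) (g {j, p j})) \<subseteq> Q j"
      "path_image (subpath (t (Suc 0)) (t 0) (g {j, p j})) \<subseteq> Q j"
      unfolding Q_def using t01 by (auto dest!: path_image_subpath_subset[THEN subsetD, rotated 2])
    show "\<exists>q. arc q \<and> path_image q \<subseteq> Q j \<and> pathstart q = label_point k l j \<and> pathfinish q = label_point k l (p j)"
    proof (cases "a = j")
      case True
      then show ?thesis
        using arcs subs ends by (intro exI[of _ "subpath (t 0) (t (Suc 0)) (g {j, p j})"]) auto
    next
      case False
      then have "a = p j" using a by simp
      then show ?thesis
        using arcs subs ends P(4)[of j] by (intro exI[of _ "subpath (t (Suc 0)) (t 0) (g {j, p j})"]) auto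
    qed
  next
    fix j assume "j \<in> ?S"
    then show "Q (p j) = Q j" using P(4)[of j] by (simp add: Q_def insert_commute)
  next
    fix i j assume ij: "i \<in> ?S" "j \<in> ?S" "j \<noteq> i \<and> j \<noteq> p i"
    then have "{i, p i} \<noteq> {j, p j}" by auto
    then show "Q i \<inter> Q j = {}"
      unfolding Q_def using disj C[OF ij(1)] C[OF ij(2)] by (auto simp: disjoint_family_on_def)
  qed
  then show "\<exists>Q. drawn_arcs k l ?S p Q" by blast
qed

lemma drawn_loops_imp_annular_NCP2:
  assumes p: "p \<in> pairings {1..k + l}" and x: "x \<in> {1..k + l}" "side k (p x) \<noteq> side k x"
    and drawn: "drawn_loops k l {1..k + l} p G"
  shows "p \<in> annular_NCP2 k l"
proof -
  let ?S = "{1..k + l}"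
  note P = pairingsD[OF p] and orb = orbit_of_pairing[OF p]
  have cyc: "cycle_sets ?S p = (\<lambda>j. {j, p j}) ` ?S" by (simp add: cycle_sets_def orb)
  have loop: "\<exists>g. draws_cycle k l p {j, p j} g \<and> path_image g = G j" if j: "j \<in> ?S" for j
  proof -
    obtain g where g: "draws_pair k l j (p j) g \<or> draws_pair k l (p j) j g" "path_image g = G j"
      using drawn j unfolding drawn_loops_def by blast
    from g(1) show ?thesis
    proof
      assume "draws_pair k l j (p j) g"
      from draws_pair_imp_draws_cycle[OF this, of p] show ?thesis using g(2) by metis
    next
      assume "draws_pair k l (p j) j g"
      from draws_pair_imp_draws_cycle[OF this, where p = p, OF P(4)[of j]] show ?thesis using g(2) by (metis insert_commute)
    qed
  qed
  have "\<forall>C\<in>cycle_sets ?S p. \<exists>g. draws_cycle k l p C g \<and> (\<exists>j\<in>?S. C = {j, p j} \<and> path_image g = G j)"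
    unfolding cyc using loop by blast
  then obtain g where g: "\<And>C. C \<in> cycle_sets ?S p \<Longrightarrow> draws_cycle k l p C (g C)"
    and gj: "\<And>C. C \<in> cycle_sets ?S p \<Longrightarrow> \<exists>j\<in>?S. C = {j, p j} \<and> path_image (g C) = G j"
    by metis
  have "disjoint_family_on (\<lambda>C. path_image (g C)) (cycle_sets ?S p)"
    unfolding disjoint_family_on_def
  proof (intro ballI impI)
    fix C D assume CD: "C \<in> cycle_sets ?S p" "D \<in> cycle_sets ?S p" "C \<noteq> D"
    obtain i where i: "i \<in> ?S" "C = {i, p i}" "path_image (g C) = G i" using gj[OF CD(1)] by blast
    obtain j where j: "j \<in> ?S" "D = {j, p j}" "path_image (g D) = G j" using gj[OF CD(2)] by blast
    have "j \<noteq> i" "j \<noteq> p i" using CD(3) i(2) j(2) P(4)[of i] by (auto simp: insert_commute)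
    then show "path_image (g C) \<inter> path_image (g D) = {}"
      using drawn i j unfolding drawn_loops_def by auto
  qed
  moreover have "\<exists>C\<in>cycle_sets ?S p. C \<inter> {1..k} \<noteq> {} \<and> C \<inter> {k + 1..k + l} \<noteq> {}"
  proof (rule bexI[of _ "{x, p x}"])
    show "{x, p x} \<in> cycle_sets ?S p" unfolding cyc using x by blast
    show "{x, p x} \<inter> {1..k} \<noteq> {} \<and> {x, p x} \<inter> {k + 1..k + l} \<noteq> {}"
      using x P(2)[OF x(1)] by (auto simp: side_def split: if_splits)
  qed
  moreover have "card C = 2" if C: "C \<in> cycle_sets ?S p" for C
  proof -
    obtain j where "j \<in> ?S" "C = {j, p j}" using gj[OF C] by blast
    then show ?thesis using P(3)[of j] by auto
  qed
  ultimately show ?thesis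
    using P(1) g unfolding annular_NCP2_def annular_NCP_def by blast
qed

text \<open>
This replaces drawings by a count, which is Euler's formula in disguise: the count says that \<open>p\<close> has
genus zero in the annulus.
\<close>

theorem annular_NCP2_eq:
  assumes "k \<ge> 1" "l \<ge> 1"
  shows "annular_NCP2 k l = {p \<in> pairings {1..k + l}. (\<exists>x\<in>{1..k + l}. side k (p x) \<noteq> side k x) \<and>
     2 * card (cycle_sets {1..k + l} (p \<circ> annular_rotation k l)) = k + l}"
proof (intro equalityI subsetI)
  note succ = annular_rotation_successor[OF assms]
  fix p assume "p \<in> annular_NCP2 k l"
  note A = annular_NCP2_imp_drawn_arcs[OF this]
  then obtain x Q where x: "x \<in> {1..k + l}" "side k (p x) \<noteq> side k x" and Q: "drawn_arcs k l {1..k + l} p Q"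
    by blast
  have "2 * card (cycle_sets {1..k + l} (p \<circ> annular_rotation k l)) = card {1..k + l}"
    by (rule drawn_arcs_imp_cycle_count[OF _ label_point_inj succ A(1) connected_pairing_linked[OF assms A(1) x] Q]) simp
  then show "p \<in> {p \<in> pairings {1..k + l}. (\<exists>x\<in>{1..k + l}. side k (p x) \<noteq> side k x) \<and>
     2 * card (cycle_sets {1..k + l} (p \<circ> annular_rotation k l)) = k + l}" using A by simp
next
  note succ = annular_rotation_successor[OF assms]
  fix p assume "p \<in> {p \<in> pairings {1..k + l}. (\<exists>x\<in>{1..k + l}. side k (p x) \<noteq> side k x) \<and>
     2 * card (cycle_sets {1..k + l} (p \<circ> annular_rotation k l)) = k + l}"
  then obtain x where p: "p \<in> pairings {1..k + l}" and x: "x \<in> {1..k + l}" "side k (p x) \<noteq> side k x"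
    and c: "2 * card (cycle_sets {1..k + l} (p \<circ> annular_rotation k l)) = card {1..k + l}"
    by auto
  obtain G where "drawn_loops k l {1..k + l} p G"
    using cycle_count_imp_drawn_loops[OF _ label_point_inj succ p connected_pairing_linked[OF assms p x] c] by blast
  then show "p \<in> annular_NCP2 k l" by (rule drawn_loops_imp_annular_NCP2[OF p x])
qed

section \<open>Gaussian integration by parts\<close>

definition gauss_moment :: "real \<Rightarrow> nat \<Rightarrow> real" where
  "gauss_moment \<sigma> n = (\<integral>x. normal_density 0 \<sigma> x * x ^ n \<partial>lborel)"

text \<open>
Gaussian integration by parts for monomials, read off from the explicit moments.
\<close>

lemma gauss_moment_Suc:
  assumes "\<sigma> > 0"
  shows "gauss_moment \<sigma> (Suc n) = real n * \<sigma>\<^sup>2 * gauss_moment \<sigma> (n - 1)"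
proof -
  have ev: "gauss_moment \<sigma> (2 * k) = fact (2 * k) / ((2 / \<sigma>\<^sup>2) ^ k * fact k)" for k
    using integral_normal_moment_even[OF assms, of 0 k] by (simp add: gauss_moment_def)
  have od: "gauss_moment \<sigma> (2 * k + 1) = 0" for k
    using integral_normal_moment_odd[OF assms, of 0 k] by (simp add: gauss_moment_def)
  show ?thesis
  proof (cases "even n")
    case True
    then obtain k where k: "n = 2 * k" by (elim evenE)
    show ?thesis
    proof (cases k)
      case 0
      then show ?thesis using od[of 0] k by simp
    next
      case (Suc i)
      then have "n - 1 = 2 * i + 1" "Suc n = 2 * k + 1" using k by auto
      then show ?thesis using od by simp
    qed
  next
    case False
    then obtain k where k: "n = 2 * k + 1" by (elim oddE)
    have "gauss_moment \<sigma> (Suc n) = fact (2 * (k + 1)) / ((2 / \<sigma>\<^sup>2) ^ (k + 1) * fact (k + 1))"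
      using ev[of "k + 1"] k by simp
    also have "\<dots> = 2 * real (k + 1) * real n * fact (2 * k) / (2 / \<sigma>\<^sup>2 * real (k + 1) * ((2 / \<sigma>\<^sup>2) ^ k * fact k))"
    proof -
      have "fact (2 * (k + 1)) = 2 * real (k + 1) * real n * fact (2 * k)"
        by (simp add: k algebra_simps)
      moreover have "(2 / \<sigma>\<^sup>2) ^ (k + 1) * fact (k + 1) = 2 / \<sigma>\<^sup>2 * real (k + 1) * ((2 / \<sigma>\<^sup>2) ^ k * fact k)"
        by (simp only: power_add power_one_right fact_Suc Suc_eq_plus1[symmetric] of_nat_Suc power_Suc) (simp add: mult_ac)
      ultimately show ?thesis by metis
    qed
    also have "\<dots> = real n * \<sigma>\<^sup>2 * (fact (2 * k) / ((2 / \<sigma>\<^sup>2) ^ k * fact k))"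
    proof -
      have "2 * K * a * F / (2 / \<sigma>\<^sup>2 * K * D) = a * \<sigma>\<^sup>2 * (F / D)" if "K > 0" "D > 0" for K a F D :: real
        using that assms by (simp add: field_simps)
      from this[of "real (k + 1)" "(2 / \<sigma>\<^sup>2) ^ k * fact k"] show ?thesis using assms by simp
    qed
    finally show ?thesis using ev[of k] k by simp
  qed
qed

lemma sum_PiE_split:
  assumes "m \<in> S"
  shows "(\<Sum>f\<in>PiE S (\<lambda>_. E). F f) = (\<Sum>e\<in>E. \<Sum>g\<in>PiE (S - {m}) (\<lambda>_. E). F (g(m := e)))"
proof -
  have S: "insert m (S - {m}) = S" using assms by auto
  have "PiE S (\<lambda>_. E) = (\<lambda>(e, g). g(m := e)) ` (E \<times> PiE (S - {m}) (\<lambda>_. E))"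
    using PiE_insert_eq[of m "S - {m}" "\<lambda>_. E"] S by simp
  moreover have "inj_on (\<lambda>(e, g). g(m := e)) (E \<times> PiE (S - {m}) (\<lambda>_. E))"
    by (rule inj_combinator) simp
  ultimately have "(\<Sum>f\<in>PiE S (\<lambda>_. E). F f) = (\<Sum>(e, g)\<in>E \<times> PiE (S - {m}) (\<lambda>_. E). F (g(m := e)))"
    by (simp add: sum.reindex case_prod_unfold)
  then show ?thesis by (simp add: sum.cartesian_product)
qed

locale gaussian_family = prob_space M for M :: "'w measure" +
  fixes E :: "'e set" and X :: "'e \<Rightarrow> 'w \<Rightarrow> real" and \<sigma> :: "'e \<Rightarrow> real"
  assumes finE: "finite E" and indep: "indep_vars (\<lambda>_. borel) X E"
    and normal: "\<And>e. e \<in> E \<Longrightarrow> distributed M lborel (X e) (normal_density 0 (\<sigma> e))"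
    and \<sigma>_pos: "\<And>e. e \<in> E \<Longrightarrow> \<sigma> e > 0"
begin

lemma X_power:
  assumes "e \<in> E"
  shows "integrable M (\<lambda>\<omega>. X e \<omega> ^ n)" "expectation (\<lambda>\<omega>. X e \<omega> ^ n) = gauss_moment (\<sigma> e) n"
proof -
  have "integrable lborel (\<lambda>x. normal_density 0 (\<sigma> e) x * x ^ n)"
    using integrable_normal_moment[OF \<sigma>_pos[OF assms], of 0 n] by simp
  then show "integrable M (\<lambda>\<omega>. X e \<omega> ^ n)"
    by (subst distributed_integrable[OF normal[OF assms], symmetric]) auto
  show "expectation (\<lambda>\<omega>. X e \<omega> ^ n) = gauss_moment (\<sigma> e) n"
    unfolding gauss_moment_def
    by (subst distributed_integral[OF normal[OF assms], symmetric]) auto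
qed

lemma monomial:
  shows "integrable M (\<lambda>\<omega>. \<Prod>e\<in>E. X e \<omega> ^ n e)"
    and "expectation (\<lambda>\<omega>. \<Prod>e\<in>E. X e \<omega> ^ n e) = (\<Prod>e\<in>E. gauss_moment (\<sigma> e) (n e))"
proof -
  have ind: "indep_vars (\<lambda>_. borel) (\<lambda>e \<omega>. X e \<omega> ^ n e) E"
    using indep by (rule indep_vars_compose2[where Y = "\<lambda>e x. x ^ n e"]) auto
  show "integrable M (\<lambda>\<omega>. \<Prod>e\<in>E. X e \<omega> ^ n e)"
    by (rule indep_vars_integrable[OF finE ind X_power(1)])
  show "expectation (\<lambda>\<omega>. \<Prod>e\<in>E. X e \<omega> ^ n e) = (\<Prod>e\<in>E. gauss_moment (\<sigma> e) (n e))"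
    by (subst indep_vars_lebesgue_integral[OF finE ind X_power(1)]) (auto intro!: prod.cong simp: X_power(2))
qed

lemma product_as_monomial:
  assumes "finite S" "f ` S \<subseteq> E"
  shows "(\<Prod>m\<in>S. X (f m) \<omega>) = (\<Prod>e\<in>E. X e \<omega> ^ card {m \<in> S. f m = e})"
proof -
  have "(\<Prod>m\<in>S. X (f m) \<omega>) = (\<Prod>e\<in>E. \<Prod>m\<in>{m \<in> S. f m = e}. X (f m) \<omega>)"
    using prod.group[OF assms(1) finE assms(2), of "\<lambda>m. X (f m) \<omega>"] by simp
  also have "\<dots> = (\<Prod>e\<in>E. X e \<omega> ^ card {m \<in> S. f m = e})"
    by (intro prod.cong refl) simp
  finally show ?thesis .
qed

lemma product_integrable:
  assumes "finite S" "f ` S \<subseteq> E"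
  shows "integrable M (\<lambda>\<omega>. \<Prod>m\<in>S. X (f m) \<omega>)"
  unfolding product_as_monomial[OF assms] by (rule monomial)

lemma extra_factor:
  assumes "finite S" "f ` S \<subseteq> E" "e \<in> E"
  shows "X e \<omega> * (\<Prod>m\<in>S. X (f m) \<omega>) = (\<Prod>d\<in>E. X d \<omega> ^ (card {m \<in> S. f m = d} + (if d = e then 1 else 0)))"
proof -
  have "(\<Prod>d\<in>E. X d \<omega> ^ (if d = e then 1 else 0)) = X e \<omega>"
    using assms(3) finE by (simp add: if_distrib prod.delta cong: if_cong)
  then show ?thesis
    unfolding product_as_monomial[OF assms(1,2)] power_add prod.distrib by (simp add: mult.commute)
qed

text \<open>
By independence this is the one-variable recursion for \<open>X e\<close>. The factor \<open>X e\<close> occurs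
\<open>card {m \<in> S. f m = e}\<close> times in the product, and the sum on the right chooses the occurrence that is
removed.
\<close>

lemma stein_product:
  assumes S: "finite S" "f ` S \<subseteq> E" and e: "e \<in> E"
  shows "expectation (\<lambda>\<omega>. X e \<omega> * (\<Prod>m\<in>S. X (f m) \<omega>)) =
    (\<Sum>m\<in>S. (if f m = e then (\<sigma> e)\<^sup>2 else 0) * expectation (\<lambda>\<omega>. \<Prod>m'\<in>S - {m}. X (f m') \<omega>))"
proof -
  define c where "c d = card {m \<in> S. f m = d}" for d
  let ?R = "\<Prod>d\<in>E - {e}. gauss_moment (\<sigma> d) (c d)"
  have "expectation (\<lambda>\<omega>. X e \<omega> * (\<Prod>m\<in>S. X (f m) \<omega>)) = (\<Prod>d\<in>E. gauss_moment (\<sigma> d) (c d + (if d = e then 1 else 0)))"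
    unfolding extra_factor[OF assms] by (simp add: monomial c_def)
  also have "\<dots> = gauss_moment (\<sigma> e) (Suc (c e)) * ?R"
    using e finE by (subst prod.remove[OF finE e]) (auto intro!: prod.cong)
  also have "\<dots> = real (c e) * ((\<sigma> e)\<^sup>2 * (gauss_moment (\<sigma> e) (c e - 1) * ?R))"
    by (simp add: gauss_moment_Suc[OF \<sigma>_pos[OF e]])
  also have "\<dots> = (\<Sum>m\<in>{m \<in> S. f m = e}. (\<sigma> e)\<^sup>2 * (gauss_moment (\<sigma> e) (c e - 1) * ?R))"
    by (simp add: c_def)
  also have "\<dots> = (\<Sum>m\<in>{m \<in> S. f m = e}. (\<sigma> e)\<^sup>2 * expectation (\<lambda>\<omega>. \<Prod>m'\<in>S - {m}. X (f m') \<omega>))"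
  proof (intro sum.cong refl)
    fix m assume m: "m \<in> {m \<in> S. f m = e}"
    have cm: "card {m' \<in> S - {m}. f m' = d} = c d - (if d = e then 1 else 0)" for d
    proof (cases "d = e")
      case True
      have "{m' \<in> S - {m}. f m' = d} = {m' \<in> S. f m' = d} - {m}" by auto
      then show ?thesis using m True S(1) by (simp add: c_def)
    next
      case False
      then have "{m' \<in> S - {m}. f m' = d} = {m' \<in> S. f m' = d}" using m by auto
      then show ?thesis using False by (simp add: c_def)
    qed
    have S': "finite (S - {m})" "f ` (S - {m}) \<subseteq> E" using S by auto
    have "expectation (\<lambda>\<omega>. \<Prod>m'\<in>S - {m}. X (f m') \<omega>) = (\<Prod>d\<in>E. gauss_moment (\<sigma> d) (c d - (if d = e then 1 else 0)))"
      unfolding product_as_monomial[OF S'] by (simp only: monomial(2) cm)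
    also have "\<dots> = gauss_moment (\<sigma> e) (c e - 1) * ?R"
      using e finE by (subst prod.remove[OF finE e]) (auto intro!: prod.cong)
    finally show "(\<sigma> e)\<^sup>2 * (gauss_moment (\<sigma> e) (c e - 1) * ?R) =
        (\<sigma> e)\<^sup>2 * expectation (\<lambda>\<omega>. \<Prod>m'\<in>S - {m}. X (f m') \<omega>)" by simp
  qed
  also have "\<dots> = (\<Sum>m\<in>S. (if f m = e then (\<sigma> e)\<^sup>2 else 0) * expectation (\<lambda>\<omega>. \<Prod>m'\<in>S - {m}. X (f m') \<omega>))"
    by (rule sum.mono_neutral_cong_left) (use S in auto)
  finally show ?thesis .
qed

definition form :: "('e \<Rightarrow> complex) \<Rightarrow> 'w \<Rightarrow> complex" where
  "form c \<omega> = (\<Sum>e\<in>E. c e * complex_of_real (X e \<omega>))"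

lemma prod_form:
  assumes "finite S"
  shows "(\<Prod>m\<in>S. form (c m) \<omega>) =
    (\<Sum>f\<in>PiE S (\<lambda>_. E). (\<Prod>m\<in>S. c m (f m)) * complex_of_real (\<Prod>m\<in>S. X (f m) \<omega>))"
  unfolding form_def using assms finE
  by (subst prod_sum_PiE) (auto simp: prod.distrib)

lemma prod_form_integrable:
  assumes "finite S"
  shows "integrable M (\<lambda>\<omega>. \<Prod>m\<in>S. form (c m) \<omega>)"
  unfolding prod_form[OF assms]
  by (intro Bochner_Integration.integrable_sum integrable_mult_right integrable_of_real product_integrable assms) auto

lemma expectation_prod_form:
  assumes "finite S"
  shows "integral\<^sup>L M (\<lambda>\<omega>. \<Prod>m\<in>S. form (c m) \<omega>) =
    (\<Sum>f\<in>PiE S (\<lambda>_. E). (\<Prod>m\<in>S. c m (f m)) * complex_of_real (expectation (\<lambda>\<omega>. \<Prod>m\<in>S. X (f m) \<omega>)))"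
proof -
  have "integrable M (\<lambda>\<omega>. complex_of_real (\<Prod>m\<in>S. X (f m) \<omega>))" if "f \<in> PiE S (\<lambda>_. E)" for f
    by (intro integrable_of_real product_integrable assms) (use that in auto)
  then show ?thesis
    unfolding prod_form[OF assms] by (subst Bochner_Integration.integral_sum) (auto simp del: of_real_prod)
qed

text \<open>
Integration by parts for complex linear forms, by multilinearity. The coefficient of the summand \<open>m\<close> is
the expectation of the product of the two forms, without complex conjugation.
\<close>

lemma stein_form:
  assumes S: "finite S"
  shows "integral\<^sup>L M (\<lambda>\<omega>. form c0 \<omega> * (\<Prod>m\<in>S. form (c m) \<omega>)) =
    (\<Sum>m\<in>S. (\<Sum>e\<in>E. c0 e * c m e * complex_of_real ((\<sigma> e)\<^sup>2)) *
       integral\<^sup>L M (\<lambda>\<omega>. \<Prod>m'\<in>S - {m}. form (c m') \<omega>))"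
proof -
  let ?F = "PiE S (\<lambda>_. E)"
  let ?C = "\<lambda>T f. \<Prod>m\<in>T. c m (f m)"
  let ?e = "\<lambda>T f. complex_of_real (expectation (\<lambda>\<omega>. \<Prod>m\<in>T. X (f m) \<omega>))"
  have fS: "f ` S \<subseteq> E" if "f \<in> ?F" for f using that by auto
  have int: "integrable M (\<lambda>\<omega>. X e \<omega> * (\<Prod>m\<in>S. X (f m) \<omega>))" if "e \<in> E" "f \<in> ?F" for e f
    unfolding extra_factor[OF S fS[OF that(2)] that(1)] by (rule monomial)
  have "form c0 \<omega> * (\<Prod>m\<in>S. form (c m) \<omega>) =
     (\<Sum>e\<in>E. \<Sum>f\<in>?F. (c0 e * ?C S f) * complex_of_real (X e \<omega> * (\<Prod>m\<in>S. X (f m) \<omega>)))" for \<omega>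
    unfolding prod_form[OF S] form_def[of c0] sum_product by (intro sum.cong refl) simp
  then have "integral\<^sup>L M (\<lambda>\<omega>. form c0 \<omega> * (\<Prod>m\<in>S. form (c m) \<omega>)) =
     (\<Sum>e\<in>E. \<Sum>f\<in>?F. (c0 e * ?C S f) * complex_of_real (expectation (\<lambda>\<omega>. X e \<omega> * (\<Prod>m\<in>S. X (f m) \<omega>))))"
    using int by (simp add: Bochner_Integration.integral_sum del: of_real_mult of_real_prod)
  also have "\<dots> = (\<Sum>e\<in>E. \<Sum>f\<in>?F. \<Sum>m\<in>S. (if f m = e then c0 e * complex_of_real ((\<sigma> e)\<^sup>2) * ?C S f * ?e (S - {m}) f else 0))"
  proof (intro sum.cong refl)
    fix e f assume "e \<in> E" "f \<in> ?F"
    then show "(c0 e * ?C S f) * complex_of_real (expectation (\<lambda>\<omega>. X e \<omega> * (\<Prod>m\<in>S. X (f m) \<omega>))) =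
      (\<Sum>m\<in>S. (if f m = e then c0 e * complex_of_real ((\<sigma> e)\<^sup>2) * ?C S f * ?e (S - {m}) f else 0))"
      by (subst stein_product[OF S fS]) (auto simp: sum_distrib_left intro!: sum.cong)
  qed
  also have "\<dots> = (\<Sum>m\<in>S. \<Sum>f\<in>?F. \<Sum>e\<in>E. (if f m = e then c0 e * complex_of_real ((\<sigma> e)\<^sup>2) * ?C S f * ?e (S - {m}) f else 0))"
    by (subst sum.swap, subst (2) sum.swap, subst sum.swap) (rule refl)
  also have "\<dots> = (\<Sum>m\<in>S. \<Sum>f\<in>?F. c0 (f m) * complex_of_real ((\<sigma> (f m))\<^sup>2) * ?C S f * ?e (S - {m}) f)"
    by (intro sum.cong refl) (use finE in \<open>auto simp: PiE_iff\<close>)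
  also have "\<dots> = (\<Sum>m\<in>S. (\<Sum>e\<in>E. c0 e * c m e * complex_of_real ((\<sigma> e)\<^sup>2)) *
       (\<Sum>g\<in>PiE (S - {m}) (\<lambda>_. E). ?C (S - {m}) g * ?e (S - {m}) g))"
  proof (intro sum.cong refl)
    fix m assume m: "m \<in> S"
    have C: "?C S (g(m := e)) = c m e * ?C (S - {m}) g" for g e
      using S m by (subst prod.remove[OF S m]) (auto intro!: prod.cong)
    have "?e (S - {m}) (g(m := e)) = ?e (S - {m}) g" for g e
      by (auto intro!: arg_cong[where f = complex_of_real] Bochner_Integration.integral_cong prod.cong)
    then show "(\<Sum>f\<in>?F. c0 (f m) * complex_of_real ((\<sigma> (f m))\<^sup>2) * ?C S f * ?e (S - {m}) f) =
      (\<Sum>e\<in>E. c0 e * c m e * complex_of_real ((\<sigma> e)\<^sup>2)) *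
       (\<Sum>g\<in>PiE (S - {m}) (\<lambda>_. E). ?C (S - {m}) g * ?e (S - {m}) g)"
      unfolding sum_PiE_split[OF m] C sum_product by (intro sum.cong refl) (simp add: mult_ac)
  qed
  also have "\<dots> = (\<Sum>m\<in>S. (\<Sum>e\<in>E. c0 e * c m e * complex_of_real ((\<sigma> e)\<^sup>2)) *
       integral\<^sup>L M (\<lambda>\<omega>. \<Prod>m'\<in>S - {m}. form (c m') \<omega>))"
    using S by (simp add: expectation_prod_form)
  finally show ?thesis .
qed

end

section \<open>Wick's formula for the GUE\<close>

lemma pairings_insert:
  assumes q: "q \<in> pairings (S - {a} - {b})" and ab: "a \<in> S" "b \<in> S" "b \<noteq> a"
  defines "p \<equiv> Transposition.transpose a b \<circ> q"
  shows "p \<in> pairings S" "p a = b" "p b = a" "\<And>z. z \<in> S - {a} - {b} \<Longrightarrow> p z = q z"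
proof -
  note Q = pairingsD[OF q]
  have fix_ab: "q a = a" "q b = b" using Q(1) by (auto simp: permutes_def)
  show pa: "p a = b" and pb: "p b = a" by (auto simp: p_def fix_ab)
  show eq: "p z = q z" if "z \<in> S - {a} - {b}" for z
    using Q(2)[OF that] by (auto simp: p_def Transposition.transpose_def)
  have "q permutes S" using Q(1) by (rule permutes_subset) auto
  then have "p permutes S" unfolding p_def using ab by (intro permutes_compose permutes_swap_id)
  moreover have "p x \<noteq> x \<and> p (p x) = x" if "x \<in> S" for x
  proof (cases "x = a \<or> x = b")
    case True
    then show ?thesis using pa pb ab by auto
  next
    case False
    then have x: "x \<in> S - {a} - {b}" using that by auto
    show ?thesis using eq[OF x] eq[OF Q(2)[OF x]] Q(3)[OF x] Q(4)[of x] by simp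
  qed
  ultimately show "p \<in> pairings S" by (simp add: pairings_def)
qed

lemma pairings_empty: "pairings {} = {id}"
  by (auto simp: pairings_def)

lemma finite_pairings: "finite S \<Longrightarrow> finite (pairings S)"
  by (rule finite_subset[OF _ finite_permutations[of S]]) (auto simp: pairings_def)

text \<open>
A pairing consists of the partner \<open>b\<close> of \<open>a\<close> and a pairing of the other elements.
\<close>

lemma sum_pairings_step:
  assumes S: "finite S" and a: "a \<in> S"
  shows "(\<Sum>p\<in>pairings S. F p) =
    (\<Sum>b\<in>S - {a}. \<Sum>q\<in>pairings (S - {a} - {b}). F (Transposition.transpose a b \<circ> q))"
proof -
  have "(\<Sum>b\<in>S - {a}. \<Sum>q\<in>pairings (S - {a} - {b}). F (Transposition.transpose a b \<circ> q)) =
    (\<Sum>(b, q)\<in>(SIGMA b:S - {a}. pairings (S - {a} - {b})). F (Transposition.transpose a b \<circ> q))"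
    using S by (subst sum.Sigma) (auto intro: finite_pairings)
  also have "\<dots> = (\<Sum>p\<in>pairings S. F p)"
  proof (rule sum.reindex_bij_witness[where j = "\<lambda>(b, q). Transposition.transpose a b \<circ> q"
        and i = "\<lambda>p. (p a, Transposition.transpose a (p a) \<circ> p)"])
    fix bq assume "bq \<in> (SIGMA b:S - {a}. pairings (S - {a} - {b}))"
    then obtain b q where bq: "bq = (b, q)" "b \<in> S" "b \<noteq> a" "q \<in> pairings (S - {a} - {b})" by auto
    note I = pairings_insert[OF bq(4) a bq(2,3)]
    show "(case bq of (b, q) \<Rightarrow> Transposition.transpose a b \<circ> q) \<in> pairings S" using I(1) bq by simp
    show "(\<lambda>p. (p a, Transposition.transpose a (p a) \<circ> p)) (case bq of (b, q) \<Rightarrow> Transposition.transpose a b \<circ> q) = bq"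
      using I(2) bq by (simp add: fun_eq_iff)
  next
    fix p assume p: "p \<in> pairings S"
    show "(p a, Transposition.transpose a (p a) \<circ> p) \<in> (SIGMA b:S - {a}. pairings (S - {a} - {b}))"
      using pairings_remove(1)[OF p a] pairingsD(2,3)[OF p a] by auto
  qed (auto simp: fun_eq_iff)
  finally show ?thesis ..
qed

definition gue_sd :: "nat \<Rightarrow> nat \<times> nat \<Rightarrow> real" where
  "gue_sd N = (\<lambda>(i, j). if i = j then sqrt (1 / real N) else sqrt (1 / (2 * real N)))"

text \<open>
Coefficients of a matrix entry as a linear form in the coordinates \<^const>\<open>hermitian_coord\<close>. Below the
diagonal the entry is the conjugate of the transposed one.
\<close>

definition entry_form :: "nat \<Rightarrow> nat \<Rightarrow> nat \<times> nat \<Rightarrow> complex" where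
  "entry_form i j e = (if i \<le> j then (if e = (i, j) then 1 else if e = (j, i) then \<i> else 0)
     else (if e = (j, i) then 1 else if e = (i, j) then - \<i> else 0))"

lemma sum_entry_form:
  assumes "i < N" "j < N"
  shows "(\<Sum>e\<in>{..<N} \<times> {..<N}. entry_form i j e * F e) =
    (if i = j then F (i, i) else if i < j then F (i, j) + \<i> * F (j, i) else F (j, i) - \<i> * F (i, j))"
proof -
  \<comment> \<open>Only the coordinates \<open>(i, j)\<close> and \<open>(j, i)\<close> enter; they coincide on the diagonal.\<close>
  have "(\<Sum>e\<in>{..<N} \<times> {..<N}. entry_form i j e * F e) = (\<Sum>e\<in>{(i, j), (j, i)}. entry_form i j e * F e)"
    by (rule sum.mono_neutral_right) (use assms in \<open>auto simp: entry_form_def\<close>)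
  also have "\<dots> = (if i = j then F (i, i) else if i < j then F (i, j) + \<i> * F (j, i) else F (j, i) - \<i> * F (i, j))"
    by (cases "i = j") (auto simp: entry_form_def)
  finally show ?thesis .
qed

text \<open>
Real and imaginary part of an off-diagonal entry have the same variance. Their contributions cancel in
the square of the entry, and add up in its product with the transposed entry.
\<close>

lemma entry_form_covariance:
  assumes "i < N" "j < N" "i' < N" "j' < N"
  shows "(\<Sum>e\<in>{..<N} \<times> {..<N}. entry_form i j e * entry_form i' j' e * complex_of_real ((gue_sd N e)\<^sup>2)) =
    (if i = j' \<and> j = i' then 1 / of_nat N else 0)"
proof -
  have "(\<Sum>e\<in>{..<N} \<times> {..<N}. entry_form i j e * (entry_form i' j' e * complex_of_real ((gue_sd N e)\<^sup>2))) =
    (if i = j' \<and> j = i' then 1 / of_nat N else 0)"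
    unfolding sum_entry_form[OF assms(1,2)]
    by (auto simp: entry_form_def gue_sd_def real_sqrt_pow2 field_simps)
  then show ?thesis by (simp add: mult.assoc)
qed

lemma GUE_gaussian_family:
  assumes "GUE N M W" "N \<ge> 1"
  shows "gaussian_family M ({..<N} \<times> {..<N}) (\<lambda>e \<omega>. hermitian_coord (W \<omega>) e) (gue_sd N)"
proof -
  interpret prob_space M using assms by (simp add: GUE_def)
  show ?thesis
  proof
    show "indep_vars (\<lambda>_. borel) (\<lambda>e \<omega>. hermitian_coord (W \<omega>) e) ({..<N} \<times> {..<N})"
      using assms by (simp add: GUE_def)
    fix e :: "nat \<times> nat" assume "e \<in> {..<N} \<times> {..<N}"
    then show "distributed M lborel (\<lambda>\<omega>. hermitian_coord (W \<omega>) e) (normal_density 0 (gue_sd N e))"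
      using assms by (cases e) (auto simp: GUE_def gue_sd_def)
    show "0 < gue_sd N e" using assms(2) by (auto simp: gue_sd_def split: prod.splits)
  qed simp
qed

lemma GUE_entry:
  assumes "GUE N M W" "N \<ge> 1" "\<omega> \<in> space M" "i < N" "j < N"
  shows "W \<omega> $$ (i, j) =
    gaussian_family.form ({..<N} \<times> {..<N}) (\<lambda>e \<omega>. hermitian_coord (W \<omega>) e) (entry_form i j) \<omega>"
proof -
  interpret gaussian_family M "{..<N} \<times> {..<N}" "\<lambda>e \<omega>. hermitian_coord (W \<omega>) e" "gue_sd N"
    by (rule GUE_gaussian_family[OF assms(1,2)])
  have W: "W \<omega> \<in> carrier_mat N N" "mat_adjoint (W \<omega>) = W \<omega>" using assms by (auto simp: GUE_def)
  have adj: "W \<omega> $$ (j, i) = cnj (W \<omega> $$ (i, j))" if "i < N" "j < N" for i j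
  proof -
    have "mat_adjoint (W \<omega>) $$ (j, i) = cnj (W \<omega> $$ (i, j))"
      using W(1) that by (auto simp: mat_adjoint_def mat_of_rows_def)
    then show ?thesis using W(2) by simp
  qed
  show ?thesis
    unfolding form_def sum_entry_form[OF assms(4,5)]
    using adj[OF assms(4,5)] adj[OF assms(5,4)]
    by (auto simp: hermitian_coord_def complex_eq_iff)
qed

text \<open>
Integration by parts with respect to one entry sums over its possible partners; by induction, all
entries are paired.
\<close>

theorem GUE_wick:
  assumes gue: "GUE N M W" "N \<ge> 1" and S: "finite S"
    and ij: "\<And>m. m \<in> S \<Longrightarrow> i m < N" "\<And>m. m \<in> S \<Longrightarrow> j m < N"
  shows "integrable M (\<lambda>\<omega>. \<Prod>m\<in>S. W \<omega> $$ (i m, j m))"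
    and "integral\<^sup>L M (\<lambda>\<omega>. \<Prod>m\<in>S. W \<omega> $$ (i m, j m)) =
      complex_of_real ((1 / sqrt (real N)) ^ card S) *
        (\<Sum>p\<in>pairings S. if \<forall>m\<in>S. i m = j (p m) then 1 else 0)"
proof -
  interpret gaussian_family M "{..<N} \<times> {..<N}" "\<lambda>e \<omega>. hermitian_coord (W \<omega>) e" "gue_sd N"
    by (rule GUE_gaussian_family[OF gue])
  have entries: "(\<Prod>m\<in>T. W \<omega> $$ (i m, j m)) = (\<Prod>m\<in>T. form (entry_form (i m) (j m)) \<omega>)"
    if "\<omega> \<in> space M" "T \<subseteq> S" for \<omega> T
    by (intro prod.cong refl GUE_entry[OF gue that(1)]) (use ij that in auto)
  have "integrable M (\<lambda>\<omega>. \<Prod>m\<in>S. form (entry_form (i m) (j m)) \<omega>)"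
    by (rule prod_form_integrable[OF S])
  then show "integrable M (\<lambda>\<omega>. \<Prod>m\<in>S. W \<omega> $$ (i m, j m))"
    by (subst Bochner_Integration.integrable_cong[OF refl entries]) auto
  have "integral\<^sup>L M (\<lambda>\<omega>. \<Prod>m\<in>S. W \<omega> $$ (i m, j m)) = integral\<^sup>L M (\<lambda>\<omega>. \<Prod>m\<in>S. form (entry_form (i m) (j m)) \<omega>)"
    by (intro Bochner_Integration.integral_cong refl entries) auto
  also have "\<dots> = complex_of_real ((1 / sqrt (real N)) ^ card S) *
        (\<Sum>p\<in>pairings S. if \<forall>m\<in>S. i m = j (p m) then 1 else 0)"
    using S ij
  proof (induction "card S" arbitrary: S rule: less_induct)
    case less
    show ?case
    proof (cases "S = {}")
      case True
      show ?thesis unfolding True pairings_empty by (simp add: prob_space)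
    next
      case False
      \<comment> \<open>Integrate by parts with respect to the entry \<open>a\<close>; the covariance selects its partner \<open>b\<close>.\<close>
      then obtain a where a: "a \<in> S" by blast
      let ?I = "\<lambda>T. integral\<^sup>L M (\<lambda>\<omega>. \<Prod>m\<in>T. form (entry_form (i m) (j m)) \<omega>)"
      let ?w = "\<lambda>T p. if \<forall>m\<in>T. i m = j (p m) then 1 else 0 :: complex"
      let ?r = "complex_of_real ((1 / sqrt (real N)) ^ card S)"
      have fin: "finite (S - {a})" using less.prems(1) by simp
      have "?I S = integral\<^sup>L M (\<lambda>\<omega>. form (entry_form (i a) (j a)) \<omega> * (\<Prod>m\<in>S - {a}. form (entry_form (i m) (j m)) \<omega>))"
        by (subst prod.remove[OF less.prems(1) a]) simp
      also have "\<dots> = (\<Sum>b\<in>S - {a}. (if i a = j b \<and> j a = i b then 1 / of_nat N else 0) * ?I (S - {a} - {b}))"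
        unfolding stein_form[OF fin]
        by (intro sum.cong refl arg_cong2[where f = "(*)"] entry_form_covariance) (use less.prems a in auto)
      also have "\<dots> = (\<Sum>b\<in>S - {a}. ?r * (\<Sum>q\<in>pairings (S - {a} - {b}). ?w S (Transposition.transpose a b \<circ> q)))"
      proof (intro sum.cong refl)
        fix b assume b: "b \<in> S - {a}"
        let ?S = "S - {a} - {b}"
        have c: "card S = card ?S + 2"
          using less.prems(1) a b by (metis One_nat_def add_2_eq_Suc' card.remove fin)
        have IH: "?I ?S = complex_of_real ((1 / sqrt (real N)) ^ card ?S) * (\<Sum>p\<in>pairings ?S. ?w ?S p)"
          by (rule less.hyps) (use c less.prems in auto)
        have r: "?r = 1 / of_nat N * complex_of_real ((1 / sqrt (real N)) ^ card ?S)"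
          unfolding c power_add using gue(2) by (simp add: power_divide flip: of_real_power)
        have w: "?w S (Transposition.transpose a b \<circ> q) = (if i a = j b \<and> j a = i b then 1 else 0) * ?w ?S q"
          if q: "q \<in> pairings ?S" for q
        proof -
          note I = pairings_insert[OF q a]
          have b': "b \<in> S" "b \<noteq> a" using b by auto
          have "(\<forall>m\<in>S. i m = j ((Transposition.transpose a b \<circ> q) m)) \<longleftrightarrow>
             i a = j b \<and> j a = i b \<and> (\<forall>m\<in>?S. i m = j (q m))"
          proof -
            have "S = insert a (insert b ?S)" using a b' by auto
            then have "(\<forall>m\<in>S. i m = j ((Transposition.transpose a b \<circ> q) m)) \<longleftrightarrow>
               (\<forall>m\<in>insert a (insert b ?S). i m = j ((Transposition.transpose a b \<circ> q) m))" by metis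
            also have "\<dots> \<longleftrightarrow> i a = j b \<and> i b = j a \<and>
                (\<forall>m\<in>?S. i m = j ((Transposition.transpose a b \<circ> q) m))"
              by (metis (no_types, lifting) I(2,3)[OF b'] insert_iff)
            also have "(\<forall>m\<in>?S. i m = j ((Transposition.transpose a b \<circ> q) m)) \<longleftrightarrow> (\<forall>m\<in>?S. i m = j (q m))"
              by (intro ball_cong refl) (simp only: I(4)[OF b'])
            finally show ?thesis by auto
          qed
          then show ?thesis by simp
        qed
        have "(\<Sum>q\<in>pairings ?S. ?w S (Transposition.transpose a b \<circ> q)) =
          (if i a = j b \<and> j a = i b then 1 else 0) * (\<Sum>q\<in>pairings ?S. ?w ?S q)"
          unfolding sum_distrib_left by (intro sum.cong refl w)
        then show "(if i a = j b \<and> j a = i b then 1 / of_nat N else 0) * ?I ?S =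
          ?r * (\<Sum>q\<in>pairings ?S. ?w S (Transposition.transpose a b \<circ> q))"
          unfolding IH r by simp
      qed
      also have "\<dots> = ?r * (\<Sum>p\<in>pairings S. ?w S p)"
        unfolding sum_pairings_step[OF less.prems(1) a] sum_distrib_left ..
      finally show ?thesis .
    qed
  qed
  finally show "integral\<^sup>L M (\<lambda>\<omega>. \<Prod>m\<in>S. W \<omega> $$ (i m, j m)) =
      complex_of_real ((1 / sqrt (real N)) ^ card S) *
        (\<Sum>p\<in>pairings S. if \<forall>m\<in>S. i m = j (p m) then 1 else 0)" .
qed

section \<open>Traces along cycles as sums over indices\<close>

lemma mat_prod_list_carrier:
  assumes "\<And>B. B \<in> set Bs \<Longrightarrow> B \<in> carrier_mat N N"
  shows "mat_prod_list N Bs \<in> carrier_mat N N"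
  using assms
proof (induction Bs)
  case (Cons B Bs)
  then have "B \<in> carrier_mat N N" "mat_prod_list N Bs \<in> carrier_mat N N" by simp_all
  then show ?case by (simp add: mat_prod_list_def)
qed (simp add: mat_prod_list_def)

lemma mat_prod_list_merge:
  assumes "B \<in> carrier_mat N N" "B' \<in> carrier_mat N N" "\<And>B. B \<in> set Bs \<Longrightarrow> B \<in> carrier_mat N N"
  shows "mat_prod_list N (B # B' # Bs) = mat_prod_list N (B * B' # Bs)"
  using assoc_mult_mat[OF assms(1,2) mat_prod_list_carrier[of Bs N]] assms(3)
  by (simp add: mat_prod_list_def)

lemma funpow_orbit_inj:
  assumes "finite S" "f permutes S" "x \<in> S" "0 < n" "n < card (orbit f x)"
  shows "(f ^^ n) x \<noteq> x"
proof
  assume "(f ^^ n) x = x"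
  then have "orbit f x = (\<lambda>m. (f ^^ m) x) ` {..<n}"
    using orbit_altdef_bounded[of n f x] assms(4) by auto
  then have "card (orbit f x) \<le> n" by (metis card_image_le card_lessThan finite_lessThan)
  then show False using assms(5) by simp
qed

lemma cycle_ntrace_cong:
  assumes "\<And>x. x \<in> C \<Longrightarrow> f x = g x \<and> f x \<in> C" "\<And>x. x \<in> C \<Longrightarrow> B x = B' x" "Min C \<in> C"
  shows "cycle_ntrace N B f C = cycle_ntrace N B' g C"
proof -
  have iter: "(f ^^ i) (Min C) = (g ^^ i) (Min C) \<and> (f ^^ i) (Min C) \<in> C" for i
  proof (induction i)
    case (Suc i)
    then show ?case using assms(1) by (metis comp_apply funpow.simps(2))
  qed (simp add: assms(3))
  then have "map (\<lambda>i. B ((f ^^ i) (Min C))) [0..<card C] = map (\<lambda>i. B' ((g ^^ i) (Min C))) [0..<card C]"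
    using assms(2) iter by (intro map_cong refl) metis
  then show ?thesis by (simp only: cycle_ntrace_def)
qed

text \<open>
Merging the first two factors along a cycle does not change their product.
\<close>

lemma cycle_ntrace_merge:
  assumes f: "finite S" "f permutes S" and s: "s \<in> S" "f s \<noteq> s" and Min: "Min (orbit f s) = s"
    and B: "\<And>x. x \<in> S \<Longrightarrow> B x \<in> carrier_mat N N"
  defines "t \<equiv> f s"
  shows "cycle_ntrace N (B(s := B s * B t)) (skip f t) (orbit f s - {t}) = cycle_ntrace N B f (orbit f s)"
proof -
  let ?C = "orbit f s"
  have CS: "?C \<subseteq> S" by (rule permutes_orbit_subset[OF f(2) s(1)])
  have tC: "t \<in> ?C" unfolding t_def by (rule orbit.base)
  have finC: "finite ?C" using CS f(1) finite_subset by blast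
  obtain m where m: "card ?C = Suc (Suc m)"
    using card_cycle_ge_2[OF f s] by (metis Suc_le_D numeral_2_eq_2 Suc_le_mono)
  have inS: "(f ^^ i) s \<in> S" for i using CS funpow_in_orbit[OF orbit_self[OF f]] by blast
  have ne: "(f ^^ i) s \<noteq> s" if "0 < i" "i \<le> Suc m" for i
    by (rule funpow_orbit_inj[OF f s(1)]) (use that m in auto)
  have net: "(f ^^ Suc i) s \<noteq> t" if "0 < i" "i \<le> Suc m" for i
    using ne[OF that] permutes_inj[OF f(2)] by (auto simp: t_def dest: injD)
  note sk = skip_simps[OF f(2)]
  have pow: "(skip f t ^^ i) s = (if i = 0 then s else (f ^^ Suc i) s)" if "i \<le> m" for i
    using that
  proof (induction i)
    case (Suc i)
    show ?case
    proof (cases "i = 0")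
      case True
      then show ?thesis using sk(2)[of s t] by (simp add: t_def)
    next
      case False
      have "skip f t ((f ^^ Suc i) s) = f ((f ^^ Suc i) s)"
        by (rule sk(3)) (use net[of i] net[of "Suc i"] False Suc.prems in auto)
      then show ?thesis using Suc False by simp
    qed
  qed simp
  have minC: "Min (?C - {t}) = s"
  proof (rule Min_eqI)
    show "finite (?C - {t})" using finC by simp
    show "s \<in> ?C - {t}" using orbit_self[OF f] s(2) by (auto simp: t_def)
    show "s \<le> y" if "y \<in> ?C - {t}" for y using Min finC that Min_le[of ?C y] by auto
  qed
  have cardC: "card (?C - {t}) = Suc m" using m tC by simp
  let ?B = "B(s := B s * B t)"
  let ?rest = "map (\<lambda>i. B ((f ^^ Suc (Suc i)) s)) [0..<m]"
  have "map (\<lambda>i. ?B ((skip f t ^^ i) s)) [0..<Suc m] = B s * B t # map (\<lambda>i. ?B ((skip f t ^^ Suc i) s)) [0..<m]"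
    by (simp add: upt_conv_Cons map_Suc_upt[symmetric] o_def del: upt_Suc funpow.simps(2))
  also have "map (\<lambda>i. ?B ((skip f t ^^ Suc i) s)) [0..<m] = ?rest"
    using pow ne by (intro map_cong refl) (auto simp del: funpow.simps(2))
  finally have 1: "map (\<lambda>i. ?B ((skip f t ^^ i) s)) [0..<Suc m] = B s * B t # ?rest" .
  have 2: "map (\<lambda>i. B ((f ^^ i) s)) [0..<Suc (Suc m)] = B s # B t # ?rest"
    by (simp add: upt_conv_Cons map_Suc_upt[symmetric] o_def t_def del: upt_Suc)
  have "mat_prod_list N (B s # B t # ?rest) = mat_prod_list N (B s * B t # ?rest)"
    by (rule mat_prod_list_merge) (use B inS s f(2) in \<open>auto simp: t_def permutes_in_image\<close>)
  then show ?thesis unfolding cycle_ntrace_def minC cardC Min m 1 2 by simp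
qed

text \<open>
If \<open>\<sigma>\<close> is the identity, this is the distributive law. Otherwise take \<open>t = \<sigma> s \<noteq> s\<close>: the sum over the
index of \<open>t\<close> multiplies the matrices of \<open>s\<close> and \<open>t\<close>, and leaves the same expression with \<open>t\<close> cut out
of \<open>\<sigma>\<close>.
\<close>

theorem trace_expansion:
  assumes "finite S" "\<sigma> permutes S" "\<And>s. s \<in> S \<Longrightarrow> B s \<in> carrier_mat N N" "N \<ge> 1"
  shows "(\<Sum>f\<in>PiE S (\<lambda>_. {..<N}). \<Prod>s\<in>S. B s $$ (f s, f (\<sigma> s))) =
    (\<Prod>C\<in>cycle_sets S \<sigma>. of_nat N * cycle_ntrace N B \<sigma> C)"
  using assms
proof (induction "card S" arbitrary: S \<sigma> B rule: less_induct)
  case less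
  note perm = less.prems(2)
  show ?case
  proof (cases "\<forall>s\<in>S. \<sigma> s = s")
    case True
    have orb: "orbit \<sigma> s = {s}" if "s \<in> S" for s using True that by (simp add: orbit_eq_singleton_iff)
    then have cyc: "cycle_sets S \<sigma> = (\<lambda>s. {s}) ` S" by (auto simp: cycle_sets_def)
    have single: "of_nat N * cycle_ntrace N B \<sigma> {s} = (\<Sum>i<N. B s $$ (i, i))" if "s \<in> S" for s
      using less.prems(3)[OF that] less.prems(4)
      by (simp add: cycle_ntrace_def mat_prod_list_def ntrace_def)
    have "(\<Sum>f\<in>PiE S (\<lambda>_. {..<N}). \<Prod>s\<in>S. B s $$ (f s, f (\<sigma> s))) =
       (\<Sum>f\<in>PiE S (\<lambda>_. {..<N}). \<Prod>s\<in>S. B s $$ (f s, f s))"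
      using True by (intro sum.cong prod.cong refl) auto
    also have "\<dots> = (\<Prod>s\<in>S. \<Sum>i<N. B s $$ (i, i))"
      using less.prems(1) by (subst prod_sum_PiE) auto
    also have "\<dots> = (\<Prod>C\<in>cycle_sets S \<sigma>. of_nat N * cycle_ntrace N B \<sigma> C)"
      unfolding cyc by (subst prod.reindex) (auto simp: single intro!: prod.cong)
    finally show ?thesis .
  next
    case False
    then obtain s0 where s0: "s0 \<in> S" "\<sigma> s0 \<noteq> s0" by blast
    have finC: "finite C" "C \<noteq> {}" "C \<subseteq> S" if "C \<in> cycle_sets S \<sigma>" for C
      using that permutes_orbit_subset[OF perm] orbit_self[OF less.prems(1) perm] less.prems(1)
      by (auto simp: cycle_sets_def intro: finite_subset)
    \<comment> \<open>The minimum of the cycle is kept, because \<^const>\<open>cycle_ntrace\<close> starts its product there.\<close>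
    define s where "s = Min (orbit \<sigma> s0)"
    have "s \<in> orbit \<sigma> s0" unfolding s_def using finC[of "orbit \<sigma> s0"] s0 by (intro Min_in) (auto simp: cycle_sets_def)
    then have orb: "orbit \<sigma> s = orbit \<sigma> s0" by (rule orbit_eq_if_mem[OF less.prems(1) perm])
    have s: "s \<in> S" using \<open>s \<in> orbit \<sigma> s0\<close> permutes_orbit_subset[OF perm s0(1)] by auto
    have ne: "\<sigma> s \<noteq> s"
    proof
      assume "\<sigma> s = s"
      then have "orbit \<sigma> s0 = {s}" using orb orbit_eq_singleton_iff[of \<sigma> s] by simp
      then show False using s0 orbit_self[OF less.prems(1) perm, of s0] \<open>\<sigma> s = s\<close> by auto
    qed
    define t where "t = \<sigma> s"
    have t: "t \<in> S" "t \<noteq> s" using s ne perm by (auto simp: t_def permutes_in_image)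
    have "\<sigma> t \<noteq> t" using ne permutes_inj[OF perm] by (auto simp: t_def dest: injD)
    define S' \<sigma>' B' where "S' = S - {t}" and "\<sigma>' = skip \<sigma> t" and "B' = B(s := B s * B t)"
    have perm': "\<sigma>' permutes S'" unfolding \<sigma>'_def S'_def by (rule skip_permutes[OF perm t(1)])
    have fin': "finite S'" "s \<in> S'" using less.prems(1) s t by (auto simp: S'_def)
    have BC: "B s \<in> carrier_mat N N" "B t \<in> carrier_mat N N" using less.prems(3) s t by auto
    have \<sigma>': "\<sigma>' s = \<sigma> t" "x \<noteq> t \<Longrightarrow> x \<noteq> s \<Longrightarrow> \<sigma>' x = \<sigma> x" for x
      using skip_simps(2,3)[OF perm] permutes_inj[OF perm] by (auto simp: \<sigma>'_def t_def dest: injD)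
    have "(\<Sum>f\<in>PiE S (\<lambda>_. {..<N}). \<Prod>x\<in>S. B x $$ (f x, f (\<sigma> x))) =
      (\<Sum>g\<in>PiE S' (\<lambda>_. {..<N}). \<Sum>i<N. \<Prod>x\<in>S. B x $$ ((g(t := i)) x, (g(t := i)) (\<sigma> x)))"
      unfolding sum_PiE_split[OF t(1)] S'_def by (rule sum.swap)
    also have "\<dots> = (\<Sum>g\<in>PiE S' (\<lambda>_. {..<N}). \<Prod>x\<in>S'. B' x $$ (g x, g (\<sigma>' x)))"
    proof (rule sum.cong[OF refl])
      fix g assume g: "g \<in> PiE S' (\<lambda>_. {..<N})"
      have gs: "g s < N" using g fin'(2) by auto
      have "\<sigma> t \<in> S'" using \<open>\<sigma> t \<noteq> t\<close> t perm by (auto simp: S'_def permutes_in_image)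
      then have gt: "g (\<sigma> t) < N" using g by auto
      have "(\<Prod>x\<in>S. B x $$ ((g(t := i)) x, (g(t := i)) (\<sigma> x))) =
        B s $$ (g s, i) * B t $$ (i, g (\<sigma> t)) * (\<Prod>x\<in>S' - {s}. B' x $$ (g x, g (\<sigma>' x)))" for i
      proof -
        have "(\<Prod>x\<in>S. B x $$ ((g(t := i)) x, (g(t := i)) (\<sigma> x))) =
          B t $$ (i, g (\<sigma> t)) * (B s $$ (g s, i) * (\<Prod>x\<in>S' - {s}. B x $$ ((g(t := i)) x, (g(t := i)) (\<sigma> x))))"
          using \<open>\<sigma> t \<noteq> t\<close> t(2)
          by (subst prod.remove[OF less.prems(1) t(1)], fold S'_def, subst prod.remove[OF fin'])
            (simp add: t_def)
        also have "(\<Prod>x\<in>S' - {s}. B x $$ ((g(t := i)) x, (g(t := i)) (\<sigma> x))) =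
          (\<Prod>x\<in>S' - {s}. B' x $$ (g x, g (\<sigma>' x)))"
        proof (rule prod.cong[OF refl])
          fix x assume "x \<in> S' - {s}"
          then have x: "x \<noteq> t" "x \<noteq> s" by (auto simp: S'_def)
          then have "\<sigma> x \<noteq> t" using permutes_inj[OF perm] by (auto simp: t_def dest: injD)
          then show "B x $$ ((g(t := i)) x, (g(t := i)) (\<sigma> x)) = B' x $$ (g x, g (\<sigma>' x))"
            using x \<sigma>'(2)[OF x] by (simp add: B'_def)
        qed
        finally show ?thesis by (simp add: mult_ac)
      qed
      then have "(\<Sum>i<N. \<Prod>x\<in>S. B x $$ ((g(t := i)) x, (g(t := i)) (\<sigma> x))) =
        (\<Sum>i<N. B s $$ (g s, i) * B t $$ (i, g (\<sigma> t))) * (\<Prod>x\<in>S' - {s}. B' x $$ (g x, g (\<sigma>' x)))"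
        by (simp add: sum_distrib_right)
      also have "(\<Sum>i<N. B s $$ (g s, i) * B t $$ (i, g (\<sigma> t))) = B' s $$ (g s, g (\<sigma>' s))"
        using BC gs gt by (simp add: B'_def \<sigma>'(1) scalar_prod_def atLeast0LessThan)
      finally show "(\<Sum>i<N. \<Prod>x\<in>S. B x $$ ((g(t := i)) x, (g(t := i)) (\<sigma> x))) =
        (\<Prod>x\<in>S'. B' x $$ (g x, g (\<sigma>' x)))"
        by (subst prod.remove[OF fin'])
    qed
    also have "\<dots> = (\<Prod>C\<in>cycle_sets S' \<sigma>'. of_nat N * cycle_ntrace N B' \<sigma>' C)"
    proof (rule less.hyps[OF _ fin'(1) perm' _ less.prems(4)])
      show "card S' < card S" using less.prems(1) t(1) unfolding S'_def by (rule card_Diff1_less)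
      show "B' x \<in> carrier_mat N N" if "x \<in> S'" for x
        using that less.prems(3) BC by (auto simp: B'_def S'_def)
    qed
    also have "\<dots> = (\<Prod>C\<in>cycle_sets S \<sigma>. of_nat N * cycle_ntrace N B' \<sigma>' (C - {t}))"
      unfolding S'_def \<sigma>'_def cycle_sets_skip(1)[OF less.prems(1) perm t(1) \<open>\<sigma> t \<noteq> t\<close>]
      by (subst prod.reindex[OF cycle_sets_skip(2)[OF less.prems(1) perm t(1) \<open>\<sigma> t \<noteq> t\<close>]]) simp
    also have "\<dots> = (\<Prod>C\<in>cycle_sets S \<sigma>. of_nat N * cycle_ntrace N B \<sigma> C)"
    proof (intro prod.cong refl arg_cong2[where f = "(*)"])
      fix C assume C: "C \<in> cycle_sets S \<sigma>"
      then obtain x where x: "C = orbit \<sigma> x" by (auto simp: cycle_sets_def)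
      show "cycle_ntrace N B' \<sigma>' (C - {t}) = cycle_ntrace N B \<sigma> C"
      proof (cases "t \<in> C")
        case True
        have "C = orbit \<sigma> t" using True orbit_eq_if_mem[OF less.prems(1) perm, of t x] x by simp
        moreover have "orbit \<sigma> t = orbit \<sigma> s"
          unfolding t_def by (rule orbit_eq_if_mem[OF less.prems(1) perm orbit.base])
        ultimately have "C = orbit \<sigma> s" by simp
        then show ?thesis
          using cycle_ntrace_merge[OF less.prems(1) perm s ne _ less.prems(3)] orb
          by (simp add: B'_def \<sigma>'_def t_def s_def)
      next
        case False
        have closed: "\<sigma> y \<in> C" if "y \<in> C" for y using that unfolding x by (rule orbit.step)
        have "s \<notin> C" using False closed[of s] by (auto simp: t_def)
        then have step: "\<sigma>' y = \<sigma> y" if "y \<in> C" for y using False \<sigma>'(2)[of y] that by blast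
        have "cycle_ntrace N B' \<sigma>' C = cycle_ntrace N B \<sigma> C"
          by (rule cycle_ntrace_cong)
            (use step closed \<open>s \<notin> C\<close> Min_in[OF finC(1,2)[OF C]] in \<open>auto simp: B'_def\<close>)
        then show ?thesis using False by simp
      qed
    qed
    finally show ?thesis .
  qed
qed

section \<open>Bounds on normalised traces\<close>

lemma euclidean_norm_L2: "euclidean_norm v = L2_set (\<lambda>i. cmod (vec_index v i)) {..<dim_vec v}"
  by (simp add: euclidean_norm_def L2_set_def)

lemma euclidean_norm_nonneg: "0 \<le> euclidean_norm v"
  by (simp add: euclidean_norm_L2)

lemma entry_le_euclidean_norm: "i < dim_vec v \<Longrightarrow> cmod (vec_index v i) \<le> euclidean_norm v"
  unfolding euclidean_norm_L2 by (rule member_le_L2_set) auto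

lemma euclidean_norm_smult: "euclidean_norm (c \<cdot>\<^sub>v v) = cmod c * euclidean_norm v"
  unfolding euclidean_norm_L2
  by (subst L2_set_right_distrib) (auto simp: norm_mult intro!: L2_set_cong)

lemma mult_mat_vec_bounded:
  assumes A: "A \<in> carrier_mat N N" and v: "v \<in> carrier_vec N"
  shows "euclidean_norm (A *\<^sub>v v) \<le> (\<Sum>i<N. \<Sum>j<N. cmod (A $$ (i, j))) * euclidean_norm v"
proof -
  have "euclidean_norm (A *\<^sub>v v) \<le> (\<Sum>i<N. cmod (vec_index (A *\<^sub>v v) i))"
    using A unfolding euclidean_norm_L2 by (intro order_trans[OF L2_set_le_sum]) auto
  also have "\<dots> \<le> (\<Sum>i<N. \<Sum>j<N. cmod (A $$ (i, j)) * euclidean_norm v)"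
  proof (rule sum_mono)
    fix i assume i: "i \<in> {..<N}"
    have "vec_index (A *\<^sub>v v) i = (\<Sum>j<N. A $$ (i, j) * vec_index v j)"
      using A v i by (simp add: scalar_prod_def atLeast0LessThan)
    also have "cmod \<dots> \<le> (\<Sum>j<N. cmod (A $$ (i, j)) * euclidean_norm v)"
      by (rule sum_norm_le) (use v in \<open>auto simp: norm_mult intro!: mult_left_mono entry_le_euclidean_norm\<close>)
    finally show "cmod (vec_index (A *\<^sub>v v) i) \<le> (\<Sum>j<N. cmod (A $$ (i, j)) * euclidean_norm v)" .
  qed
  also have "\<dots> = (\<Sum>i<N. \<Sum>j<N. cmod (A $$ (i, j))) * euclidean_norm v"
    by (simp add: sum_distrib_right)
  finally show ?thesis .
qed

text \<open>
Scaling reduces the bound to unit vectors, for which it is the definition of the supremum.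
\<close>

lemma operator_norm_bound:
  assumes A: "A \<in> carrier_mat N N" and v: "v \<in> carrier_vec N"
  shows "euclidean_norm (A *\<^sub>v v) \<le> operator_norm A * euclidean_norm v"
proof (cases "euclidean_norm v = 0")
  case True
  then show ?thesis using mult_mat_vec_bounded[OF A v] by simp
next
  case False
  let ?n = "euclidean_norm v"
  have n: "?n > 0" using False euclidean_norm_nonneg[of v] by simp
  define u where "u = complex_of_real (1 / ?n) \<cdot>\<^sub>v v"
  have u: "u \<in> carrier_vec N" "euclidean_norm u = 1" using v n by (auto simp: u_def euclidean_norm_smult norm_divide)
  let ?K = "\<Sum>i<N. \<Sum>j<N. cmod (A $$ (i, j))"
  let ?T = "{euclidean_norm (A *\<^sub>v v) | v. v \<in> carrier_vec (dim_col A) \<and> euclidean_norm v \<le> 1}"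
  \<comment> \<open>The supremum of an unbounded set would be arbitrary.\<close>
  have "bdd_above ?T"
  proof (rule bdd_aboveI)
    fix x assume "x \<in> ?T"
    then obtain w where w: "x = euclidean_norm (A *\<^sub>v w)" "w \<in> carrier_vec N" "euclidean_norm w \<le> 1"
      using A by auto
    have "?K * euclidean_norm w \<le> ?K * 1" using w(3) by (intro mult_left_mono) (auto intro!: sum_nonneg)
    then show "x \<le> ?K" using mult_mat_vec_bounded[OF A w(2)] w(1) by simp
  qed
  moreover have "euclidean_norm (A *\<^sub>v u) \<in> ?T" using u A by auto
  ultimately have "euclidean_norm (A *\<^sub>v u) \<le> operator_norm A"
    unfolding operator_norm_def by (intro cSup_upper)
  moreover have "A *\<^sub>v u = complex_of_real (1 / ?n) \<cdot>\<^sub>v (A *\<^sub>v v)"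
    unfolding u_def using A v by (rule mult_mat_vec)
  ultimately have "euclidean_norm (A *\<^sub>v v) / ?n \<le> operator_norm A"
    using n by (simp add: euclidean_norm_smult norm_divide)
  then show ?thesis using n by (simp add: divide_le_eq)
qed

lemma mat_prod_list_bound:
  assumes "\<And>B. B \<in> set Bs \<Longrightarrow> B \<in> carrier_mat N N \<and> operator_norm B \<le> c" and v: "v \<in> carrier_vec N" and c: "c \<ge> 0"
  shows "euclidean_norm (mat_prod_list N Bs *\<^sub>v v) \<le> c ^ length Bs * euclidean_norm v"
  using assms(1)
proof (induction Bs)
  case Nil
  then show ?case using v by (simp add: mat_prod_list_def)
next
  case (Cons B Bs)
  let ?P = "mat_prod_list N Bs"
  have B: "B \<in> carrier_mat N N" "operator_norm B \<le> c" using Cons.prems by auto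
  have P: "?P \<in> carrier_mat N N" by (rule mat_prod_list_carrier) (use Cons.prems in auto)
  have "mat_prod_list N (B # Bs) *\<^sub>v v = B *\<^sub>v (?P *\<^sub>v v)"
    using assoc_mult_mat_vec[OF B(1) P v] by (simp add: mat_prod_list_def)
  then have "euclidean_norm (mat_prod_list N (B # Bs) *\<^sub>v v) \<le> operator_norm B * euclidean_norm (?P *\<^sub>v v)"
    using operator_norm_bound[OF B(1)] P v by simp
  also have "\<dots> \<le> c * (c ^ length Bs * euclidean_norm v)"
    using B(2) Cons c by (intro mult_mono) (auto simp: euclidean_norm_nonneg)
  finally show ?case by (simp add: mult.assoc)
qed

text \<open>
A diagonal entry is a coordinate of the image of a unit vector, so it is bounded by the product of the
operator norms.
\<close>

lemma ntrace_mat_prod_list_bound: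
  assumes "\<And>B. B \<in> set Bs \<Longrightarrow> B \<in> carrier_mat N N \<and> operator_norm B \<le> c" and c: "c \<ge> 0" and N: "N \<ge> 1"
  shows "cmod (ntrace (mat_prod_list N Bs)) \<le> c ^ length Bs"
proof -
  let ?P = "mat_prod_list N Bs"
  have P: "?P \<in> carrier_mat N N" by (rule mat_prod_list_carrier) (use assms in auto)
  have entry: "cmod (?P $$ (i, i)) \<le> c ^ length Bs" if i: "i < N" for i
  proof -
    have "(\<Sum>j<N. (cmod (vec_index (unit_vec N i :: complex vec) j))\<^sup>2) = (\<Sum>j<N. if j = i then 1 else 0)"
      by (intro sum.cong refl) (auto simp: unit_vec_def)
    then have u: "euclidean_norm (unit_vec N i) = 1" using i by (simp add: euclidean_norm_def)
    have "?P $$ (i, i) = vec_index (?P *\<^sub>v unit_vec N i) i" using P i by simp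
    then have "cmod (?P $$ (i, i)) \<le> euclidean_norm (?P *\<^sub>v unit_vec N i)"
      using entry_le_euclidean_norm[of i "?P *\<^sub>v unit_vec N i"] P i by simp
    also have "\<dots> \<le> c ^ length Bs * 1"
      using mat_prod_list_bound[OF assms(1) unit_vec_carrier c] u by metis
    finally show ?thesis by simp
  qed
  have "cmod (\<Sum>i<N. ?P $$ (i, i)) \<le> (\<Sum>i<N. c ^ length Bs)"
    by (rule sum_norm_le) (use entry in auto)
  then show ?thesis using P N by (simp add: ntrace_def norm_divide divide_le_eq mult.commute)
qed

lemma cycle_ntrace_bound:
  assumes S: "finite S" "\<sigma> permutes S" and C: "C \<in> cycle_sets S \<sigma>" and c: "c \<ge> 1" and N: "N \<ge> 1"
    and A: "\<And>s. s \<in> S \<Longrightarrow> A s \<in> carrier_mat N N" "\<And>s. s \<in> S \<Longrightarrow> operator_norm (A s) \<le> c"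
  shows "cmod (cycle_ntrace N A \<sigma> C) \<le> c ^ card S"
proof -
  obtain x where x: "x \<in> S" "C = orbit \<sigma> x" using C by (auto simp: cycle_sets_def)
  have CS: "C \<subseteq> S" unfolding x by (rule permutes_orbit_subset[OF S(2) x(1)])
  then have "finite C" using S(1) finite_subset by blast
  moreover have "C \<noteq> {}" using orbit_self[OF S, of x] x by auto
  ultimately have "Min C \<in> C" by simp
  then have iter: "(\<sigma> ^^ i) (Min C) \<in> S" for i
    using funpow_in_orbit[of "Min C" \<sigma> x i] CS unfolding x by blast
  have "cmod (cycle_ntrace N A \<sigma> C) \<le> c ^ length (map (\<lambda>i. A ((\<sigma> ^^ i) (Min C))) [0..<card C])"
    unfolding cycle_ntrace_def by (rule ntrace_mat_prod_list_bound) (use A iter c N in auto)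
  also have "\<dots> \<le> c ^ card S" using CS S(1) c by (auto intro!: power_increasing card_mono)
  finally show ?thesis .
qed

section \<open>Expectations of products of traces\<close>

definition trace_product :: "nat \<Rightarrow> (nat \<Rightarrow> complex mat) \<Rightarrow> nat set \<Rightarrow> (nat \<Rightarrow> nat) \<Rightarrow> complex" where
  "trace_product N A S \<sigma> = (\<Prod>C\<in>cycle_sets S \<sigma>. of_nat N * cycle_ntrace N A \<sigma> C)"

text \<open>
Wick's formula for the expectation of a product of traces has this form with all pairings of \<open>S\<close> as
\<open>Ps\<close>; smaller sets \<open>Ps\<close> collect parts of it.
\<close>

definition wick_sum :: "nat \<Rightarrow> (nat \<Rightarrow> complex mat) \<Rightarrow> nat set \<Rightarrow> (nat \<Rightarrow> nat) \<Rightarrow> (nat \<Rightarrow> nat) set \<Rightarrow> complex" where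
  "wick_sum N A S \<sigma> Ps =
     complex_of_real ((1 / sqrt (real N)) ^ card S) * (\<Sum>p\<in>Ps. trace_product N A S (p \<circ> \<sigma>))"

lemma sum_rotate: "(\<Sum>a\<in>A. \<Sum>b\<in>B. \<Sum>c\<in>C. F a b c) = (\<Sum>c\<in>C. \<Sum>b\<in>B. \<Sum>a\<in>A. F a b c)"
proof -
  have "(\<Sum>a\<in>A. \<Sum>b\<in>B. \<Sum>c\<in>C. F a b c) = (\<Sum>a\<in>A. \<Sum>c\<in>C. \<Sum>b\<in>B. F a b c)"
    by (intro sum.cong refl sum.swap)
  also have "\<dots> = (\<Sum>c\<in>C. \<Sum>a\<in>A. \<Sum>b\<in>B. F a b c)" by (rule sum.swap)
  also have "\<dots> = (\<Sum>c\<in>C. \<Sum>b\<in>B. \<Sum>a\<in>A. F a b c)" by (intro sum.cong refl sum.swap)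
  finally show ?thesis .
qed

text \<open>
Wick's formula for \<open>p\<close> identifies the row index of the entry \<open>m\<close> with the column index of its partner
\<open>p m\<close>. This turns \<open>\<sigma>\<close> into \<open>p \<circ> \<sigma>\<close> in the expansion of the traces of the deterministic matrices.
\<close>

lemma expectation_trace_product:
  assumes gue: "GUE N M W" "N \<ge> 1" and S: "finite S" "\<sigma> permutes S"
    and A: "\<And>s. s \<in> S \<Longrightarrow> A s \<in> carrier_mat N N"
  shows "integrable M (\<lambda>\<omega>. trace_product N (\<lambda>s. W \<omega> * A s) S \<sigma>)"
    and "integral\<^sup>L M (\<lambda>\<omega>. trace_product N (\<lambda>s. W \<omega> * A s) S \<sigma>) = wick_sum N A S \<sigma> (pairings S)"
proof -
  let ?F = "PiE S (\<lambda>_. {..<N})"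
  let ?a = "\<lambda>f g. \<Prod>s\<in>S. A s $$ (g s, f (\<sigma> s))"
  let ?W = "\<lambda>f g \<omega>. \<Prod>s\<in>S. W \<omega> $$ (f s, g s)"
  have \<sigma>S: "\<sigma> s \<in> S" if "s \<in> S" for s using S(2) that by (simp add: permutes_in_image)
  have expand: "trace_product N (\<lambda>s. W \<omega> * A s) S \<sigma> = (\<Sum>f\<in>?F. \<Sum>g\<in>?F. ?W f g \<omega> * ?a f g)"
    if \<omega>: "\<omega> \<in> space M" for \<omega>
  proof -
    have W: "W \<omega> \<in> carrier_mat N N" using gue(1) \<omega> by (simp add: GUE_def)
    have "trace_product N (\<lambda>s. W \<omega> * A s) S \<sigma> = (\<Sum>f\<in>?F. \<Prod>s\<in>S. (W \<omega> * A s) $$ (f s, f (\<sigma> s)))"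
      unfolding trace_product_def
      by (rule trace_expansion[symmetric, OF S _ gue(2)]) (use W A in auto)
    also have "\<dots> = (\<Sum>f\<in>?F. \<Prod>s\<in>S. \<Sum>i<N. W \<omega> $$ (f s, i) * A s $$ (i, f (\<sigma> s)))"
    proof (intro sum.cong prod.cong refl)
      fix f s assume f: "f \<in> ?F" and s: "s \<in> S"
      have "f s < N" "f (\<sigma> s) < N" using f s \<sigma>S[OF s] by auto
      then show "(W \<omega> * A s) $$ (f s, f (\<sigma> s)) = (\<Sum>i<N. W \<omega> $$ (f s, i) * A s $$ (i, f (\<sigma> s)))"
        using W A[OF s] by (simp add: scalar_prod_def atLeast0LessThan)
    qed
    also have "\<dots> = (\<Sum>f\<in>?F. \<Sum>g\<in>?F. \<Prod>s\<in>S. W \<omega> $$ (f s, g s) * A s $$ (g s, f (\<sigma> s)))"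
      using S(1) by (subst prod_sum_PiE) auto
    finally show ?thesis by (simp add: prod.distrib)
  qed
  have wick: "integrable M (?W f g)"
    "integral\<^sup>L M (?W f g) = complex_of_real ((1 / sqrt (real N)) ^ card S) *
        (\<Sum>p\<in>pairings S. if \<forall>m\<in>S. f m = g (p m) then 1 else 0)"
    if "f \<in> ?F" "g \<in> ?F" for f g
    using GUE_wick[OF gue S(1), of f g] that by auto
  have int: "integrable M (\<lambda>\<omega>. \<Sum>f\<in>?F. \<Sum>g\<in>?F. ?W f g \<omega> * ?a f g)"
    using wick(1) by (intro Bochner_Integration.integrable_sum integrable_mult_left) auto
  then show "integrable M (\<lambda>\<omega>. trace_product N (\<lambda>s. W \<omega> * A s) S \<sigma>)"
    by (subst Bochner_Integration.integrable_cong[OF refl expand]) auto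
  let ?r = "complex_of_real ((1 / sqrt (real N)) ^ card S)"
  have "integral\<^sup>L M (\<lambda>\<omega>. trace_product N (\<lambda>s. W \<omega> * A s) S \<sigma>) =
    integral\<^sup>L M (\<lambda>\<omega>. \<Sum>f\<in>?F. \<Sum>g\<in>?F. ?W f g \<omega> * ?a f g)"
    by (intro Bochner_Integration.integral_cong refl expand)
  also have "\<dots> = (\<Sum>f\<in>?F. \<Sum>g\<in>?F. integral\<^sup>L M (?W f g) * ?a f g)"
    using wick(1) by (simp add: Bochner_Integration.integral_sum Bochner_Integration.integrable_sum)
  also have "\<dots> = (\<Sum>f\<in>?F. \<Sum>g\<in>?F. \<Sum>p\<in>pairings S. ?r * (if \<forall>m\<in>S. f m = g (p m) then ?a f g else 0))"
    using wick(2) by (intro sum.cong refl) (simp add: sum_distrib_left sum_distrib_right if_distrib if_distribR cong: if_cong)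
  also have "\<dots> = (\<Sum>p\<in>pairings S. \<Sum>g\<in>?F. \<Sum>f\<in>?F. ?r * (if \<forall>m\<in>S. f m = g (p m) then ?a f g else 0))"
    by (rule sum_rotate)
  also have "\<dots> = (\<Sum>p\<in>pairings S. ?r * trace_product N A S (p \<circ> \<sigma>))"
  proof (rule sum.cong[OF refl])
    fix p assume p: "p \<in> pairings S"
    note P = pairingsD[OF p]
    have "(\<Sum>g\<in>?F. \<Sum>f\<in>?F. ?r * (if \<forall>m\<in>S. f m = g (p m) then ?a f g else 0)) =
      (\<Sum>g\<in>?F. ?r * (\<Prod>s\<in>S. A s $$ (g s, g ((p \<circ> \<sigma>) s))))"
    proof (rule sum.cong[OF refl])
      fix g assume g: "g \<in> ?F"
      \<comment> \<open>Given \<open>g\<close>, Wick's formula leaves a single choice of the row indices.\<close>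
      define f0 where "f0 = restrict (g \<circ> p) S"
      have f0: "f0 \<in> ?F" using g P(2) by (auto simp: f0_def)
      have "(\<Sum>f\<in>?F. ?r * (if \<forall>m\<in>S. f m = g (p m) then ?a f g else 0)) = (\<Sum>f\<in>?F. if f = f0 then ?r * ?a f0 g else 0)"
      proof (rule sum.cong[OF refl])
        fix f assume f: "f \<in> ?F"
        have "(\<forall>m\<in>S. f m = g (p m)) \<longleftrightarrow> f = f0"
        proof
          assume "\<forall>m\<in>S. f m = g (p m)"
          then show "f = f0" using f f0 by (intro PiE_ext[OF f f0]) (auto simp: f0_def)
        qed (auto simp: f0_def)
        then show "?r * (if \<forall>m\<in>S. f m = g (p m) then ?a f g else 0) = (if f = f0 then ?r * ?a f0 g else 0)"
          by simp
      qed
      also have "\<dots> = ?r * ?a f0 g" using S(1) f0 by (simp add: finite_PiE)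
      also have "?a f0 g = (\<Prod>s\<in>S. A s $$ (g s, g ((p \<circ> \<sigma>) s)))"
        using \<sigma>S by (intro prod.cong refl) (simp add: f0_def)
      finally show "(\<Sum>f\<in>?F. ?r * (if \<forall>m\<in>S. f m = g (p m) then ?a f g else 0)) =
        ?r * (\<Prod>s\<in>S. A s $$ (g s, g ((p \<circ> \<sigma>) s)))" .
    qed
    also have "\<dots> = ?r * trace_product N A S (p \<circ> \<sigma>)"
      unfolding trace_product_def sum_distrib_left[symmetric]
      by (subst trace_expansion[OF S(1) permutes_compose[OF S(2) P(1)] A gue(2)]) auto
    finally show "(\<Sum>g\<in>?F. \<Sum>f\<in>?F. ?r * (if \<forall>m\<in>S. f m = g (p m) then ?a f g else 0)) =
      ?r * trace_product N A S (p \<circ> \<sigma>)" .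
  qed
  finally show "integral\<^sup>L M (\<lambda>\<omega>. trace_product N (\<lambda>s. W \<omega> * A s) S \<sigma>) = wick_sum N A S \<sigma> (pairings S)"
    by (simp add: wick_sum_def sum_distrib_left)
qed

lemma trace_product_union:
  assumes dis: "S1 \<inter> S2 = {}" and fin: "finite S1" "finite S2"
    and 1: "\<sigma>1 permutes S1" "\<And>s. s \<in> S1 \<Longrightarrow> \<sigma> s = \<sigma>1 s"
    and 2: "\<sigma>2 permutes S2" "\<And>s. s \<in> S2 \<Longrightarrow> \<sigma> s = \<sigma>2 s"
  shows "trace_product N A (S1 \<union> S2) \<sigma> = trace_product N A S1 \<sigma>1 * trace_product N A S2 \<sigma>2"
proof -
  have part: "trace_product N A S \<tau> = (\<Prod>C\<in>cycle_sets S \<tau>. of_nat N * cycle_ntrace N A \<sigma> C)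
      \<and> cycle_sets S \<tau> = cycle_sets S \<sigma>"
    if \<tau>: "\<tau> permutes S" "\<And>s. s \<in> S \<Longrightarrow> \<sigma> s = \<tau> s" and S: "finite S" for S \<tau>
  proof
    show "cycle_sets S \<tau> = cycle_sets S \<sigma>" by (rule cycle_sets_cong) (use \<tau> in auto)
    show "trace_product N A S \<tau> = (\<Prod>C\<in>cycle_sets S \<tau>. of_nat N * cycle_ntrace N A \<sigma> C)"
      unfolding trace_product_def
    proof (intro prod.cong refl arg_cong2[where f = "(*)"])
      fix C assume "C \<in> cycle_sets S \<tau>"
      then obtain x where x: "x \<in> S" "C = orbit \<tau> x" by (auto simp: cycle_sets_def)
      have CS: "C \<subseteq> S" unfolding x by (rule permutes_orbit_subset[OF \<tau>(1) x(1)])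
      have "Min C \<in> C"
        using finite_subset[OF CS S] orbit_self[OF S \<tau>(1), of x] x(2) by (intro Min_in) auto
      then show "cycle_ntrace N A \<tau> C = cycle_ntrace N A \<sigma> C"
        using \<tau>(2) CS unfolding x(2) by (intro cycle_ntrace_cong) (auto intro: orbit.step)
    qed
  qed
  have dis': "cycle_sets S1 \<sigma>1 \<inter> cycle_sets S2 \<sigma>2 = {}"
  proof -
    have "C \<subseteq> S1 \<and> C \<noteq> {}" if "C \<in> cycle_sets S1 \<sigma>1" for C
      using that permutes_orbit_subset[OF 1(1)] orbit_nonempty[of \<sigma>1] by (auto simp: cycle_sets_def)
    moreover have "C \<subseteq> S2" if "C \<in> cycle_sets S2 \<sigma>2" for C
      using that permutes_orbit_subset[OF 2(1)] by (auto simp: cycle_sets_def)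
    ultimately show ?thesis using dis by blast
  qed
  have un: "cycle_sets (S1 \<union> S2) \<sigma> = cycle_sets S1 \<sigma>1 \<union> cycle_sets S2 \<sigma>2"
    using part[OF 1 fin(1)] part[OF 2 fin(2)] by (simp add: cycle_sets_def image_Un)
  have fin': "finite (cycle_sets S1 \<sigma>1)" "finite (cycle_sets S2 \<sigma>2)" using fin by (auto simp: cycle_sets_def)
  have "trace_product N A (S1 \<union> S2) \<sigma> =
      (\<Prod>C\<in>cycle_sets S1 \<sigma>1. of_nat N * cycle_ntrace N A \<sigma> C) * (\<Prod>C\<in>cycle_sets S2 \<sigma>2. of_nat N * cycle_ntrace N A \<sigma> C)"
    unfolding trace_product_def un by (rule prod.union_disjoint[OF fin' dis'])
  then show ?thesis using part[OF 1 fin(1)] part[OF 2 fin(2)] by simp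
qed

text \<open>
A pairing that maps \<open>S1\<close> to itself splits into pairings of \<open>S1\<close> and \<open>S2\<close>.
\<close>

lemma sum_pairings_union:
  assumes dis: "S1 \<inter> S2 = {}"
  shows "(\<Sum>p1\<in>pairings S1. \<Sum>p2\<in>pairings S2. F (p1 \<circ> p2)) =
    (\<Sum>p\<in>{p \<in> pairings (S1 \<union> S2). \<forall>x\<in>S1. p x \<in> S1}. F p)"
proof -
  have "(\<Sum>p1\<in>pairings S1. \<Sum>p2\<in>pairings S2. F (p1 \<circ> p2)) = (\<Sum>(p1, p2)\<in>pairings S1 \<times> pairings S2. F (p1 \<circ> p2))"
    by (rule sum.cartesian_product)
  also have "\<dots> = (\<Sum>p\<in>{p \<in> pairings (S1 \<union> S2). \<forall>x\<in>S1. p x \<in> S1}. F p)"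
  proof (rule sum.reindex_bij_witness[where j = "\<lambda>(p1, p2). p1 \<circ> p2"
        and i = "\<lambda>p. (perm_restrict p S1, perm_restrict p S2)"])
    fix pp assume "pp \<in> pairings S1 \<times> pairings S2"
    then obtain p1 p2 where pp: "pp = (p1, p2)" and p: "p1 \<in> pairings S1" "p2 \<in> pairings S2" by auto
    note P1 = pairingsD[OF p(1)] and P2 = pairingsD[OF p(2)]
    have on1: "(p1 \<circ> p2) x = p1 x" if "x \<in> S1" for x
      using that P2(1) dis by (auto simp: permutes_def)
    have on2: "(p1 \<circ> p2) x = p2 x" if "x \<in> S2" for x
      using P2(2)[OF that] P1(1) dis by (auto simp: permutes_def)
    have "p1 \<circ> p2 permutes S1 \<union> S2"
      using P1(1) P2(1) by (intro permutes_compose) (auto intro: permutes_subset)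
    moreover have "(p1 \<circ> p2) x \<noteq> x \<and> (p1 \<circ> p2) ((p1 \<circ> p2) x) = x" if "x \<in> S1 \<union> S2" for x
      using that
    proof
      assume x: "x \<in> S1"
      show ?thesis using on1[OF x] on1[OF P1(2)[OF x]] P1(3)[OF x] P1(4)[of x] by simp
    next
      assume x: "x \<in> S2"
      show ?thesis using on2[OF x] on2[OF P2(2)[OF x]] P2(3)[OF x] P2(4)[of x] by simp
    qed
    ultimately show "(case pp of (p1, p2) \<Rightarrow> p1 \<circ> p2) \<in> {p \<in> pairings (S1 \<union> S2). \<forall>x\<in>S1. p x \<in> S1}"
      using on1 P1(2) pp by (auto simp: pairings_def)
    have "perm_restrict (p1 \<circ> p2) S1 = p1"
      using on1 P1(1) by (auto simp: perm_restrict_def fun_eq_iff permutes_def)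
    moreover have "perm_restrict (p1 \<circ> p2) S2 = p2"
      using on2 P2(1) by (auto simp: perm_restrict_def fun_eq_iff permutes_def)
    ultimately show "(\<lambda>p. (perm_restrict p S1, perm_restrict p S2)) (case pp of (p1, p2) \<Rightarrow> p1 \<circ> p2) = pp"
      using pp by simp
  next
    fix p assume "p \<in> {p \<in> pairings (S1 \<union> S2). \<forall>x\<in>S1. p x \<in> S1}"
    then have p: "p \<in> pairings (S1 \<union> S2)" and 1: "\<And>x. x \<in> S1 \<Longrightarrow> p x \<in> S1" by auto
    note P = pairingsD[OF p]
    have 2: "p x \<in> S2" if "x \<in> S2" for x using P(2)[of x] P(4)[of x] 1[of "p x"] that dis by auto
    have restr: "perm_restrict p T \<in> pairings T" if T: "T \<subseteq> S1 \<union> S2" "\<And>x. x \<in> T \<Longrightarrow> p x \<in> T" for T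
    proof -
      have inv: "perm_restrict p T (perm_restrict p T x) = x" for x
        using T(2) P(4) by (auto simp: perm_restrict_def)
      have "bij (perm_restrict p T)" by (rule o_bij[of "perm_restrict p T"]) (auto simp: fun_eq_iff inv)
      then have "perm_restrict p T permutes T"
        by (auto simp: permutes_def perm_restrict_def bij_iff)
      moreover have "perm_restrict p T x \<noteq> x" if "x \<in> T" for x
        using P(3)[of x] T(1) that by (auto simp: perm_restrict_def)
      ultimately show ?thesis using inv by (auto simp: pairings_def)
    qed
    show "(perm_restrict p S1, perm_restrict p S2) \<in> pairings S1 \<times> pairings S2"
      using restr[of S1] restr[of S2] 1 2 by auto
    show "(case (perm_restrict p S1, perm_restrict p S2) of (p1, p2) \<Rightarrow> p1 \<circ> p2) = p"
      using 2 P(1) dis by (auto simp: perm_restrict_def fun_eq_iff permutes_def)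
  qed auto
  finally show ?thesis .
qed

section \<open>The covariance and its limit\<close>

lemma cycle_ntrace_interval:
  assumes "a < b" "\<And>j. a \<le> j \<Longrightarrow> Suc j < b \<Longrightarrow> \<sigma> j = Suc j"
  shows "cycle_ntrace N B \<sigma> {a..<b} = ntrace (mat_prod_list N (map B [a..<b]))"
proof -
  have Min: "Min {a..<b} = a" using assms(1) by (intro Min_eqI) auto
  have iter: "(\<sigma> ^^ i) a = a + i" if "i < b - a" for i
    using that by (induction i) (auto simp: assms(2))
  have "map (\<lambda>i. B ((\<sigma> ^^ i) a)) [0..<b - a] = map B [a..<b]"
    by (rule nth_equalityI) (use iter in auto)
  then show ?thesis by (simp add: cycle_ntrace_def Min)
qed

definition outer_labels :: "nat \<Rightarrow> nat set" where "outer_labels k = {1..<k + 1}"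

definition inner_labels :: "nat \<Rightarrow> nat \<Rightarrow> nat set" where "inner_labels k l = {k + 1..<k + l + 1}"

lemma labels_split:
  "{1..k + l} = outer_labels k \<union> inner_labels k l" "outer_labels k \<inter> inner_labels k l = {}"
  "finite (outer_labels k)" "finite (inner_labels k l)"
  by (auto simp: outer_labels_def inner_labels_def)

lemma restricted_rotation:
  assumes "k \<ge> 1" "l \<ge> 1" and T: "T = outer_labels k \<or> T = inner_labels k l"
  shows "perm_restrict (annular_rotation k l) T permutes T"
    and "cycle_sets T (perm_restrict (annular_rotation k l) T) = {T}"
proof -
  let ?\<gamma> = "annular_rotation k l"
  have T_side: "x \<in> T \<Longrightarrow> y \<in> {1..k + l} \<Longrightarrow> y \<in> T \<longleftrightarrow> side k y = side k x" for x y
    using T by (auto simp: outer_labels_def inner_labels_def side_def)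
  have TS: "T \<subseteq> {1..k + l}" using T labels_split(1) by auto
  have closed: "?\<gamma> x \<in> T" if "x \<in> T" for x
    using T_side[OF that, of "?\<gamma> x"] annular_rotation_successor[OF assms(1,2)] that TS
      permutes_in_image[OF annular_rotation_permutes[of k l], of x]
    by (auto simp: successor_on_def)
  have fin: "finite T" using TS finite_subset by blast
  have "inj_on ?\<gamma> T" using permutes_inj[OF annular_rotation_permutes] by (rule inj_on_subset) auto
  moreover from endo_inj_surj[OF fin _ this] closed have "?\<gamma> ` T = T" by blast
  ultimately have "bij_betw ?\<gamma> T T" by (simp add: bij_betw_def)
  then have "bij_betw (perm_restrict ?\<gamma> T) T T"
    by (rule bij_betw_cong[THEN iffD1, rotated]) (simp add: perm_restrict_def)
  then show perm: "perm_restrict ?\<gamma> T permutes T"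
    by (rule bij_imp_permutes) (simp add: perm_restrict_def)
  have "orbit (perm_restrict ?\<gamma> T) x = T" if x: "x \<in> T" for x
  proof -
    have "orbit (perm_restrict ?\<gamma> T) x = orbit ?\<gamma> x"
      by (rule orbit_cong0[of x T]) (use x closed in \<open>auto simp: perm_restrict_def\<close>)
    moreover have "y \<in> orbit ?\<gamma> x" if y: "y \<in> T" for y
      by (rule annular_rotation_orbit[OF assms(1,2)]) (use x y TS T_side[OF x, of y] in auto)
    ultimately show ?thesis using permutes_orbit_subset[OF perm x] by auto
  qed
  moreover have "T \<noteq> {}" using T assms(1,2) by (auto simp: outer_labels_def inner_labels_def)
  ultimately show "cycle_sets T (perm_restrict ?\<gamma> T) = {T}" by (auto simp: cycle_sets_def)
qed

lemma word_trace_as_trace_product: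
  assumes "k \<ge> 1" "l \<ge> 1" "T = {a..<b}" "T = outer_labels k \<or> T = inner_labels k l"
  shows "trace_product N (\<lambda>s. H * A s) T (perm_restrict (annular_rotation k l) T) =
    of_nat N * word_trace N H (map A [a..<b])"
proof -
  have "T \<noteq> {}" using assms(1,2,4) by (auto simp: outer_labels_def inner_labels_def)
  then have ab: "a < b" using assms(3) by simp
  have next_label: "perm_restrict (annular_rotation k l) T j = Suc j" if "a \<le> j" "Suc j < b" for j
  proof -
    have "j \<in> T" "Suc j \<in> T" using that assms(3) by auto
    then show ?thesis using assms(1,2,4)
      by (auto simp: perm_restrict_def annular_rotation_eq outer_labels_def inner_labels_def)
  qed
  show ?thesis
    unfolding trace_product_def restricted_rotation(2)[OF assms(1,2,4)] word_trace_def
    using cycle_ntrace_interval[OF ab next_label] assms(3) by (simp add: o_def)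
qed

definition linking_pairings :: "nat \<Rightarrow> nat \<Rightarrow> (nat \<Rightarrow> nat) set" where
  "linking_pairings k l = {p \<in> pairings {1..k + l}. \<exists>x\<in>{1..k + l}. side k (p x) \<noteq> side k x}"

text \<open>
Pairings of the two circles combine to the pairings of all labels that preserve the circles. So these are
the terms that cancel in the covariance.
\<close>

lemma wick_sum_product:
  assumes k: "k \<ge> 1" "l \<ge> 1"
  defines "\<gamma> \<equiv> annular_rotation k l"
  shows "wick_sum N A (outer_labels k) (perm_restrict \<gamma> (outer_labels k)) (pairings (outer_labels k)) *
     wick_sum N A (inner_labels k l) (perm_restrict \<gamma> (inner_labels k l)) (pairings (inner_labels k l)) =
     wick_sum N A {1..k + l} \<gamma> (pairings {1..k + l} - linking_pairings k l)"
proof -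
  let ?S1 = "outer_labels k" and ?S2 = "inner_labels k l"
  let ?g1 = "perm_restrict \<gamma> ?S1" and ?g2 = "perm_restrict \<gamma> ?S2"
  note L = labels_split(1)[of k l] labels_split(2)[of k l] labels_split(3)[of k] labels_split(4)[of k l]
  have g1: "?g1 permutes ?S1" and g2: "?g2 permutes ?S2"
    unfolding \<gamma>_def by (rule restricted_rotation(1)[OF k]; simp)+
  have split: "trace_product N A ?S1 (p1 \<circ> ?g1) * trace_product N A ?S2 (p2 \<circ> ?g2) =
     trace_product N A {1..k + l} ((p1 \<circ> p2) \<circ> \<gamma>)"
    if p: "p1 \<in> pairings ?S1" "p2 \<in> pairings ?S2" for p1 p2
  proof -
    note P1 = pairingsD[OF p(1)] and P2 = pairingsD[OF p(2)]
    have "((p1 \<circ> p2) \<circ> \<gamma>) s = (p1 \<circ> ?g1) s" if s: "s \<in> ?S1" for s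
    proof -
      have "\<gamma> s = ?g1 s" using s by (simp add: perm_restrict_def)
      moreover have "?g1 s \<in> ?S1" using s by (simp only: permutes_in_image[OF g1])
      ultimately have e: "\<gamma> s = ?g1 s" "p2 (\<gamma> s) = \<gamma> s" using P2(1) L(2) by (auto simp: permutes_def)
      then show ?thesis by simp
    qed
    moreover have "((p1 \<circ> p2) \<circ> \<gamma>) s = (p2 \<circ> ?g2) s" if s: "s \<in> ?S2" for s
    proof -
      have "\<gamma> s = ?g2 s" using s by (simp add: perm_restrict_def)
      moreover have "?g2 s \<in> ?S2" using s by (simp only: permutes_in_image[OF g2])
      ultimately have e: "\<gamma> s = ?g2 s" "p1 (p2 (\<gamma> s)) = p2 (\<gamma> s)" using P1(1) P2(2) L(2) by (auto simp: permutes_def)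
      then show ?thesis by simp
    qed
    ultimately show ?thesis
      unfolding L(1)
      by (intro trace_product_union[symmetric] L permutes_compose[OF g1 P1(1)] permutes_compose[OF g2 P2(1)])
  qed
  have keep: "{p \<in> pairings (?S1 \<union> ?S2). \<forall>x\<in>?S1. p x \<in> ?S1} = pairings {1..k + l} - linking_pairings k l"
  proof -
    have "(\<forall>x\<in>?S1. p x \<in> ?S1) \<longleftrightarrow> \<not> (\<exists>x\<in>{1..k + l}. side k (p x) \<noteq> side k x)"
      if p: "p \<in> pairings {1..k + l}" for p
    proof -
      note P = pairingsD[OF p]
      have out: "x \<in> ?S1 \<longleftrightarrow> side k x = 1" if "x \<in> {1..k + l}" for x
        using that by (auto simp: outer_labels_def side_def)
      show ?thesis
      proof
        assume all: "\<forall>x\<in>?S1. p x \<in> ?S1"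
        have "x \<in> ?S1 \<longleftrightarrow> p x \<in> ?S1" for x using all P(4)[of x] by metis
        then show "\<not> (\<exists>x\<in>{1..k + l}. side k (p x) \<noteq> side k x)"
          using out P(2) side_cases by metis
      next
        assume "\<not> (\<exists>x\<in>{1..k + l}. side k (p x) \<noteq> side k x)"
        then show "\<forall>x\<in>?S1. p x \<in> ?S1" using out P(2) L(1) by (metis UnI1)
      qed
    qed
    then show ?thesis unfolding linking_pairings_def L(1)[symmetric] by blast
  qed
  have card: "card {1..k + l} = card ?S1 + card ?S2" by (simp add: outer_labels_def inner_labels_def)
  have "(\<Sum>p1\<in>pairings ?S1. trace_product N A ?S1 (p1 \<circ> ?g1)) * (\<Sum>p2\<in>pairings ?S2. trace_product N A ?S2 (p2 \<circ> ?g2)) =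
    (\<Sum>p1\<in>pairings ?S1. \<Sum>p2\<in>pairings ?S2. trace_product N A {1..k + l} ((p1 \<circ> p2) \<circ> \<gamma>))"
    unfolding sum_product by (intro sum.cong refl split)
  also have "\<dots> = (\<Sum>p\<in>pairings {1..k + l} - linking_pairings k l. trace_product N A {1..k + l} (p \<circ> \<gamma>))"
    unfolding sum_pairings_union[OF L(2), of "\<lambda>p. trace_product N A {1..k + l} (p \<circ> \<gamma>)"] keep ..
  finally show ?thesis
    unfolding wick_sum_def card power_add of_real_mult by (simp only: mult_ac)
qed

text \<open>
An exact identity for every \<open>N\<close>; the limit only compares powers of \<open>N\<close>.
\<close>

theorem covariance_formula:
  assumes k: "k \<ge> 1" "l \<ge> 1" and gue: "GUE N M W" "N \<ge> 1"
    and A: "\<And>j. j \<in> {1..k + l} \<Longrightarrow> A j \<in> carrier_mat N N"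
  defines "X\<alpha> \<equiv> \<lambda>\<omega>. word_trace N (W \<omega>) (map A [1..<k + 1])"
    and "X\<beta> \<equiv> \<lambda>\<omega>. word_trace N (W \<omega>) (map A [k + 1..<k + l + 1])"
  shows "(of_nat N)\<^sup>2 * (\<integral>\<omega>. centred M X\<alpha> \<omega> * centred M X\<beta> \<omega> \<partial>M) =
    wick_sum N A {1..k + l} (annular_rotation k l) (linking_pairings k l)"
proof -
  interpret prob_space M using gue(1) by (simp add: GUE_def)
  let ?\<gamma> = "annular_rotation k l" and ?S = "{1..k + l}" and ?S1 = "outer_labels k" and ?S2 = "inner_labels k l"
  let ?g1 = "perm_restrict ?\<gamma> ?S1" and ?g2 = "perm_restrict ?\<gamma> ?S2"
  note L = labels_split(1)[of k l] labels_split(2)[of k l] labels_split(3)[of k] labels_split(4)[of k l]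
  have g1: "?g1 permutes ?S1" and g2: "?g2 permutes ?S2" by (rule restricted_rotation(1)[OF k]; simp)+
  define Z1 Z2 Z where "Z1 \<omega> = trace_product N (\<lambda>s. W \<omega> * A s) ?S1 ?g1"
    and "Z2 \<omega> = trace_product N (\<lambda>s. W \<omega> * A s) ?S2 ?g2"
    and "Z \<omega> = trace_product N (\<lambda>s. W \<omega> * A s) ?S ?\<gamma>" for \<omega>
  have X: "X\<alpha> \<omega> = Z1 \<omega> / of_nat N" "X\<beta> \<omega> = Z2 \<omega> / of_nat N" for \<omega>
    using word_trace_as_trace_product[OF k, of ?S1 1 "k + 1" N "W \<omega>" A]
      word_trace_as_trace_product[OF k, of ?S2 "k + 1" "k + l + 1" N "W \<omega>" A] gue(2)
    by (simp_all add: X\<alpha>_def X\<beta>_def Z1_def Z2_def outer_labels_def inner_labels_def)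
  have Z: "Z1 \<omega> * Z2 \<omega> = Z \<omega>" for \<omega>
    unfolding Z_def Z1_def Z2_def L(1)
    by (rule trace_product_union[symmetric, OF L(2-4) g1 _ g2]) (simp_all add: perm_restrict_def)
  have A1: "A s \<in> carrier_mat N N" if "s \<in> ?S1" for s using A that L(1) by blast
  have A2: "A s \<in> carrier_mat N N" if "s \<in> ?S2" for s using A that L(1) by blast
  have E1: "integrable M Z1" "integral\<^sup>L M Z1 = wick_sum N A ?S1 ?g1 (pairings ?S1)"
    unfolding Z1_def[abs_def] by (rule expectation_trace_product[OF gue L(3) g1]; use A1 in blast)+
  have E2: "integrable M Z2" "integral\<^sup>L M Z2 = wick_sum N A ?S2 ?g2 (pairings ?S2)"
    unfolding Z2_def[abs_def] by (rule expectation_trace_product[OF gue L(4) g2]; use A2 in blast)+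
  have E: "integrable M Z" "integral\<^sup>L M Z = wick_sum N A ?S ?\<gamma> (pairings ?S)"
    unfolding Z_def[abs_def]
    by (rule expectation_trace_product[OF gue finite_atLeastAtMost annular_rotation_permutes]; use A in blast)+
  let ?n = "of_nat N :: complex" and ?e1 = "integral\<^sup>L M Z1" and ?e2 = "integral\<^sup>L M Z2"
  have n: "?n \<noteq> 0" using gue(2) by simp
  have mean: "integral\<^sup>L M X\<alpha> = ?e1 / ?n" "integral\<^sup>L M X\<beta> = ?e2 / ?n"
    unfolding X by simp_all
  have "?n\<^sup>2 * (centred M X\<alpha> \<omega> * centred M X\<beta> \<omega>) = Z \<omega> - ?e2 * Z1 \<omega> - ?e1 * Z2 \<omega> + ?e1 * ?e2" for \<omega>
    unfolding centred_def mean X Z[symmetric] using n by (simp add: field_simps power2_eq_square)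
  then have "?n\<^sup>2 * (\<integral>\<omega>. centred M X\<alpha> \<omega> * centred M X\<beta> \<omega> \<partial>M) =
     (\<integral>\<omega>. Z \<omega> - ?e2 * Z1 \<omega> - ?e1 * Z2 \<omega> + ?e1 * ?e2 \<partial>M)"
    by (simp flip: integral_mult_right_zero)
  also have "\<dots> = integral\<^sup>L M Z - ?e1 * ?e2"
    using E(1) E1(1) E2(1) by (simp add: prob_space mult.commute)
  also have "\<dots> = wick_sum N A ?S ?\<gamma> (pairings ?S) - wick_sum N A ?S ?\<gamma> (pairings ?S - linking_pairings k l)"
    unfolding E(2) E1(2) E2(2) wick_sum_product[OF k] ..
  also have "\<dots> = wick_sum N A ?S ?\<gamma> (linking_pairings k l)"
  proof -
    have "linking_pairings k l \<subseteq> pairings ?S" by (auto simp: linking_pairings_def)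
    then show ?thesis unfolding wick_sum_def
      by (subst sum.subset_diff[OF _ finite_pairings[of ?S]]) (auto simp: algebra_simps)
  qed
  finally show ?thesis .
qed

text \<open>
The summand of a linking pairing \<open>p\<close> carries the factor \<open>N powr (c - (k + l) / 2)\<close>, where \<open>c\<close> is the number
of cycles of \<open>p \<circ> \<gamma>\<close>. This is \<open>1\<close> for the annular non-crossing pairings. For the others it is at
most \<open>1 / sqrt N\<close>, and they vanish in the limit, because their normalised traces are bounded.
\<close>

theorem corollary2p11:
  fixes k l :: nat
    and M :: "nat \<Rightarrow> 'w measure"
    and W :: "nat \<Rightarrow> 'w \<Rightarrow> complex mat"
    and A :: "nat \<Rightarrow> nat \<Rightarrow> complex mat"
    and Y\<alpha> Y\<beta> :: "nat \<Rightarrow> 'w \<Rightarrow> complex"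
  assumes "k \<ge> 1" and "l \<ge> 1"
    and "\<And>N. N \<ge> 1 \<Longrightarrow> GUE N (M N) (W N)"
    and "\<And>N j. N \<ge> 1 \<Longrightarrow> j \<in> {1..k + l} \<Longrightarrow> A N j \<in> carrier_mat N N"
    and "\<exists>c. \<forall>N\<ge>1. \<forall>j\<in>{1..k + l}. operator_norm (A N j) \<le> c"
  defines "Y\<alpha> \<equiv> \<lambda>N. centred (M N) (\<lambda>\<omega>. word_trace N (W N \<omega>) (map (A N) [1..<k + 1]))"
    and "Y\<beta> \<equiv> \<lambda>N. centred (M N) (\<lambda>\<omega>. word_trace N (W N \<omega>) (map (A N) [k + 1..<k + l + 1]))"
  shows "(\<lambda>N. (of_nat N)\<^sup>2 * (\<integral>\<omega>. Y\<alpha> N \<omega> * Y\<beta> N \<omega> \<partial>M N)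
            - (\<Sum>p\<in>annular_NCP2 k l.
                 \<Prod>B\<in>cycle_sets {1..k + l} (annular_Kreweras k l p).
                   cycle_ntrace N (A N) (annular_Kreweras k l p) B)) \<longlonglongrightarrow> 0"
proof -
  let ?S = "{1..k + l}" and ?\<gamma> = "annular_rotation k l"
  let ?c = "\<lambda>p. card (cycle_sets ?S (p \<circ> ?\<gamma>))"
  obtain c0 where c0: "\<And>N j. N \<ge> 1 \<Longrightarrow> j \<in> ?S \<Longrightarrow> operator_norm (A N j) \<le> c0" using assms(5) by blast
  \<comment> \<open>A bound at least \<open>1\<close> has increasing powers, so products of different lengths share one bound.\<close>
  define c where "c = max 1 c0"
  have c: "c \<ge> 1" "\<And>N j. N \<ge> 1 \<Longrightarrow> j \<in> ?S \<Longrightarrow> operator_norm (A N j) \<le> c"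
    using c0 by (auto simp: c_def intro: max.coboundedI2)
  define T where "T N p = (\<Prod>B\<in>cycle_sets ?S (p \<circ> ?\<gamma>). cycle_ntrace N (A N) (p \<circ> ?\<gamma>) B)" for N p
  \<comment> \<open>The contribution of \<open>p\<close>; on linking pairings the truncated subtraction in the exponent is exact.\<close>
  define R where "R N p = complex_of_real ((1 / sqrt (real N)) ^ (k + l - 2 * ?c p)) * T N p" for N p
  have NCP2: "annular_NCP2 k l = {p \<in> linking_pairings k l. 2 * ?c p = k + l}"
    unfolding annular_NCP2_eq[OF assms(1,2)] by (auto simp: linking_pairings_def)
  have fin: "finite (linking_pairings k l)"
    using finite_pairings[of ?S] by (auto simp: linking_pairings_def)
  have bound: "2 * ?c p \<le> k + l" if "p \<in> linking_pairings k l" for p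
  proof -
    from that obtain x where p: "p \<in> pairings ?S" and x: "x \<in> ?S" "side k (p x) \<noteq> side k x"
      by (auto simp: linking_pairings_def)
    show ?thesis
      using linked_cycle_bound[OF _ annular_rotation_permutes p connected_pairing_linked[OF assms(1,2) p x]] by simp
  qed
  have summand: "complex_of_real ((1 / sqrt (real N)) ^ card ?S) * trace_product N (A N) ?S (p \<circ> ?\<gamma>) = R N p"
    if N: "N \<ge> 1" and p: "p \<in> linking_pairings k l" for N p
  proof -
    have factor: "trace_product N (A N) ?S (p \<circ> ?\<gamma>) = of_nat N ^ ?c p * T N p"
      by (simp add: trace_product_def T_def prod.distrib)
    have scale: "(1 / sqrt (real N)) ^ card ?S * real N ^ ?c p = (1 / sqrt (real N)) ^ (k + l - 2 * ?c p)"
    proof -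
      define m where "m = ?c p"
      have "2 * m \<le> card ?S" using bound[OF p] by (simp add: m_def)
      then have "(1 / sqrt (real N)) ^ card ?S = (1 / sqrt (real N)) ^ (card ?S - 2 * m) * (1 / sqrt (real N)) ^ (2 * m)"
        by (metis le_add_diff_inverse2 power_add)
      also have "(1 / sqrt (real N)) ^ (2 * m) = (1 / real N) ^ m"
        by (simp add: power_mult power_divide)
      finally show ?thesis using N unfolding m_def[symmetric] by (simp add: power_divide)
    qed
    have "complex_of_real ((1 / sqrt (real N)) ^ card ?S) * of_nat N ^ ?c p =
        complex_of_real ((1 / sqrt (real N)) ^ card ?S * real N ^ ?c p)"
      by (simp only: of_real_mult of_real_power of_real_of_nat_eq)
    then show ?thesis by (simp only: R_def factor mult.assoc[symmetric] scale)
  qed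
  have Krew: "annular_Kreweras k l p = p \<circ> ?\<gamma>" if "p \<in> annular_NCP2 k l" for p
  proof -
    have "p \<in> pairings ?S" using that unfolding NCP2 by (simp add: linking_pairings_def)
    then have "inv_into UNIV p = p" using pairingsD(4) by (intro inv_unique_comp) (auto simp: fun_eq_iff)
    then show ?thesis by (simp add: annular_Kreweras_def)
  qed
  have main: "(of_nat N)\<^sup>2 * (\<integral>\<omega>. Y\<alpha> N \<omega> * Y\<beta> N \<omega> \<partial>M N) -
      (\<Sum>p\<in>annular_NCP2 k l. \<Prod>B\<in>cycle_sets ?S (annular_Kreweras k l p). cycle_ntrace N (A N) (annular_Kreweras k l p) B) =
      (\<Sum>p\<in>linking_pairings k l - annular_NCP2 k l. R N p)" if N: "N \<ge> 1" for N
  proof -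
    have "(of_nat N)\<^sup>2 * (\<integral>\<omega>. Y\<alpha> N \<omega> * Y\<beta> N \<omega> \<partial>M N) = wick_sum N (A N) ?S ?\<gamma> (linking_pairings k l)"
      unfolding Y\<alpha>_def Y\<beta>_def by (rule covariance_formula) (use assms(1-4) N in auto)
    also have "\<dots> = (\<Sum>p\<in>linking_pairings k l. R N p)"
      unfolding wick_sum_def sum_distrib_left by (intro sum.cong refl summand N)
    also have "\<dots> = (\<Sum>p\<in>linking_pairings k l - annular_NCP2 k l. R N p) + (\<Sum>p\<in>annular_NCP2 k l. R N p)"
      by (rule sum.subset_diff) (use fin in \<open>auto simp: NCP2\<close>)
    also have "(\<Sum>p\<in>annular_NCP2 k l. R N p) =
      (\<Sum>p\<in>annular_NCP2 k l. \<Prod>B\<in>cycle_sets ?S (annular_Kreweras k l p). cycle_ntrace N (A N) (annular_Kreweras k l p) B)"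
    proof (intro sum.cong refl)
      fix p assume p: "p \<in> annular_NCP2 k l"
      then have "k + l - 2 * ?c p = 0" by (simp add: NCP2)
      then show "R N p = (\<Prod>B\<in>cycle_sets ?S (annular_Kreweras k l p). cycle_ntrace N (A N) (annular_Kreweras k l p) B)"
        unfolding Krew[OF p] R_def T_def by simp
    qed
    finally show ?thesis by simp
  qed
  have small: "(\<lambda>N. R N p) \<longlonglongrightarrow> 0" if p: "p \<in> linking_pairings k l - annular_NCP2 k l" for p
  proof (rule Lim_null_comparison)
    have perm: "(p \<circ> ?\<gamma>) permutes ?S"
      using p pairingsD(1) annular_rotation_permutes unfolding linking_pairings_def by (auto intro!: permutes_compose)
    have e: "k + l - 2 * ?c p \<ge> 1" using p bound[of p] by (auto simp: NCP2)
    show "\<forall>\<^sub>F N in sequentially. norm (R N p) \<le> (1 / sqrt (real N)) * (c ^ card ?S) ^ ?c p"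
    proof (rule eventually_sequentiallyI[of 1])
      fix N :: nat assume N: "1 \<le> N"
      have "cmod (T N p) \<le> (\<Prod>B\<in>cycle_sets ?S (p \<circ> ?\<gamma>). c ^ card ?S)"
        unfolding T_def prod_norm[symmetric]
        using cycle_ntrace_bound[OF finite_atLeastAtMost perm _ c(1) N assms(4)[OF N] c(2)[OF N]]
        by (intro prod_mono) auto
      then have T: "cmod (T N p) \<le> (c ^ card ?S) ^ ?c p" by simp
      have "sqrt (real N) \<ge> 1" using N by simp
      then have "(1 / sqrt (real N)) ^ (k + l - 2 * ?c p) \<le> (1 / sqrt (real N)) ^ 1"
        using e by (intro power_decreasing) auto
      then show "norm (R N p) \<le> (1 / sqrt (real N)) * (c ^ card ?S) ^ ?c p"
        unfolding R_def norm_mult norm_of_real using T by (intro mult_mono) auto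
    qed
    have "(\<lambda>N. 1 / sqrt (real N)) \<longlonglongrightarrow> 0"
      by (intro tendsto_divide_0[OF tendsto_const] filterlim_at_top_imp_at_infinity
          filterlim_compose[OF sqrt_at_top filterlim_real_sequentially])
    from tendsto_mult_left_zero[OF this] show "(\<lambda>N. (1 / sqrt (real N)) * (c ^ card ?S) ^ ?c p) \<longlonglongrightarrow> 0" .
  qed
  have "(\<lambda>N. \<Sum>p\<in>linking_pairings k l - annular_NCP2 k l. R N p) \<longlonglongrightarrow> (\<Sum>p\<in>linking_pairings k l - annular_NCP2 k l. 0)"
    by (intro tendsto_sum small)
  then have "(\<lambda>N. \<Sum>p\<in>linking_pairings k l - annular_NCP2 k l. R N p) \<longlonglongrightarrow> 0" by simp
  then show ?thesis
    by (rule Lim_transform_eventually) (rule eventually_sequentiallyI[of 1], rule main[symmetric])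
qed

end
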